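(* Let $f:\mathbb{R}\to\mathbb{R}$ be locally Lipschitz continuous with $f(0)=0$ and $xf(x)>0$ for all $x\neq 0$. Suppose that there exists an odd function $\phi$ on $\mathbb{R}$ such that $\lim_{x\to 0} f(x)/\phi(x)=1$, that $f\in \mathrm{RV}_0(\beta)$ for some $\beta>1$, and that $\lim_{x\to 0^+} f(x)/x=0$. Let $\Gamma\in C^1([0,\infty);(0,\infty))$ satisfy $\lim_{t\to\infty}\Gamma(t)=+\infty$. Then there exists a continuous function $\sigma:[0,\infty)\to\mathbb{R}$ with $\sigma\in L^2([0,\infty);\mathbb{R})$ and $\sigma^2\in C^1((0,\infty);(0,\infty))$ such that $$\lim_{t\to\infty}\frac{2\int_t^\infty\sigma^2(s)\,ds\,\log\log\left(\frac{1}{\int_t^\infty\sigma^2(s)\,ds}\right)}{F^{-1}(t)^2}=0,\qquad \limsup_{t\to\infty}\frac{\sigma^2(t)}{\Gamma(t)}=1,$$ and hence the continuous adapted process $X$ which obeys $$dX(t)=-f(X(t))\,dt+\sigma(t)\,dB(t),\quad t\ge 0;\qquad X(0)=\xi,$$ with $\xi\in\mathbb{R}$ deterministic, satisfies the following: there exists an $\mathcal{F}^B(\infty)$-measurable random variable $\lambda$ such that $\mathbb{P}[\lambda\in\{-1,0,1\}]=1$ and $$\mathbb{P}\left[\lim_{t\to\infty}\frac{X(t)}{F^{-1}(t)}=\lambda\right]=1.$$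
   Context: $B$ is a one-dimensional standard Brownian motion on a complete probability space $(\Omega,\mathcal{F},\mathbb{P})$, with filtration $(\mathcal{F}^B(t))_{t\ge0}$ the natural filtration generated by $B$; $\mathcal{F}^B(\infty)$ is the $\sigma$-algebra generated by $(B(t))_{t\ge0}$. A function $f$ which is positive and measurable on $(0,\infty)$ is regularly varying at $0$ with index $\beta\in\mathbb{R}$, written $f\in\mathrm{RV}_0(\beta)$, if $\lim_{x\to0^+} f(\lambda x)/f(x)=\lambda^\beta$ for every $\lambda>0$ (for $f$ defined on $\mathbb{R}$ this refers to its restriction to $(0,\infty)$). Define $F(x)=\int_x^1 \frac{1}{f(u)}\,du$ for $x>0$. $F$ is strictly decreasing; since $\beta>1$, $F(x)\to\infty$ as $x\to0^+$. $F^{-1}$ denotes the inverse function of $F$; $F^{-1}(t)>0$ is defined for all $t\ge 0$ and tends to $0$ as $t\to\infty$. *)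

theory Defs
  imports "HOL-Probability.Probability"
begin

section \<open>Real functions\<close>

definition locally_lipschitz :: "(real \<Rightarrow> real) \<Rightarrow> bool" where
  "locally_lipschitz f \<longleftrightarrow> (\<forall>x. \<exists>u>0. \<exists>L. L-lipschitz_on (cball x u) f)"

text \<open>The derivative is taken within \<open>S\<close>: it is one-sided at an endpoint of a closed
  interval, and two-sided at every point of an open set.\<close>

definition C1_on :: "real set \<Rightarrow> (real \<Rightarrow> real) \<Rightarrow> bool" where
  "C1_on S f \<longleftrightarrow>
    (\<exists>D. (\<forall>x\<in>S. (f has_real_derivative D x) (at x within S)) \<and> continuous_on S D)"

definition regularly_varying_at_0 :: "real \<Rightarrow> (real \<Rightarrow> real) \<Rightarrow> bool" where
  "regularly_varying_at_0 \<beta> f \<longleftrightarrow>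
    (\<forall>x>0. f x > 0) \<and> f \<in> borel_measurable (restrict_space borel {0<..}) \<and>
    (\<forall>l>0. ((\<lambda>x. f (l * x) / f x) \<longlongrightarrow> l powr \<beta>) (at_right 0))"

text \<open>The integral is oriented, so \<open>F_fun f x\<close> is negative for \<open>x > 1\<close>.\<close>

definition F_fun :: "(real \<Rightarrow> real) \<Rightarrow> real \<Rightarrow> real" where
  "F_fun f x = (LBINT u=x..1. 1 / f u)"

definition F_inv :: "(real \<Rightarrow> real) \<Rightarrow> real \<Rightarrow> real" where
  "F_inv f = the_inv_into {0<..} (F_fun f)"

definition tail_energy :: "(real \<Rightarrow> real) \<Rightarrow> real \<Rightarrow> real" where
  "tail_energy \<sigma> t = (LINT s:{t..}|lborel. (\<sigma> s)\<^sup>2)"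


section \<open>Brownian motion\<close>

text \<open>Processes are indexed by \<^typ>\<open>real\<close>, but only times \<open>t \<ge> 0\<close> are relevant. The
  \<open>\<sigma>\<close>-algebras below are not augmented by null sets.\<close>

definition generated_sigma :: "'a measure \<Rightarrow> (real \<Rightarrow> 'a \<Rightarrow> real) \<Rightarrow> real set \<Rightarrow> 'a measure" where
  "generated_sigma M B T =
    sigma (space M) (\<Union>s\<in>T. {B s -` A \<inter> space M | A. A \<in> sets borel})"

definition natural_filtration :: "'a measure \<Rightarrow> (real \<Rightarrow> 'a \<Rightarrow> real) \<Rightarrow> real \<Rightarrow> 'a measure" where
  "natural_filtration M B t = generated_sigma M B {0..t}"

definition terminal_sigma :: "'a measure \<Rightarrow> (real \<Rightarrow> 'a \<Rightarrow> real) \<Rightarrow> 'a measure" where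
  "terminal_sigma M B = generated_sigma M B {0..}"

definition adapted :: "(real \<Rightarrow> 'a measure) \<Rightarrow> (real \<Rightarrow> 'a \<Rightarrow> real) \<Rightarrow> bool" where
  "adapted F X \<longleftrightarrow> (\<forall>t\<ge>0. X t \<in> borel_measurable (F t))"

definition continuous_process :: "'a measure \<Rightarrow> (real \<Rightarrow> 'a \<Rightarrow> real) \<Rightarrow> bool" where
  "continuous_process M X \<longleftrightarrow> (AE \<omega> in M. continuous_on {0..} (\<lambda>t. X t \<omega>))"

locale brownian_motion = prob_space M for M :: "'a measure" +
  fixes B :: "real \<Rightarrow> 'a \<Rightarrow> real"
  assumes random_variable: "\<And>t. 0 \<le> t \<Longrightarrow> B t \<in> borel_measurable M"
    and start: "AE \<omega> in M. B 0 \<omega> = 0"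
    and continuous: "continuous_process M B"
    and increment_normal: "\<And>s t. 0 \<le> s \<Longrightarrow> s < t \<Longrightarrow>
      distributed M lborel (\<lambda>\<omega>. B t \<omega> - B s \<omega>) (normal_density 0 (sqrt (t - s)))"
    and increment_indep: "\<And>s t. 0 \<le> s \<Longrightarrow> s < t \<Longrightarrow>
      indep_set (sets (natural_filtration M B s))
        (sets (vimage_algebra (space M) (\<lambda>\<omega>. B t \<omega> - B s \<omega>) borel))"


section \<open>The Ito integral\<close>

text \<open>The triple \<open>n\<close>, \<open>p\<close>, \<open>e\<close> encodes the elementary process that takes the value \<open>e j\<close>
  on \<open>[p j, p (j + 1))\<close> for \<open>j < n\<close>, and \<open>0\<close> elsewhere.\<close>

definition elementary_process ::
  "'a measure \<Rightarrow> (real \<Rightarrow> 'a measure) \<Rightarrow> nat \<Rightarrow> (nat \<Rightarrow> real) \<Rightarrow> (nat \<Rightarrow> 'a \<Rightarrow> real) \<Rightarrow> bool" where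
  "elementary_process M F n p e \<longleftrightarrow>
    0 \<le> p 0 \<and> (\<forall>j<n. p j \<le> p (Suc j)) \<and>
    (\<forall>j<n. e j \<in> borel_measurable (F (p j)) \<and> bounded (e j ` space M))"

definition elementary_value ::
  "nat \<Rightarrow> (nat \<Rightarrow> real) \<Rightarrow> (nat \<Rightarrow> 'a \<Rightarrow> real) \<Rightarrow> real \<Rightarrow> 'a \<Rightarrow> real" where
  "elementary_value n p e s \<omega> = (\<Sum>j<n. e j \<omega> * indicat_real {p j..<p (Suc j)} s)"

definition elementary_integral ::
  "(real \<Rightarrow> 'a \<Rightarrow> real) \<Rightarrow> nat \<Rightarrow> (nat \<Rightarrow> real) \<Rightarrow> (nat \<Rightarrow> 'a \<Rightarrow> real) \<Rightarrow> real \<Rightarrow> 'a \<Rightarrow> real" where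
  "elementary_integral B n p e t \<omega> =
    (\<Sum>j<n. e j \<omega> * (B (min t (p (Suc j))) \<omega> - B (min t (p j)) \<omega>))"

text \<open>\<open>has_ito_integral M F B H t I\<close> says that the random variable \<open>I\<close> is a version of the
  stochastic integral of \<open>H\<close> with respect to \<open>B\<close> over \<open>[0, t]\<close>, as a mean-square limit of
  integrals of elementary processes that approximate \<open>H\<close> in mean square on \<open>[0, t]\<close>.\<close>

definition has_ito_integral ::
  "'a measure \<Rightarrow> (real \<Rightarrow> 'a measure) \<Rightarrow> (real \<Rightarrow> 'a \<Rightarrow> real) \<Rightarrow> (real \<Rightarrow> 'a \<Rightarrow> real) \<Rightarrow>
    real \<Rightarrow> ('a \<Rightarrow> real) \<Rightarrow> bool" where
  "has_ito_integral M F B H t I \<longleftrightarrow>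
    adapted F H \<and>
    (\<lambda>(s, \<omega>). H s \<omega>) \<in> borel_measurable (restrict_space borel {0..t} \<Otimes>\<^sub>M M) \<and>
    I \<in> borel_measurable M \<and>
    (\<exists>n p e. (\<forall>k. elementary_process M F (n k) (p k) (e k)) \<and>
      ((\<lambda>k. \<integral>\<^sup>+\<omega>. (\<integral>\<^sup>+s\<in>{0..t}.
          ennreal ((H s \<omega> - elementary_value (n k) (p k) (e k) s \<omega>)\<^sup>2) \<partial>lborel) \<partial>M)
        \<longlonglongrightarrow> 0) \<and>
      ((\<lambda>k. \<integral>\<^sup>+\<omega>. ennreal ((I \<omega> - elementary_integral B (n k) (p k) (e k) t \<omega>)\<^sup>2) \<partial>M)
        \<longlonglongrightarrow> 0))"


section \<open>The stochastic differential equation\<close>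

text \<open>Solutions of \<open>dX(t) = - f(X(t)) dt + \<sigma>(t) dB(t)\<close>, \<open>X(0) = \<xi>\<close>, in integral form.\<close>

definition sde_solution ::
  "'a measure \<Rightarrow> (real \<Rightarrow> 'a \<Rightarrow> real) \<Rightarrow> (real \<Rightarrow> real) \<Rightarrow> (real \<Rightarrow> real) \<Rightarrow> real \<Rightarrow>
    (real \<Rightarrow> 'a \<Rightarrow> real) \<Rightarrow> bool" where
  "sde_solution M B f \<sigma> \<xi> X \<longleftrightarrow>
    continuous_process M X \<and> adapted (natural_filtration M B) X \<and>
    (AE \<omega> in M. X 0 \<omega> = \<xi>) \<and>
    (\<exists>I. (\<forall>t\<ge>0. has_ito_integral M (natural_filtration M B) B (\<lambda>s _. \<sigma> s) t (I t)) \<and>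
      (AE \<omega> in M. \<forall>t\<ge>0. X t \<omega> = \<xi> - (LBINT s=0..t. f (X s \<omega>)) + I t \<omega>))"

end

theory Submission
  imports Defs
begin

text \<open>The deterministic equation \<open>y' = - f y\<close> started at a small positive value satisfies
\<open>F (y t) = t + const\<close>, so it decays like \<open>F_inv f t\<close>; regular variation of \<open>f\<close> makes \<open>F\<close>
regularly varying of index \<open>1 - \<beta> < 0\<close>, and then \<open>F (y t) / t \<longlongrightarrow> 1\<close> is enough for
\<open>y t / F_inv f t \<longlongrightarrow> 1\<close>. The noise intensity may be constructed freely, and the theorem holds because a
function with arbitrarily high peaks can still have an arbitrarily small stochastic integral:
the peaks of height \<open>sqrt (\<Gamma> n)\<close> only have to be narrow enough.

\<^emph>\<open>The noise.\<close> \<open>\<sigma>\<close> is a sum of C1 bumps centred at the positive integers, each one the sum of a wide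
and very low bump (which keeps \<open>\<sigma>\<close> positive) and a spike of height \<open>sqrt (\<Gamma> n)\<close>. Integration by parts
bounds the Ito integral of a bump by its height times the oscillation of the Brownian path over
its support (lemma \<open>path_integral_atom_bound\<close>). The oscillation over a shrinking window tends to
zero by path continuity, so a sufficiently narrow window makes the contribution of the
spike smaller than any prescribed number, outside events of summable probability. The
Borel-Cantelli lemma then gives, almost surely, an eventual bound of
\<open>\<integral> \<sigma> dB\<close> over \<open>[t, \<infinity>)\<close> by any prescribed positive decreasing function of \<open>t\<close>
(lemmas \<open>noise_piece_exists\<close>, \<open>path_integral_tail\<close>, \<open>noise_exists\<close>).

\<^emph>\<open>The paths.\<close> Let \<open>\<eta> t\<close> be that tail integral. Then \<open>y = X + \<eta>\<close> is differentiable and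
\<open>y' = - f (y - \<eta>)\<close>. With \<open>\<eta>\<close> below the function \<open>tolerance\<close>, the perturbation is negligible compared
with \<open>f y\<close> as long as \<open>\<bar>y t\<bar> \<ge> F_inv f (t\<^sup>2)\<close>, and this threshold is itself negligible compared with
\<open>F_inv f t\<close>. In the region above the threshold, \<open>F (y t)\<close> has slope close to 1 while \<open>t\<^sup>2\<close> has slope
\<open>2 * t\<close>, so the region can never be left again. Hence \<open>y\<close> is eventually above the
threshold and \<open>y / F_inv f\<close> tends to 1, or eventually below it; the same holds for \<open>- y\<close>
because \<open>f\<close> is asymptotically odd. This gives the three limits (lemmas \<open>one_sided_dichotomy\<close>, \<open>path_limit\<close>).

\<^emph>\<open>The stochastic calculus.\<close> For a deterministic C1 integrand the Ito integral is a
pathwise integral by parts. Elementary integrals converge to it in mean square, and the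
isometry for elementary integrands shows that every version of the Ito integral agrees with it
(lemmas \<open>elementary_isometry\<close>, \<open>has_ito_integral_exists\<close>, \<open>has_ito_integral_unique\<close>). The equation therefore
is an ordinary integral equation for each path. It is solved by Picard iteration; since the
filtration is not augmented, every integral is written as a limit of Riemann sums, so that each
iterate is visibly a measurable function of the path up to the present time
(lemmas \<open>solver_correct\<close>, \<open>sde_solution_exists\<close>).\<close>

section \<open>Barrier arguments, and the function F with its inverse\<close>

lemma locally_lipschitz_imp_continuous:
  assumes "locally_lipschitz f"
  shows "continuous_on S f"
proof -
  have "isCont f x" for x
  proof -
    obtain u L where "u > 0" "L-lipschitz_on (cball x u) f"
      using assms unfolding locally_lipschitz_def by blast
    then have "continuous_on (cball x u) f" "x \<in> interior (cball x u)"
      by (auto intro: lipschitz_on_continuous_on)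
    then show ?thesis
      using continuous_on_interior by blast
  qed
  then show ?thesis
    by (simp add: continuous_at_imp_continuous_on)
qed

lemma locally_lipschitz_imp_lipschitz_on_interval:
  assumes "locally_lipschitz f"
  shows "\<exists>L>0. L-lipschitz_on {a..b} f"
proof -
  have "local_lipschitz {0::real} {a..b} (\<lambda>_. f)"
  proof (rule local_lipschitzI)
    fix t x :: real
    obtain u L where "u > 0" "L-lipschitz_on (cball x u) f"
      using assms unfolding locally_lipschitz_def by blast
    then have "L-lipschitz_on (cball x u \<inter> {a..b}) f"
      by (auto intro: lipschitz_on_subset)
    with \<open>u > 0\<close> show "\<exists>u>0. \<exists>L. \<forall>t\<in>cball t u \<inter> {0}. L-lipschitz_on (cball x u \<inter> {a..b}) f"
      by blast
  qed
  then obtain L where L: "\<And>t::real. t \<in> {0} \<Longrightarrow> L-lipschitz_on {a..b} f"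
    by (rule local_lipschitz_compact_implies_lipschitz) auto
  have "(max L 1)-lipschitz_on {a..b} f"
    using lipschitz_on_mono[OF L[of 0], of "{a..b}" "max L 1"] by auto
  then show ?thesis
    by (intro exI[of _ "max L 1"]) auto
qed

text \<open>The level \<open>c\<close> cannot be crossed upwards: after the last time at or below \<open>c\<close> the function
would be nonincreasing.\<close>
lemma barrier_le:
  fixes y :: "real \<Rightarrow> real"
  assumes cont: "continuous_on {a..b} y" and "a \<le> b" "y a \<le> c"
    and der: "\<And>t. a < t \<Longrightarrow> t < b \<Longrightarrow> y t > c \<Longrightarrow> \<exists>D. (y has_real_derivative D) (at t) \<and> D \<le> 0"
  shows "y b \<le> c"
proof (rule ccontr)
  assume "\<not> y b \<le> c"
  then have yb: "y b > c" by simp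
  define S where "S = {t \<in> {a..b}. y t \<le> c}"
  have "closed S"
    unfolding S_def using continuous_on_closed_Collect_le[OF cont continuous_on_const] by simp
  moreover have "a \<in> S" "bdd_above S"
    using assms by (auto simp: S_def bdd_above_def)
  ultimately have s: "Sup S \<in> S"
    by (intro closed_contains_Sup) auto
  define s where "s = Sup S"
  have after: "y t > c" if "s < t" "t \<le> b" for t
  proof (rule ccontr)
    assume "\<not> y t > c"
    then have "t \<in> S" using that s by (auto simp: S_def s_def)
    then have "t \<le> s" unfolding s_def using \<open>bdd_above S\<close> by (rule cSup_upper)
    with that show False by simp
  qed
  have "s \<in> S" using s by (simp add: s_def)
  then have "a \<le> s" "y s \<le> c" "s \<le> b" by (auto simp: S_def)
  moreover have "s \<noteq> b" using \<open>y s \<le> c\<close> yb by auto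
  ultimately have "s < b" by simp
  have "y b \<le> y s"
  proof (rule DERIV_nonpos_imp_decreasing_open[where f=y])
    show "s \<le> b" using \<open>s < b\<close> by simp
    show "\<exists>D. (y has_real_derivative D) (at x) \<and> D \<le> 0" if "s < x" "x < b" for x
      using der[of x] after[of x] that \<open>a \<le> s\<close> by auto
    show "continuous_on {s..b} y"
      using cont by (rule continuous_on_subset) (use \<open>a \<le> s\<close> in auto)
  qed
  then show False using \<open>y s \<le> c\<close> yb by simp
qed

text \<open>Only the derivative at times of negative value is controlled. This suffices
because up to the first zero every value is negative.\<close>
lemma stays_negative:
  fixes v :: "real \<Rightarrow> real"
  assumes cont: "continuous_on {a..b} v" and "a \<le> b" "v a < 0"
    and der: "\<And>t. a < t \<Longrightarrow> t < b \<Longrightarrow> v t < 0 \<Longrightarrow> \<exists>D. (v has_real_derivative D) (at t) \<and> D \<le> 0"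
  shows "v b < 0"
proof (rule ccontr)
  assume "\<not> v b < 0"
  define S where "S = {t \<in> {a..b}. 0 \<le> v t}"
  have "closed S"
    unfolding S_def using continuous_on_closed_Collect_le[OF continuous_on_const cont] by simp
  moreover have "b \<in> S" and S: "bdd_below S"
    using assms \<open>\<not> v b < 0\<close> by (auto simp: S_def bdd_below_def)
  ultimately have s: "Inf S \<in> S"
    by (intro closed_contains_Inf) auto
  define s where "s = Inf S"
  have s_S: "a \<le> s" "s \<le> b" "0 \<le> v s"
    using s by (auto simp: S_def s_def)
  have before: "v t < 0" if "a \<le> t" "t < s" for t
  proof (rule ccontr)
    assume "\<not> v t < 0"
    then have "t \<in> S" using that s_S by (auto simp: S_def)
    then have "s \<le> t" unfolding s_def using S by (rule cInf_lower)
    with that show False by simp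
  qed
  have "v s \<le> v a"
  proof (rule DERIV_nonpos_imp_decreasing_open[OF s_S(1)])
    show "\<exists>D. (v has_real_derivative D) (at x) \<and> D \<le> 0" if "a < x" "x < s" for x
      using der[of x] before[of x] that s_S by auto
    show "continuous_on {a..s} v"
      using cont by (rule continuous_on_subset) (use s_S in auto)
  qed
  then show False using \<open>v a < 0\<close> s_S by simp
qed

locale drift =
  fixes f :: "real \<Rightarrow> real" and \<beta> :: real
  assumes lipschitz: "locally_lipschitz f"
    and zero: "f 0 = 0"
    and sign: "\<And>x. x \<noteq> 0 \<Longrightarrow> x * f x > 0"
    and index: "\<beta> > 1"
    and regular: "regularly_varying_at_0 \<beta> f"
begin

lemma continuous_f: "continuous_on S f"
  using lipschitz by (rule locally_lipschitz_imp_continuous)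

lemma pos: "x > 0 \<Longrightarrow> f x > 0"
  using sign[of x] by (simp add: zero_less_mult_iff)

lemma neg: "x < 0 \<Longrightarrow> f x < 0"
  using sign[of x] by (simp add: zero_less_mult_iff)

text \<open>Within this locale \<open>F\<close> and \<open>\<rho>\<close> are the function \<open>F\<close> and the decay rate \<open>F\<inverse>\<close> of the unperturbed equation;
\<open>\<rho>\<close> solves \<open>\<rho>' = - f \<rho>\<close> with \<open>\<rho> 0 = 1\<close>.\<close>
definition F where "F = F_fun f"
definition \<rho> where "\<rho> = F_inv f"

lemma F_deriv:
  assumes "x > 0"
  shows "(F has_real_derivative - (1 / f x)) (at x)"
proof -
  define a where "a = min (x / 2) (1 / 2)"
  define b where "b = x + 1"
  have ab: "0 < a" "a < x" "x < b" "a < 1" "1 < b"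
    using assms by (auto simp: a_def b_def)
  have "continuous_on {a..b} (\<lambda>u. 1 / f u)"
    using ab pos by (intro continuous_intros continuous_f) (metis atLeastAtMost_iff less_le_trans less_irrefl)
  then have "((\<lambda>u. LBINT y=1..u. 1 / f y) has_vector_derivative (1 / f x)) (at x within {a..b})"
    using ab interval_integral_FTC2[of a 1 b "\<lambda>u. 1 / f u" x] by (simp add: one_ereal_def)
  then have "((\<lambda>u. LBINT y=1..u. 1 / f y) has_real_derivative (1 / f x)) (at x)"
    using ab at_within_Icc_at[of a x b] by (simp add: has_real_derivative_iff_has_vector_derivative)
  then have "((\<lambda>u. - (LBINT y=1..u. 1 / f y)) has_real_derivative - (1 / f x)) (at x)"
    by (rule DERIV_minus)
  moreover have "F = (\<lambda>u. - (LBINT y=1..u. 1 / f y))"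
    unfolding F_def F_fun_def by (rule ext) (rule interval_integral_endpoints_reverse)
  ultimately show ?thesis by simp
qed

lemma F_1: "F 1 = 0"
  by (simp add: F_def F_fun_def one_ereal_def)

lemma F_isCont: "x > 0 \<Longrightarrow> isCont F x"
  using F_deriv DERIV_isCont by blast

lemma F_continuous: "S \<subseteq> {0<..} \<Longrightarrow> continuous_on S F"
  by (intro continuous_at_imp_continuous_on) (auto intro!: F_isCont)

lemma F_strict: "0 < x \<Longrightarrow> x < y \<Longrightarrow> F y < F x"
  by (rule DERIV_neg_imp_decreasing) (auto intro!: exI F_deriv simp: pos)

lemma F_less_iff: "0 < x \<Longrightarrow> 0 < y \<Longrightarrow> F x < F y \<longleftrightarrow> y < x"
  using F_strict[of x y] F_strict[of y x] by (cases x y rule: linorder_cases) auto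

lemma F_le_iff: "0 < x \<Longrightarrow> 0 < y \<Longrightarrow> F x \<le> F y \<longleftrightarrow> y \<le> x"
  using F_less_iff[of y x] by auto

lemma F_eq_iff: "0 < x \<Longrightarrow> 0 < y \<Longrightarrow> F x = F y \<longleftrightarrow> y = x"
  using F_less_iff[of y x] F_less_iff[of x y] by (metis less_irrefl linorder_neqE)

text \<open>The Lipschitz bound \<open>f x \<le> L * x\<close> near \<open>0\<close> makes \<open>F\<close> diverge at least logarithmically.\<close>
lemma F_at_top: "filterlim F at_top (at_right 0)"
proof -
  obtain L where L: "L > 0" "L-lipschitz_on {0..1} f"
    using locally_lipschitz_imp_lipschitz_on_interval[OF lipschitz] by blast
  have fL: "f x \<le> L * x" if "0 < x" "x \<le> 1" for x
    using lipschitz_onD[OF L(2), of x 0] that zero by (simp add: dist_real_def)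
  have lower: "- ln x / L \<le> F x" if "0 < x" "x \<le> 1" for x
  proof -
    have "F 1 + ln 1 / L \<le> F x + ln x / L"
    proof (rule DERIV_nonpos_imp_nonincreasing[OF that(2)])
      fix u assume u: "x \<le> u" "u \<le> 1"
      then have "u > 0" using that by simp
      have "((\<lambda>x. F x + ln x / L) has_real_derivative (- (1 / f u) + 1 / u / L)) (at u)"
        using \<open>u > 0\<close> L(1) by (auto intro!: derivative_eq_intros F_deriv)
      moreover have "1 / (L * u) \<le> 1 / f u"
        using fL[of u] pos[of u] u \<open>u > 0\<close> by (intro divide_left_mono) (auto simp: L)
      then have "- (1 / f u) + 1 / u / L \<le> 0"
        by (simp add: field_simps)
      ultimately show "\<exists>y. ((\<lambda>x. F x + ln x / L) has_real_derivative y) (at u) \<and> y \<le> 0"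
        by blast
    qed
    then show ?thesis by (simp add: F_1)
  qed
  have "filterlim (\<lambda>x. - ln x) at_top (at_right (0::real))"
    using ln_at_0 by (simp add: filterlim_uminus_at_top)
  then have "filterlim (\<lambda>x. - ln x * (1 / L)) at_top (at_right (0::real))"
    using L(1) by (intro filterlim_at_top_mult_tendsto_pos[OF tendsto_const]) auto
  then have "filterlim (\<lambda>x. - ln x / L) at_top (at_right 0)"
    by simp
  then show ?thesis
    by (rule filterlim_at_top_mono)
      (use lower in \<open>auto simp: eventually_at_right[OF zero_less_one] intro!: exI[of _ 1]\<close>)
qed

lemma F_surj:
  assumes "t \<ge> 0"
  shows "\<exists>x. 0 < x \<and> x \<le> 1 \<and> F x = t"
proof -
  have "eventually (\<lambda>x. F x \<ge> t \<and> x < 1 \<and> x > 0) (at_right 0)"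
    using F_at_top[unfolded filterlim_at_top, rule_format, of t]
    by (intro eventually_conj eventually_at_right_less)
      (auto intro: eventually_at_rightI[of 0 "1::real"])
  then obtain x where x: "F x \<ge> t" "x < 1" "x > 0"
    using eventually_happens[of _ "at_right (0::real)"] by auto
  have "\<exists>y\<ge>x. y \<le> 1 \<and> F y = t"
    by (rule IVT2) (use x assms F_isCont in \<open>auto simp: F_1\<close>)
  then show ?thesis using x less_le_trans by blast
qed

lemma \<rho>_F: "x > 0 \<Longrightarrow> \<rho> (F x) = x"
  unfolding \<rho>_def F_inv_def F_def[symmetric]
  by (rule the_inv_into_f_f) (auto simp: inj_on_def F_eq_iff)

lemma \<rho>_bounds: "t \<ge> 0 \<Longrightarrow> 0 < \<rho> t" "t \<ge> 0 \<Longrightarrow> \<rho> t \<le> 1" and F_\<rho>: "t \<ge> 0 \<Longrightarrow> F (\<rho> t) = t"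
  using F_surj[of t] \<rho>_F by auto

lemma \<rho>_antimono: "0 \<le> s \<Longrightarrow> s \<le> t \<Longrightarrow> \<rho> t \<le> \<rho> s"
  using F_le_iff[of "\<rho> s" "\<rho> t"] \<rho>_bounds F_\<rho> by auto

lemma \<rho>_tendsto_0: "(\<rho> \<longlongrightarrow> 0) at_top"
proof (rule order_tendstoI)
  fix a :: real assume "a < 0"
  show "eventually (\<lambda>t. a < \<rho> t) at_top"
    using eventually_ge_at_top[of "0::real"]
  proof eventually_elim
    case (elim t)
    then show ?case using \<rho>_bounds(1)[of t] \<open>a < 0\<close> by linarith
  qed
next
  fix a :: real assume "a > 0"
  show "eventually (\<lambda>t. \<rho> t < a) at_top"
    using eventually_gt_at_top[of "max 0 (F a)"]
  proof eventually_elim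
    case (elim t)
    then show ?case using F_less_iff[of a "\<rho> t"] \<rho>_bounds[of t] F_\<rho>[of t] \<open>a > 0\<close> by auto
  qed
qed

lemma \<rho>_at_right_0: "filterlim \<rho> (at_right 0) at_top"
  unfolding filterlim_at using \<rho>_tendsto_0 \<rho>_bounds(1)
  by (auto intro!: eventually_at_top_linorderI[of 0] simp: less_imp_neq[symmetric])

text \<open>\<open>F\<close> inherits regular variation from \<open>f\<close> by l'Hospital's rule, since the quotient of the derivatives
is \<open>l * f x / f (l * x)\<close>.\<close>
lemma F_scale:
  assumes l: "l > 0"
  shows "((\<lambda>x. F (l * x) / F x) \<longlongrightarrow> l powr (1 - \<beta>)) (at_right 0)"
proof (rule lhopital_right_0_at_top[OF F_at_top])
  have ev: "eventually (\<lambda>x::real. x > 0) (at_right 0)"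
    by (simp add: eventually_at_right_less)
  show "eventually (\<lambda>x. - (1 / f x) \<noteq> 0) (at_right 0)"
    using ev by eventually_elim (use pos in force)
  show "eventually (\<lambda>x. (F has_real_derivative - (1 / f x)) (at x)) (at_right 0)"
    using ev by eventually_elim (use F_deriv in force)
  show "eventually (\<lambda>x. ((\<lambda>x. F (l * x)) has_real_derivative - (1 / f (l * x)) * l) (at x)) (at_right 0)"
    using ev
  proof eventually_elim
    case (elim x)
    have "((\<lambda>x. l * x) has_real_derivative l) (at x)"
      by (auto intro!: derivative_eq_intros)
    with elim l show ?case by (intro DERIV_chain2[OF F_deriv]) auto
  qed
  have "((\<lambda>x. l / (f (l * x) / f x)) \<longlongrightarrow> l / l powr \<beta>) (at_right 0)"
    using regular l unfolding regularly_varying_at_0_def by (intro tendsto_intros) auto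
  also have "l / l powr \<beta> = l powr (1 - \<beta>)"
    using l by (simp add: powr_diff)
  finally show "((\<lambda>x. - (1 / f (l * x)) * l / - (1 / f x)) \<longlongrightarrow> l powr (1 - \<beta>)) (at_right 0)"
    by (rule Lim_transform_eventually) (use ev in eventually_elim, auto)
qed

lemma F_scale_\<rho>:
  assumes l: "l > 0"
  shows "((\<lambda>t. F (l * \<rho> t) / t) \<longlongrightarrow> l powr (1 - \<beta>)) at_top"
  using filterlim_compose[OF F_scale[OF l] \<rho>_at_right_0]
  by (rule Lim_transform_eventually)
    (use F_\<rho> in \<open>auto intro!: eventually_at_top_linorderI[of 0]\<close>)

end

section \<open>Asymptotics of perturbed trajectories\<close>

text \<open>Once the perturbation is below \<open>c / 2\<close>, the drift is bounded away from zero while \<open>y > c\<close>, so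
the level \<open>c\<close> is reached in finite time; afterwards it acts as a barrier.\<close>
lemma perturbed_decay_below:
  fixes g y \<eta> :: "real \<Rightarrow> real"
  assumes g: "continuous_on UNIV g" "\<And>x. x > 0 \<Longrightarrow> g x > 0"
    and y: "\<And>t. t > T \<Longrightarrow> (y has_real_derivative - g (y t - \<eta> t)) (at t)"
    and \<eta>: "(\<eta> \<longlongrightarrow> 0) at_top" and c: "c > 0"
  shows "eventually (\<lambda>t. y t \<le> c) at_top"
proof -
  have "eventually (\<lambda>t. \<bar>\<eta> t\<bar> < c / 2 \<and> t > T) at_top"
    using tendstoD[OF \<eta>, of "c / 2"] c by (intro eventually_conj eventually_gt_at_top) auto
  then obtain a where a: "\<And>t. t \<ge> a \<Longrightarrow> \<bar>\<eta> t\<bar> < c / 2" "\<And>t. t \<ge> a \<Longrightarrow> t > T"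
    unfolding eventually_at_top_linorder by blast
  have cont: "continuous_on {s..t} y" if "s \<ge> a" for s t
    using that a(2) by (intro continuous_at_imp_continuous_on ballI DERIV_isCont[OF y]) force
  have "\<exists>s\<ge>a. y s \<le> c"
  proof (rule ccontr)
    assume "\<not> ?thesis"
    then have above: "y s > c" if "s \<ge> a" for s
      using that by (meson not_le)
    have dec: "y s \<le> y a" if "s \<ge> a" for s
    proof (rule DERIV_nonpos_imp_nonincreasing[OF that])
      fix x assume x: "a \<le> x" "x \<le> s"
      then have "y x - \<eta> x > 0"
        using above[of x] a(1)[of x] c by linarith
      then show "\<exists>d. (y has_real_derivative d) (at x) \<and> d \<le> 0"
        using y[OF a(2)[OF x(1)]] g(2)[of "y x - \<eta> x"] by (intro exI conjI) auto
    qed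
    have "compact {c / 2..y a + c / 2}" "{c / 2..y a + c / 2} \<noteq> {}"
      using above[of a] c by auto
    then obtain p where p: "p \<in> {c / 2..y a + c / 2}" "\<And>x. x \<in> {c / 2..y a + c / 2} \<Longrightarrow> g p \<le> g x"
      using continuous_attains_inf[of "{c / 2..y a + c / 2}" g] continuous_on_subset[OF g(1)] by auto
    have "g p > 0" using g(2) p(1) c by auto
    define t where "t = a + (y a - c) / g p + 1"
    have "t \<ge> a" using above[of a] \<open>g p > 0\<close> by (simp add: t_def)
    have "y t + g p * t \<le> y a + g p * a"
    proof (rule DERIV_nonpos_imp_nonincreasing[OF \<open>t \<ge> a\<close>])
      fix x assume x: "a \<le> x" "x \<le> t"
      have "y x - \<eta> x \<in> {c / 2..y a + c / 2}"
        using above[of x] dec[of x] a(1)[of x] x by auto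
      then have "- g (y x - \<eta> x) + g p \<le> 0"
        using p(2) by auto
      moreover have "((\<lambda>t. y t + g p * t) has_real_derivative (- g (y x - \<eta> x) + g p)) (at x)"
        using y[OF a(2)[OF x(1)]] by (auto intro!: derivative_eq_intros)
      ultimately show "\<exists>d. ((\<lambda>t. y t + g p * t) has_real_derivative d) (at x) \<and> d \<le> 0"
        by blast
    qed
    then have "y t \<le> y a - g p * (t - a)"
      by (simp add: algebra_simps)
    also have "\<dots> = c - g p"
      using \<open>g p > 0\<close> by (simp add: t_def field_simps)
    finally show False using above[OF \<open>t \<ge> a\<close>] \<open>g p > 0\<close> by simp
  qed
  then obtain s where s: "s \<ge> a" "y s \<le> c" by blast
  have "y t \<le> c" if "t \<ge> s" for t
  proof (rule barrier_le[OF cont[OF s(1)] that s(2)])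
    fix x assume x: "s < x" "x < t" "y x > c"
    then have "y x - \<eta> x > 0"
      using a(1)[of x] c s(1) by linarith
    then show "\<exists>d. (y has_real_derivative d) (at x) \<and> d \<le> 0"
      using y[OF a(2), of x] x s(1) g(2)[of "y x - \<eta> x"] by (intro exI conjI) auto
  qed
  then show ?thesis
    unfolding eventually_at_top_linorder by blast
qed

lemma perturbed_decay:
  fixes g y \<eta> :: "real \<Rightarrow> real"
  assumes g: "continuous_on UNIV g" "\<And>x. x \<noteq> 0 \<Longrightarrow> x * g x > 0"
    and y: "\<And>t. t > T \<Longrightarrow> (y has_real_derivative - g (y t - \<eta> t)) (at t)"
    and \<eta>: "(\<eta> \<longlongrightarrow> 0) at_top"
  shows "(y \<longlongrightarrow> 0) at_top"
proof (rule tendstoI)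
  fix e :: real assume "e > 0"
  then have e: "e / 2 > 0" by simp
  have "eventually (\<lambda>t. y t \<le> e / 2) at_top"
  proof (rule perturbed_decay_below[OF g(1) _ y \<eta> e])
    show "g x > 0" if "x > 0" for x
      using g(2)[of x] that by (simp add: zero_less_mult_iff)
  qed
  moreover have "eventually (\<lambda>t. - y t \<le> e / 2) at_top"
  proof (rule perturbed_decay_below[where g = "\<lambda>x. - g (- x)" and \<eta> = "\<lambda>t. - \<eta> t", OF _ _ _ _ e])
    show "continuous_on UNIV (\<lambda>x. - g (- x))"
      by (intro continuous_intros continuous_on_compose2[OF g(1)]) auto
    show "- g (- x) > 0" if "x > 0" for x
      using g(2)[of "- x"] that by (simp add: mult_less_0_iff)
    show "((\<lambda>t. - y t) has_real_derivative - (- g (- (- y t - - \<eta> t)))) (at t)" if "t > T" for t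
      using y[OF that] by (auto intro!: derivative_eq_intros simp: algebra_simps)
    show "((\<lambda>t. - \<eta> t) \<longlongrightarrow> 0) at_top"
      using tendsto_minus[OF \<eta>] by simp
  qed
  ultimately show "eventually (\<lambda>t. dist (y t) 0 < e) at_top"
    by eventually_elim (use \<open>e > 0\<close> in auto)
qed

context drift
begin

text \<open>The least restoring force available at distance at least \<open>\<rho> (t\<^sup>2)\<close> from the equilibrium. A perturbation
much smaller than \<open>\<mu> t\<close> changes \<open>f\<close> only by a small relative amount there.\<close>
definition \<mu> :: "real \<Rightarrow> real" where "\<mu> t = Inf (f ` {\<rho> (t\<^sup>2)..1})"

lemma \<mu>_pos: "\<mu> t > 0" and \<mu>_le: "\<rho> (t\<^sup>2) \<le> x \<Longrightarrow> x \<le> 1 \<Longrightarrow> \<mu> t \<le> f x"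
proof -
  have r: "\<rho> (t\<^sup>2) > 0" "\<rho> (t\<^sup>2) \<le> 1"
    using \<rho>_bounds[of "t\<^sup>2"] by auto
  then obtain p where p: "p \<in> {\<rho> (t\<^sup>2)..1}" "\<And>x. x \<in> {\<rho> (t\<^sup>2)..1} \<Longrightarrow> f p \<le> f x"
    using continuous_attains_inf[of "{\<rho> (t\<^sup>2)..1}" f] continuous_f by auto
  have "\<mu> t = f p"
    unfolding \<mu>_def using p by (intro cInf_eq_minimum) auto
  then show "\<mu> t > 0" "\<rho> (t\<^sup>2) \<le> x \<Longrightarrow> x \<le> 1 \<Longrightarrow> \<mu> t \<le> f x"
    using p r pos[of p] by auto
qed

lemma \<mu>_antimono: "0 \<le> s \<Longrightarrow> s \<le> t \<Longrightarrow> \<mu> t \<le> \<mu> s"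
proof -
  assume st: "0 \<le> s" "s \<le> t"
  then have "\<rho> (t\<^sup>2) \<le> \<rho> (s\<^sup>2)"
    by (intro \<rho>_antimono power_mono) auto
  then show ?thesis
    unfolding \<mu>_def[of s] using \<rho>_bounds[of "s\<^sup>2"] by (intro cInf_greatest) (auto intro!: \<mu>_le)
qed

text \<open>The admissible size of the noise remaining after time \<open>t\<close>. Comparison with \<open>\<mu> t\<close> makes it
negligible in the drift. The sixth power of \<open>\<rho> t\<close> makes it negligible against \<open>\<rho> t\<close>; it leaves room also
for the energy condition, where a factor \<open>(\<rho> t)\<^sup>2\<close> is divided out and a
square root is lost to the iterated logarithm.\<close>
definition tolerance :: "real \<Rightarrow> real" where
  "tolerance t = min (\<mu> t) ((\<rho> t) ^ 6) / (t + 1)"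

lemma tolerance_pos: "t \<ge> 0 \<Longrightarrow> tolerance t > 0"
  using \<mu>_pos[of t] \<rho>_bounds(1)[of t] by (simp add: tolerance_def)

lemma tolerance_antimono: "0 \<le> s \<Longrightarrow> s \<le> t \<Longrightarrow> tolerance t \<le> tolerance s"
  unfolding tolerance_def using \<mu>_pos[of t] \<mu>_pos[of s] \<rho>_bounds(1)[of t]
  by (intro frac_le min.mono \<mu>_antimono power_mono \<rho>_antimono) (auto simp: less_imp_le)

lemma tolerance_le_\<mu>: "t \<ge> 0 \<Longrightarrow> tolerance t \<le> \<mu> t / (t + 1)"
  unfolding tolerance_def by (intro divide_right_mono) auto

lemma tolerance_le_\<rho>6: "t \<ge> 0 \<Longrightarrow> tolerance t \<le> \<rho> t ^ 6 / (t + 1)"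
  unfolding tolerance_def by (intro divide_right_mono) auto

lemma tolerance_le_\<rho>: "t \<ge> 0 \<Longrightarrow> tolerance t \<le> \<rho> t / (t + 1)"
proof -
  assume t: "t \<ge> 0"
  have "\<rho> t ^ 6 \<le> \<rho> t ^ 1"
    using \<rho>_bounds[OF t] by (intro power_decreasing) auto
  then have "\<rho> t ^ 6 / (t + 1) \<le> \<rho> t / (t + 1)"
    using t by (intro divide_right_mono) auto
  then show ?thesis using tolerance_le_\<rho>6[OF t] by linarith
qed

lemma inverse_shift_tendsto_0: "((\<lambda>t::real. c / (t + 1)) \<longlongrightarrow> 0) at_top"
  by (intro real_tendsto_divide_at_top[OF tendsto_const]
      filterlim_tendsto_add_at_top[OF tendsto_const filterlim_ident, of 1, simplified add.commute])

lemma tolerance_over_\<rho>: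
  assumes "\<And>t. t > T \<Longrightarrow> \<bar>\<eta> t\<bar> \<le> tolerance t"
  shows "((\<lambda>t. \<eta> t / \<rho> t) \<longlongrightarrow> 0) at_top"
proof (rule Lim_null_comparison[OF _ inverse_shift_tendsto_0[of 1]])
  show "eventually (\<lambda>t. norm (\<eta> t / \<rho> t) \<le> 1 / (t + 1)) at_top"
    using eventually_gt_at_top[of "max T 0"]
  proof eventually_elim
    case (elim t)
    then have "\<bar>\<eta> t\<bar> \<le> \<rho> t / (t + 1)"
      using assms[of t] tolerance_le_\<rho>[of t] by simp
    then show ?case
      using elim \<rho>_bounds(1)[of t] by (simp add: field_simps)
  qed
qed

lemma tolerance_tendsto_0:
  assumes "\<And>t. t > T \<Longrightarrow> \<bar>\<eta> t\<bar> \<le> tolerance t"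
  shows "(\<eta> \<longlongrightarrow> 0) at_top"
proof -
  have "((\<lambda>t. \<eta> t / \<rho> t * \<rho> t) \<longlongrightarrow> 0 * 0) at_top"
    by (intro tendsto_mult tolerance_over_\<rho>[OF assms] \<rho>_tendsto_0)
  then have "((\<lambda>t. \<eta> t / \<rho> t * \<rho> t) \<longlongrightarrow> 0) at_top" by simp
  then show ?thesis
  proof (rule Lim_transform_eventually)
    show "eventually (\<lambda>t. \<eta> t / \<rho> t * \<rho> t = \<eta> t) at_top"
      using eventually_ge_at_top[of "0::real"]
      by eventually_elim (use \<rho>_bounds(1) in \<open>simp add: less_imp_neq[symmetric]\<close>)
  qed
qed

text \<open>\<open>F (c * \<rho> t)\<close> grows only linearly in \<open>t\<close>, whereas \<open>F (\<rho> (t\<^sup>2)) = t\<^sup>2\<close>.\<close>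
lemma \<rho>_square_less:
  assumes "c > 0"
  shows "eventually (\<lambda>t. \<rho> (t\<^sup>2) < c * \<rho> t) at_top"
proof -
  have "eventually (\<lambda>t. F (c * \<rho> t) / t < c powr (1 - \<beta>) + 1) at_top"
    using F_scale_\<rho>[OF assms] by (rule order_tendstoD) simp
  then show ?thesis
    using eventually_gt_at_top[of "max 1 (c powr (1 - \<beta>) + 1)"]
  proof eventually_elim
    case (elim t)
    then have "F (c * \<rho> t) < (c powr (1 - \<beta>) + 1) * t"
      by (simp add: field_simps)
    also have "\<dots> \<le> t * t"
      using elim by (intro mult_right_mono) linarith+
    finally have "F (c * \<rho> t) < F (\<rho> (t\<^sup>2))"
      by (simp add: F_\<rho> power2_eq_square)
    then show ?case
      using F_less_iff[of "c * \<rho> t" "\<rho> (t\<^sup>2)"] \<rho>_bounds(1)[of t] \<rho>_bounds(1)[of "t\<^sup>2"] elim assms by auto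
  qed
qed

text \<open>The index \<open>1 - \<beta>\<close> of \<open>F\<close> is negative. So if \<open>z\<close> exceeded \<open>l * \<rho>\<close> with \<open>l > 1\<close> at large times, then
\<open>F z / t\<close> would drop below a constant less than 1, and symmetrically for \<open>l < 1\<close>.\<close>
lemma F_asymp_imp_\<rho>_asymp:
  assumes z: "eventually (\<lambda>t. z t > 0) at_top" and lim: "((\<lambda>t. F (z t) / t) \<longlongrightarrow> 1) at_top"
  shows "((\<lambda>t. z t / \<rho> t) \<longlongrightarrow> 1) at_top"
proof (rule order_tendstoI)
  fix l :: real assume l: "1 < l"
  have "l powr (1 - \<beta>) < 1"
    using l index by (simp add: powr_less_one)
  then obtain q where q: "l powr (1 - \<beta>) < q" "q < 1" using dense by blast
  have "eventually (\<lambda>t. F (l * \<rho> t) / t < q) at_top"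
    using F_scale_\<rho>[of l] q(1) l by (intro order_tendstoD) auto
  moreover have "eventually (\<lambda>t. q < F (z t) / t) at_top"
    using lim q(2) by (rule order_tendstoD)
  ultimately show "eventually (\<lambda>t. z t / \<rho> t < l) at_top"
    using z eventually_gt_at_top[of 0]
  proof eventually_elim
    case (elim t)
    then have "F (l * \<rho> t) / t < F (z t) / t" by linarith
    then have "F (l * \<rho> t) < F (z t)" using elim by (simp add: divide_less_cancel)
    then show ?case
      using F_less_iff[of "l * \<rho> t" "z t"] elim \<rho>_bounds(1)[of t] l by (simp add: field_simps)
  qed
next
  fix l :: real assume l: "l < 1"
  show "eventually (\<lambda>t. l < z t / \<rho> t) at_top"
  proof (cases "l > 0")
    case False
    show ?thesis
      using z eventually_ge_at_top[of 0]
    proof eventually_elim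
      case (elim t)
      then have "0 < z t / \<rho> t" using \<rho>_bounds(1)[of t] by simp
      then show ?case using False by linarith
    qed
  next
    case True
    have "1 powr (1 - \<beta>) < l powr (1 - \<beta>)"
      using l True index by (intro powr_less_mono2_neg) auto
    then obtain q where q: "1 < q" "q < l powr (1 - \<beta>)" using dense by auto
    have "eventually (\<lambda>t. q < F (l * \<rho> t) / t) at_top"
      using F_scale_\<rho>[of l] q(2) True by (intro order_tendstoD) auto
    moreover have "eventually (\<lambda>t. F (z t) / t < q) at_top"
      using lim q(1) by (rule order_tendstoD)
    ultimately show ?thesis
      using z eventually_gt_at_top[of 0]
    proof eventually_elim
      case (elim t)
      then have "F (z t) / t < F (l * \<rho> t) / t" by linarith
      then have "F (z t) < F (l * \<rho> t)" using elim by (simp add: divide_less_cancel)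
      then show ?case
        using F_less_iff[of "z t" "l * \<rho> t"] elim \<rho>_bounds(1)[of t] True by (simp add: field_simps)
    qed
  qed
qed

text \<open>The region above the threshold \<open>\<rho> (t\<^sup>2)\<close> is forward invariant at large times, because there \<open>F (z t)\<close> grows
with slope at most 2 while the threshold corresponds to \<open>F = t\<^sup>2\<close>. Either the trajectory enters it and
follows \<open>\<rho>\<close>, or it stays below the negligible threshold. The drift \<open>g\<close> is allowed to differ from \<open>f\<close>
so that the statement applies to \<open>- z\<close> too.\<close>
lemma one_sided_dichotomy:
  fixes g z \<eta> :: "real \<Rightarrow> real"
  assumes g: "L-lipschitz_on {-2..2} g" "((\<lambda>x. g x / f x) \<longlongrightarrow> 1) (at_right 0)"
    and z: "\<And>t. t > T \<Longrightarrow> (z has_real_derivative - g (z t - \<eta> t)) (at t)"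
    and \<eta>: "\<And>t. t > T \<Longrightarrow> \<bar>\<eta> t\<bar> \<le> tolerance t"
    and z0: "(z \<longlongrightarrow> 0) at_top"
  shows "((\<lambda>t. z t / \<rho> t) \<longlongrightarrow> 1) at_top \<or> (\<forall>c>0. eventually (\<lambda>t. z t < c * \<rho> t) at_top)"
proof -
  define q where "q t = g (z t - \<eta> t) / f (z t)" for t
  have L: "L \<ge> 0" using g(1) by (rule lipschitz_on_nonneg)
  have q: "eventually (\<lambda>t. z t \<ge> \<rho> (t\<^sup>2) \<longrightarrow> \<bar>q t - 1\<bar> < \<delta>) at_top" if \<delta>: "\<delta> > 0" for \<delta>
  proof -
    have "eventually (\<lambda>x. \<bar>g x / f x - 1\<bar> < \<delta> / 2) (at_right 0)"
      using tendstoD[OF g(2), of "\<delta> / 2"] \<delta> by (simp add: dist_real_def)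
    then obtain b where b: "b > 0" "\<And>x. 0 < x \<Longrightarrow> x < b \<Longrightarrow> \<bar>g x / f x - 1\<bar> < \<delta> / 2"
      unfolding eventually_at_right[OF zero_less_one] by auto
    have "eventually (\<lambda>t. \<bar>z t\<bar> < min b 1) at_top"
      using tendstoD[OF z0, of "min b 1"] b by simp
    moreover have "eventually (\<lambda>t. \<bar>L / (t + 1)\<bar> < \<delta> / 2) at_top"
      using tendstoD[OF inverse_shift_tendsto_0[of L], of "\<delta> / 2"] \<delta> by simp
    moreover have "eventually (\<lambda>t. \<bar>\<eta> t\<bar> < 1) at_top"
      using tendstoD[OF tolerance_tendsto_0[OF \<eta>], of T 1] by simp
    ultimately show ?thesis
      using eventually_gt_at_top[of "max T 0"]
    proof eventually_elim
      case (elim t)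
      show ?case
      proof
        assume zt: "z t \<ge> \<rho> (t\<^sup>2)"
        then have "z t > 0" using \<rho>_bounds(1)[of "t\<^sup>2"] by simp
        then have fz: "f (z t) > 0" by (rule pos)
        have "\<bar>g (z t - \<eta> t) - g (z t)\<bar> \<le> L * \<bar>\<eta> t\<bar>"
        proof -
          have "z t - \<eta> t \<in> {-2..2}" "z t \<in> {-2..2}" using elim by auto
          from lipschitz_onD[OF g(1) this] show ?thesis by (simp add: dist_real_def)
        qed
        also have "\<dots> \<le> L * (f (z t) / (t + 1))"
        proof (intro mult_left_mono L)
          have "\<bar>\<eta> t\<bar> \<le> \<mu> t / (t + 1)"
            using \<eta>[of t] tolerance_le_\<mu>[of t] elim by linarith
          also have "\<dots> \<le> f (z t) / (t + 1)"
            using \<mu>_le[OF zt] elim by (intro divide_right_mono) auto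
          finally show "\<bar>\<eta> t\<bar> \<le> f (z t) / (t + 1)" .
        qed
        finally have "\<bar>g (z t - \<eta> t) - g (z t)\<bar> / f (z t) \<le> L / (t + 1)"
          using fz elim by (simp add: field_simps)
        moreover have "q t - g (z t) / f (z t) = (g (z t - \<eta> t) - g (z t)) / f (z t)"
          by (simp add: q_def diff_divide_distrib)
        then have "\<bar>q t - g (z t) / f (z t)\<bar> = \<bar>g (z t - \<eta> t) - g (z t)\<bar> / f (z t)"
          using fz by (simp add: abs_divide)
        moreover have "\<bar>g (z t) / f (z t) - 1\<bar> < \<delta> / 2"
          using b(2)[OF \<open>z t > 0\<close>] elim by auto
        ultimately show "\<bar>q t - 1\<bar> < \<delta>" using elim by linarith
      qed
    qed
  qed
  have "eventually (\<lambda>t. (z t \<ge> \<rho> (t\<^sup>2) \<longrightarrow> \<bar>q t - 1\<bar> < 1) \<and> t > max T 1) at_top"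
    by (intro eventually_conj q eventually_gt_at_top) simp
  then obtain a where a: "\<And>t. t \<ge> a \<Longrightarrow> z t \<ge> \<rho> (t\<^sup>2) \<Longrightarrow> \<bar>q t - 1\<bar> < 1" "\<And>t. t \<ge> a \<Longrightarrow> t > max T 1"
    unfolding eventually_at_top_linorder by blast
  have Fz: "((\<lambda>t. F (z t)) has_real_derivative q t) (at t)" if "t > T" "z t > 0" for t
    using DERIV_chain2[OF F_deriv[OF that(2)] z[OF that(1)]] by (simp add: q_def)
  show ?thesis
  proof (cases "\<exists>s\<ge>a. z s > \<rho> (s\<^sup>2)")
    case False
    have "eventually (\<lambda>t. z t < c * \<rho> t) at_top" if "c > 0" for c
      using \<rho>_square_less[OF that] eventually_ge_at_top[of a]
      by eventually_elim (use False in force)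
    then show ?thesis by blast
  next
    case True
    then obtain s where s: "s \<ge> a" "z s > \<rho> (s\<^sup>2)" by blast
    have above: "z t > \<rho> (t\<^sup>2)" if "t \<ge> s" for t
    proof -
      define \<kappa> where "\<kappa> = \<rho> (t\<^sup>2)"
      have \<kappa>: "\<kappa> > 0" "F \<kappa> = t\<^sup>2" by (auto simp: \<kappa>_def \<rho>_bounds F_\<rho>)
      have sT: "s > T" "s > 1" using a(2)[OF s(1)] by auto
      \<comment> \<open>The maximum with \<open>\<kappa>\<close>, the lowest threshold on \<open>[s, t]\<close>, keeps the argument of \<open>F\<close> positive.\<close>
      define v where "v r = F (max (z r) \<kappa>) - r\<^sup>2" for r
      have v_neg: "z r > \<kappa>" "z r > \<rho> (r\<^sup>2)" if "v r < 0" "s \<le> r" "r \<le> t" for r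
      proof -
        have "\<kappa> \<le> \<rho> (r\<^sup>2)"
          unfolding \<kappa>_def using that sT by (intro \<rho>_antimono power_mono) auto
        moreover have "F (max (z r) \<kappa>) < F (\<rho> (r\<^sup>2))"
          using that by (simp add: v_def F_\<rho>)
        then have "max (z r) \<kappa> > \<rho> (r\<^sup>2)"
          using F_less_iff[of "max (z r) \<kappa>" "\<rho> (r\<^sup>2)"] \<kappa> \<rho>_bounds(1)[of "r\<^sup>2"] by auto
        ultimately show "z r > \<kappa>" "z r > \<rho> (r\<^sup>2)" by (auto simp: max_def split: if_splits)
      qed
      have "v t < 0"
      proof (rule stays_negative[OF _ \<open>t \<ge> s\<close>])
        have "continuous_on {s..t} z"
          using sT by (intro continuous_at_imp_continuous_on ballI DERIV_isCont[OF z]) auto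
        then show "continuous_on {s..t} v"
          unfolding v_def using \<kappa>
          by (intro continuous_intros continuous_on_compose2[OF F_continuous[of "{0<..}"]]) auto
        have "F (max (z s) \<kappa>) \<le> F (z s)"
          using s(2) \<rho>_bounds(1)[of "s\<^sup>2"] \<kappa> by (subst F_le_iff) auto
        also have "\<dots> < F (\<rho> (s\<^sup>2))"
          using s(2) \<rho>_bounds(1)[of "s\<^sup>2"] by (intro F_strict) auto
        finally show "v s < 0" by (simp add: v_def F_\<rho>)
      next
        fix r assume r: "s < r" "r < t" "v r < 0"
        then have zr: "z r > \<kappa>" "z r > \<rho> (r\<^sup>2)" using v_neg[of r] by auto
        have "((\<lambda>r. F (z r) - r\<^sup>2) has_real_derivative (q r - 2 * r)) (at r)"
          using r sT zr \<kappa> by (auto intro!: derivative_eq_intros Fz)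
        then have "(v has_real_derivative (q r - 2 * r)) (at r)" if "eventually (\<lambda>x. F (z x) - x\<^sup>2 = v x) (nhds r)"
          by (rule iffD1[OF DERIV_cong_ev[OF refl that refl]])
        moreover have "eventually (\<lambda>x. F (z x) - x\<^sup>2 = v x) (nhds r)"
        proof -
          have "(z \<longlongrightarrow> z r) (nhds r)"
            using DERIV_isCont[OF z, of r] r sT by (simp add: isCont_def tendsto_at_iff_tendsto_nhds)
          then have "eventually (\<lambda>x. z x > \<kappa>) (nhds r)"
            using zr(1) by (rule order_tendstoD)
          then show ?thesis by eventually_elim (simp add: v_def max_def)
        qed
        ultimately have "(v has_real_derivative (q r - 2 * r)) (at r)"
          by blast
        moreover have "q r - 2 * r \<le> 0"
          using a(1)[of r] r s(1) zr(2) sT by auto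
        ultimately show "\<exists>D. (v has_real_derivative D) (at r) \<and> D \<le> 0" by blast
      qed
      then show ?thesis using v_neg(2)[of t] \<open>t \<ge> s\<close> by simp
    qed
    have zpos: "z t > 0" if "t \<ge> s" for t
      using above[OF that] \<rho>_bounds(1)[of "t\<^sup>2"] by simp
    have "(q \<longlongrightarrow> 1) at_top"
    proof (rule tendstoI)
      fix \<delta> :: real assume "\<delta> > 0"
      show "eventually (\<lambda>t. dist (q t) 1 < \<delta>) at_top"
        using q[OF \<open>\<delta> > 0\<close>] eventually_ge_at_top[of s]
        by eventually_elim (use above in \<open>auto simp: dist_real_def less_imp_le\<close>)
    qed
    then have q1: "((\<lambda>t. q t / 1) \<longlongrightarrow> 1) at_top" by simp
    have "eventually (\<lambda>t. ((\<lambda>t. F (z t)) has_real_derivative q t) (at t)) at_top"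
      using eventually_ge_at_top[of s]
    proof eventually_elim
      case (elim t)
      then have "t > T" using a(2)[of t] s(1) by simp
      then show ?case using zpos[OF elim] by (rule Fz)
    qed
    moreover have "eventually (\<lambda>t::real. (1::real) \<noteq> 0) at_top" "eventually (\<lambda>t::real. ((\<lambda>t. t) has_real_derivative 1) (at t)) at_top"
      by simp_all
    ultimately have "((\<lambda>t. F (z t) / t) \<longlongrightarrow> 1) at_top"
      by (intro lhospital_at_top_at_top[OF filterlim_ident _ _ _ q1])
    then have "((\<lambda>t. z t / \<rho> t) \<longlongrightarrow> 1) at_top"
      by (intro F_asymp_imp_\<rho>_asymp) (use zpos in \<open>auto intro!: eventually_at_top_linorderI[of s]\<close>)
    then show ?thesis ..
  qed
qed

theorem path_limit:
  assumes odd: "((\<lambda>x. f (- x) / f x) \<longlongrightarrow> - 1) (at_right 0)"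
    and y: "\<And>t. t > T \<Longrightarrow> (y has_real_derivative - f (y t - \<eta> t)) (at t)"
    and \<eta>: "\<And>t. t > T \<Longrightarrow> \<bar>\<eta> t\<bar> \<le> tolerance t"
  shows "\<exists>l\<in>{-1, 0, 1}. ((\<lambda>t. (y t - \<eta> t) / \<rho> t) \<longlongrightarrow> l) at_top"
proof -
  have y0: "(y \<longlongrightarrow> 0) at_top"
    by (rule perturbed_decay[OF continuous_f sign y tolerance_tendsto_0[OF \<eta>]]) auto
  obtain L where L: "L-lipschitz_on {-2..2} f"
    using locally_lipschitz_imp_lipschitz_on_interval[OF lipschitz] by blast
  have up: "((\<lambda>t. y t / \<rho> t) \<longlongrightarrow> 1) at_top \<or> (\<forall>c>0. eventually (\<lambda>t. y t < c * \<rho> t) at_top)"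
  proof (rule one_sided_dichotomy[OF L _ y \<eta> y0])
    have "eventually (\<lambda>x. f x / f x = 1) (at_right 0)"
      using eventually_at_right_less[of "0::real"]
      by eventually_elim (use pos in \<open>simp add: less_imp_neq[symmetric]\<close>)
    then show "((\<lambda>x. f x / f x) \<longlongrightarrow> 1) (at_right 0)"
      by (rule tendsto_eventually)
  qed
  have down: "((\<lambda>t. - y t / \<rho> t) \<longlongrightarrow> 1) at_top \<or> (\<forall>c>0. eventually (\<lambda>t. - y t < c * \<rho> t) at_top)"
  proof (rule one_sided_dichotomy[where g = "\<lambda>x. - f (- x)" and \<eta> = "\<lambda>t. - \<eta> t"])
    show "L-lipschitz_on {-2..2} (\<lambda>x. - f (- x))"
    proof (rule lipschitz_onI)
      fix u v :: real assume "u \<in> {-2..2}" "v \<in> {-2..2}"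
      then show "dist (- f (- u)) (- f (- v)) \<le> L * dist u v"
        using lipschitz_onD[OF L, of "- u" "- v"] by (simp add: dist_real_def abs_minus_commute)
    qed (rule lipschitz_on_nonneg[OF L])
    show "((\<lambda>x. - f (- x) / f x) \<longlongrightarrow> 1) (at_right 0)"
      using tendsto_minus[OF odd] by simp
    show "((\<lambda>t. - y t) has_real_derivative - (- f (- (- y t - - \<eta> t)))) (at t)" if "t > T" for t
      using y[OF that] by (auto intro!: derivative_eq_intros simp: algebra_simps)
    show "\<bar>- \<eta> t\<bar> \<le> tolerance t" if "t > T" for t using \<eta>[OF that] by simp
    show "((\<lambda>t. - y t) \<longlongrightarrow> 0) at_top" using tendsto_minus[OF y0] by simp
  qed
  have "\<exists>l\<in>{-1, 0, 1}. ((\<lambda>t. y t / \<rho> t) \<longlongrightarrow> l) at_top"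
  proof -
    consider "((\<lambda>t. y t / \<rho> t) \<longlongrightarrow> 1) at_top" | "((\<lambda>t. - y t / \<rho> t) \<longlongrightarrow> 1) at_top" |
      "\<And>c. c > 0 \<Longrightarrow> eventually (\<lambda>t. y t < c * \<rho> t) at_top"
      "\<And>c. c > 0 \<Longrightarrow> eventually (\<lambda>t. - y t < c * \<rho> t) at_top"
      using up down by blast
    then show ?thesis
    proof cases
      case 2
      then have "((\<lambda>t. y t / \<rho> t) \<longlongrightarrow> - 1) at_top"
        using tendsto_minus[OF 2] by simp
      then show ?thesis by blast
    next
      case 3
      have "((\<lambda>t. y t / \<rho> t) \<longlongrightarrow> 0) at_top"
      proof (rule tendstoI)
        fix c :: real assume "c > 0"
        show "eventually (\<lambda>t. dist (y t / \<rho> t) 0 < c) at_top"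
          using 3(1)[OF \<open>c > 0\<close>] 3(2)[OF \<open>c > 0\<close>] eventually_ge_at_top[of "0::real"]
        proof eventually_elim
          case (elim t)
          then show ?case
            using \<rho>_bounds(1)[of t] by (simp add: abs_less_iff field_simps)
        qed
      qed
      then show ?thesis by blast
    qed blast
  qed
  then obtain l where l: "l \<in> {-1, 0, 1}" "((\<lambda>t. y t / \<rho> t) \<longlongrightarrow> l) at_top" by blast
  have "((\<lambda>t. y t / \<rho> t - \<eta> t / \<rho> t) \<longlongrightarrow> l - 0) at_top"
    by (intro tendsto_diff l tolerance_over_\<rho>[OF \<eta>])
  then show ?thesis
    using l(1) by (intro bexI[of _ l]) (auto simp: diff_divide_distrib)
qed

end

section \<open>Riemann sums and integration by parts along a path\<close>

text \<open>The points \<open>grid t m\<close> divide \<open>[0, t]\<close> into \<open>Suc m\<close> equal parts, so that \<open>m = 0\<close> is not exceptional.\<close>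
definition grid :: "real \<Rightarrow> nat \<Rightarrow> nat \<Rightarrow> real" where
  "grid t m k = real k * t / real (Suc m)"

lemma grid_0 [simp]: "grid t m 0 = 0"
  by (simp add: grid_def)

lemma grid_end [simp]: "grid t m (Suc m) = t"
  unfolding grid_def by (rule nonzero_mult_div_cancel_left) simp

lemma grid_step: "grid t m (Suc k) - grid t m k = t / real (Suc m)"
  unfolding grid_def diff_divide_distrib[symmetric] by (simp add: algebra_simps)

lemma grid_mono: "t \<ge> 0 \<Longrightarrow> j \<le> k \<Longrightarrow> grid t m j \<le> grid t m k"
  unfolding grid_def by (intro divide_right_mono mult_right_mono) auto

lemma grid_bounds: "t \<ge> 0 \<Longrightarrow> 0 \<le> grid t m k" "t \<ge> 0 \<Longrightarrow> k \<le> Suc m \<Longrightarrow> grid t m k \<le> t"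
  using grid_mono[of t 0 k m] grid_mono[of t k "Suc m" m] by auto

lemma grid_fine:
  assumes "\<delta> > 0"
  shows "eventually (\<lambda>m. t / real (Suc m) < \<delta>) sequentially"
proof -
  have "(\<lambda>m. t / real (Suc m)) \<longlonglongrightarrow> 0"
    using LIMSEQ_Suc[OF lim_const_over_n[of t]] by simp
  then show ?thesis using assms by (rule order_tendstoD)
qed

lemma integral_grid_sum:
  fixes g :: "real \<Rightarrow> real"
  assumes t: "t \<ge> 0" and g: "continuous_on {0..t} g"
  shows "integral {0..t} g = (\<Sum>k<Suc m. integral {grid t m k..grid t m (Suc k)} g)"
proof -
  have "integral {0..grid t m n} g = (\<Sum>k<n. integral {grid t m k..grid t m (Suc k)} g)" if "n \<le> Suc m" for n
    using that
  proof (induction n)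
    case (Suc n)
    have "g integrable_on {0..grid t m (Suc n)}"
      using grid_bounds(2)[OF t Suc.prems] by (intro integrable_continuous_interval continuous_on_subset[OF g]) auto
    then have "integral {0..grid t m n} g + integral {grid t m n..grid t m (Suc n)} g = integral {0..grid t m (Suc n)} g"
      using t by (intro Henstock_Kurzweil_Integration.integral_combine grid_mono grid_bounds) auto
    with Suc show ?case by simp
  qed simp
  from this[of "Suc m"] show ?thesis by simp
qed

text \<open>Uniform continuity of \<open>g\<close> lets \<open>g\<close> be frozen on every cell. The weight \<open>D = 1\<close> gives ordinary Riemann sums;
a derivative as weight gives Riemann-Stieltjes sums.\<close>
lemma weighted_riemann_sum:
  fixes g D :: "real \<Rightarrow> real" and \<tau> :: "nat \<Rightarrow> nat \<Rightarrow> real"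
  assumes t: "t \<ge> 0" and g: "continuous_on {0..t} g" and D: "continuous_on {0..t} D"
    and tag: "\<And>m k. k \<le> m \<Longrightarrow> \<tau> m k \<in> {grid t m k..grid t m (Suc k)}"
  shows "(\<lambda>m. \<Sum>k<Suc m. g (\<tau> m k) * integral {grid t m k..grid t m (Suc k)} D) \<longlonglongrightarrow> integral {0..t} (\<lambda>s. D s * g s)"
proof (rule LIMSEQ_I)
  fix e :: real assume "e > 0"
  obtain C where C: "C > 0" "\<And>s. s \<in> {0..t} \<Longrightarrow> \<bar>D s\<bar> \<le> C"
    using compact_imp_bounded[OF compact_continuous_image[OF D compact_Icc]] unfolding bounded_pos by auto
  define e' where "e' = e / (C * t + 1)"
  have e': "e' > 0" using \<open>e > 0\<close> C t by (simp add: e'_def add_nonneg_pos)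
  have "uniformly_continuous_on {0..t} g"
    using g by (intro compact_uniformly_continuous) auto
  then obtain \<delta> where \<delta>: "\<delta> > 0" "\<And>x y. x \<in> {0..t} \<Longrightarrow> y \<in> {0..t} \<Longrightarrow> dist y x < \<delta> \<Longrightarrow> dist (g y) (g x) < e'"
    using e' unfolding uniformly_continuous_on_def by metis
  obtain N where N: "\<And>m. m \<ge> N \<Longrightarrow> t / real (Suc m) < \<delta>"
    using grid_fine[OF \<delta>(1)] unfolding eventually_sequentially by blast
  show "\<exists>N. \<forall>m\<ge>N. norm ((\<Sum>k<Suc m. g (\<tau> m k) * integral {grid t m k..grid t m (Suc k)} D) - integral {0..t} (\<lambda>s. D s * g s)) < e"
  proof (intro exI allI impI)
    fix m assume m: "m \<ge> N"
    let ?I = "\<lambda>k. {grid t m k..grid t m (Suc k)}"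
    have sub: "?I k \<subseteq> {0..t}" if "k < Suc m" for k
      using grid_bounds(1)[OF t, of m k] grid_bounds(2)[OF t, of "Suc k" m] that by auto
    have piece: "\<bar>g (\<tau> m k) * integral (?I k) D - integral (?I k) (\<lambda>s. D s * g s)\<bar> \<le> C * e' * (t / real (Suc m))"
      if k: "k < Suc m" for k
    proof -
      have iD: "D integrable_on ?I k" "(\<lambda>s. D s * g s) integrable_on ?I k"
        by (intro integrable_continuous_interval continuous_intros continuous_on_subset[OF D sub[OF k]]
            continuous_on_subset[OF g sub[OF k]])+
      have "g (\<tau> m k) * integral (?I k) D - integral (?I k) (\<lambda>s. D s * g s) = integral (?I k) (\<lambda>s. g (\<tau> m k) * D s - D s * g s)"
        using iD by (subst Henstock_Kurzweil_Integration.integral_diff) (auto intro: integrable_on_mult_right)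
      also have "\<dots> = integral (?I k) (\<lambda>s. D s * (g (\<tau> m k) - g s))"
        by (simp add: algebra_simps)
      finally have eq: "g (\<tau> m k) * integral (?I k) D - integral (?I k) (\<lambda>s. D s * g s) = integral (?I k) (\<lambda>s. D s * (g (\<tau> m k) - g s))" .
      have "norm (integral (?I k) (\<lambda>s. D s * (g (\<tau> m k) - g s))) \<le> (C * e') * (grid t m (Suc k) - grid t m k)"
      proof (rule integral_bound)
        show "grid t m k \<le> grid t m (Suc k)" using t by (intro grid_mono) auto
        show "continuous_on (?I k) (\<lambda>s. D s * (g (\<tau> m k) - g s))"
          by (intro continuous_intros continuous_on_subset[OF D sub[OF k]] continuous_on_subset[OF g sub[OF k]])
        fix s assume s: "s \<in> ?I k"
        have tk: "\<tau> m k \<in> ?I k" using tag k by auto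
        have "\<bar>\<tau> m k - s\<bar> \<le> grid t m (Suc k) - grid t m k" using s tk by auto
        then have "dist (g (\<tau> m k)) (g s) < e'"
          using N[OF m] s tk sub[OF k] by (intro \<delta>(2)) (auto simp: grid_step dist_real_def)
        then show "norm (D s * (g (\<tau> m k) - g s)) \<le> C * e'"
          using C(2)[of s] s sub[OF k] C(1) unfolding norm_mult by (intro mult_mono) (auto simp: dist_real_def)
      qed
      then show ?thesis by (simp add: eq grid_step)
    qed
    have "(\<Sum>k<Suc m. g (\<tau> m k) * integral (?I k) D) - integral {0..t} (\<lambda>s. D s * g s) =
      (\<Sum>k<Suc m. g (\<tau> m k) * integral (?I k) D - integral (?I k) (\<lambda>s. D s * g s))"
      unfolding sum_subtractf by (subst integral_grid_sum[OF t, of _ m]) (auto intro!: continuous_intros g D)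
    also have "\<bar>\<dots>\<bar> \<le> (\<Sum>k<Suc m. C * e' * (t / real (Suc m)))"
      by (rule order_trans[OF sum_abs]) (intro sum_mono piece, simp)
    also have "\<dots> = C * e' * t"
      by (simp del: of_nat_Suc)
    also have "\<dots> < e"
    proof -
      have "C * t \<ge> 0" using C t by simp
      then have "C * t / (C * t + 1) < 1" by (simp add: field_simps)
      then have "e * (C * t / (C * t + 1)) < e * 1"
        using \<open>e > 0\<close> by (intro mult_strict_left_mono)
      then show ?thesis by (simp add: e'_def mult_ac)
    qed
    finally show "norm ((\<Sum>k<Suc m. g (\<tau> m k) * integral (?I k) D) - integral {0..t} (\<lambda>s. D s * g s)) < e"
      by simp
  qed
qed

lemma riemann_sum_tendsto:
  fixes g :: "real \<Rightarrow> real"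
  assumes t: "t \<ge> 0" and g: "continuous_on {0..t} g"
  shows "(\<lambda>m. \<Sum>k<Suc m. g (grid t m k) * (t / real (Suc m))) \<longlonglongrightarrow> integral {0..t} g"
proof -
  have I: "integral {grid t m k..grid t m (Suc k)} (\<lambda>_. 1::real) = t / real (Suc m)" for m k
    using grid_mono[OF t, of k "Suc k" m] grid_step[of t m k] by simp
  moreover have "grid t m k \<in> {grid t m k..grid t m (Suc k)}" for m k
    using grid_mono[OF t, of k "Suc k" m] by simp
  ultimately show ?thesis
    using weighted_riemann_sum[OF t g continuous_on_const[of _ 1], of "grid t", unfolded I mult_1] by blast
qed

text \<open>The Riemann-Stieltjes integral of \<open>\<sigma>\<close> with respect to \<open>b\<close>, integrated by parts: it is meaningful for
a merely continuous \<open>b\<close>, with \<open>D\<close> the derivative of \<open>\<sigma>\<close>.\<close>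
definition path_integral :: "(real \<Rightarrow> real) \<Rightarrow> (real \<Rightarrow> real) \<Rightarrow> (real \<Rightarrow> real) \<Rightarrow> real \<Rightarrow> real" where
  "path_integral \<sigma> D b t = \<sigma> t * b t - \<sigma> 0 * b 0 - integral {0..t} (\<lambda>s. D s * b s)"

text \<open>Summation by parts moves the increments from \<open>b\<close> to \<open>\<sigma>\<close>, and the increments of \<open>\<sigma>\<close> are integrals
of \<open>D\<close>.\<close>
lemma path_integral_tendsto:
  fixes \<sigma> D b :: "real \<Rightarrow> real"
  assumes t: "t \<ge> 0" and b: "continuous_on {0..t} b" and D: "continuous_on {0..t} D"
    and \<sigma>: "\<And>s. s \<in> {0..t} \<Longrightarrow> (\<sigma> has_real_derivative D s) (at s within {0..t})"
  shows "(\<lambda>m. \<Sum>k<Suc m. \<sigma> (grid t m k) * (b (grid t m (Suc k)) - b (grid t m k))) \<longlonglongrightarrow> path_integral \<sigma> D b t"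
proof -
  have abel: "(\<Sum>k<n. s k * (c (Suc k) - c k)) = s n * c n - s 0 * c 0 - (\<Sum>k<n. c (Suc k) * (s (Suc k) - s k))"
    for s c :: "nat \<Rightarrow> real" and n
    by (induction n) (auto simp: algebra_simps)
  have D_int: "integral {grid t m k..grid t m (Suc k)} D = \<sigma> (grid t m (Suc k)) - \<sigma> (grid t m k)" if "k < Suc m" for m k
  proof (rule integral_unique, rule fundamental_theorem_of_calculus)
    show "grid t m k \<le> grid t m (Suc k)" using t by (intro grid_mono) auto
    fix s assume s: "s \<in> {grid t m k..grid t m (Suc k)}"
    have sub: "{grid t m k..grid t m (Suc k)} \<subseteq> {0..t}"
      using grid_bounds(1)[OF t, of m k] grid_bounds(2)[OF t, of "Suc k" m] that by auto
    then have "(\<sigma> has_real_derivative D s) (at s within {grid t m k..grid t m (Suc k)})"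
      using s by (intro has_field_derivative_subset[OF \<sigma>]) auto
    then show "(\<sigma> has_vector_derivative D s) (at s within {grid t m k..grid t m (Suc k)})"
      by (simp add: has_real_derivative_iff_has_vector_derivative)
  qed
  have "(\<lambda>m. \<Sum>k<Suc m. b (grid t m (Suc k)) * integral {grid t m k..grid t m (Suc k)} D) \<longlonglongrightarrow> integral {0..t} (\<lambda>s. D s * b s)"
    using grid_mono[OF t] by (intro weighted_riemann_sum[OF t b D]) auto
  then have "(\<lambda>m. \<Sum>k<Suc m. b (grid t m (Suc k)) * (\<sigma> (grid t m (Suc k)) - \<sigma> (grid t m k))) \<longlonglongrightarrow> integral {0..t} (\<lambda>s. D s * b s)"
    by (simp add: D_int cong: sum.cong_simp del: sum.lessThan_Suc)
  then have "(\<lambda>m. \<sigma> t * b t - \<sigma> 0 * b 0 - (\<Sum>k<Suc m. b (grid t m (Suc k)) * (\<sigma> (grid t m (Suc k)) - \<sigma> (grid t m k))))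
    \<longlonglongrightarrow> path_integral \<sigma> D b t"
    unfolding path_integral_def by (intro tendsto_diff tendsto_const)
  then show ?thesis
    by (subst abel[of "\<lambda>k. \<sigma> (grid t _ k)" "\<lambda>k. b (grid t _ k)"]) simp
qed

section \<open>Brownian increments and the Ito isometry\<close>

lemma space_generated_sigma [simp]: "space (generated_sigma M B T) = space M"
  unfolding generated_sigma_def by (auto simp: space_measure_of_conv)

lemma space_natural_filtration [simp]: "space (natural_filtration M B t) = space M"
  by (simp add: natural_filtration_def)

lemma sets_generated_sigma:
  "sets (generated_sigma M B T) = sigma_sets (space M) (\<Union>s\<in>T. {B s -` A \<inter> space M | A. A \<in> sets borel})"
  unfolding generated_sigma_def by (rule sets_measure_of) auto

lemma generated_sigma_mono:
  assumes "S \<subseteq> T" shows "sets (generated_sigma M B S) \<subseteq> sets (generated_sigma M B T)"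
  unfolding sets_generated_sigma using assms by (intro sigma_sets_mono') auto

lemma generated_sigma_measurable:
  assumes "s \<in> T" shows "B s \<in> borel_measurable (generated_sigma M B T)"
  by (rule measurableI) (use assms in \<open>auto simp: sets_generated_sigma intro!: sigma_sets.Basic\<close>)

lemma natural_filtration_mono_measurable:
  assumes "X \<in> borel_measurable (natural_filtration M B s)" "s \<le> t"
  shows "X \<in> borel_measurable (natural_filtration M B t)"
proof -
  have "sets (natural_filtration M B s) \<subseteq> sets (natural_filtration M B t)"
    unfolding natural_filtration_def by (rule generated_sigma_mono) (use assms(2) in auto)
  then have "subalgebra (natural_filtration M B t) (natural_filtration M B s)"
    by (simp add: subalgebra_def)
  then show ?thesis using assms(1) by (rule measurable_from_subalg)
qed

lemma terminal_sigma_measurable: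
  assumes "X \<in> borel_measurable (natural_filtration M B s)"
  shows "X \<in> borel_measurable (terminal_sigma M B)"
proof -
  have "sets (natural_filtration M B s) \<subseteq> sets (terminal_sigma M B)"
    unfolding natural_filtration_def terminal_sigma_def by (rule generated_sigma_mono) auto
  then have "subalgebra (terminal_sigma M B) (natural_filtration M B s)"
    by (simp add: subalgebra_def terminal_sigma_def)
  then show ?thesis using assms by (rule measurable_from_subalg)
qed

lemma natural_filtration_measurable:
  "0 \<le> s \<Longrightarrow> s \<le> t \<Longrightarrow> B s \<in> borel_measurable (natural_filtration M B t)"
  unfolding natural_filtration_def by (rule generated_sigma_measurable) auto

context brownian_motion
begin

abbreviation \<F> where "\<F> \<equiv> natural_filtration M B"

lemma sets_filtration_subset: "sets (\<F> t) \<subseteq> sets M"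
  unfolding natural_filtration_def sets_generated_sigma
  using random_variable by (intro sets.sigma_sets_subset) (auto intro: measurable_sets)

lemma filtration_measurable_M:
  assumes "X \<in> borel_measurable (\<F> t)" shows "X \<in> borel_measurable M"
  using sets_filtration_subset[of t] assms
  by (intro measurable_from_subalg[of M "\<F> t"]) (simp_all add: subalgebra_def)

lemma increment_indep_var:
  assumes "0 \<le> s" "s < t" and X: "X \<in> borel_measurable (\<F> s)" and g: "g \<in> borel_measurable borel"
  shows "indep_var borel X borel (\<lambda>\<omega>. g (B t \<omega> - B s \<omega>) :: real)"
proof -
  have D: "(\<lambda>\<omega>. B t \<omega> - B s \<omega>) \<in> borel_measurable M"
    using random_variable assms by (intro borel_measurable_diff) auto
  have "indep_set (sigma_sets (space M) {X -` A \<inter> space M |A. A \<in> sets borel})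
     (sigma_sets (space M) {(\<lambda>\<omega>. B t \<omega> - B s \<omega>) -` A \<inter> space M |A. A \<in> sets borel})"
    unfolding indep_set_def
  proof (rule indep_sets_mono_sets[OF increment_indep[OF assms(1,2), unfolded indep_set_def]])
    fix b :: bool
    have "sigma_sets (space M) {X -` A \<inter> space M |A. A \<in> sets borel} \<subseteq> sets (\<F> s)"
      using sets.sigma_sets_subset[of "{X -` A \<inter> space M |A. A \<in> sets borel}" "\<F> s"] measurable_sets[OF X]
      by auto
    then show "(case b of True \<Rightarrow> sigma_sets (space M) {X -` A \<inter> space M |A. A \<in> sets borel}
        | False \<Rightarrow> sigma_sets (space M) {(\<lambda>\<omega>. B t \<omega> - B s \<omega>) -` A \<inter> space M |A. A \<in> sets borel})
      \<subseteq> (case b of True \<Rightarrow> sets (\<F> s)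
        | False \<Rightarrow> sets (vimage_algebra (space M) (\<lambda>\<omega>. B t \<omega> - B s \<omega>) borel))"
      by (auto split: bool.splits simp: sets_vimage_algebra)
  qed
  then have "indep_var borel X borel (\<lambda>\<omega>. B t \<omega> - B s \<omega>)"
    unfolding indep_var_eq using filtration_measurable_M[OF X] D by auto
  from indep_var_compose[OF this measurable_ident g] show ?thesis
    by (simp add: comp_def)
qed

lemma increment_moments:
  assumes "0 \<le> s" "s \<le> t"
  shows "integrable M (\<lambda>\<omega>. B t \<omega> - B s \<omega>)" "expectation (\<lambda>\<omega>. B t \<omega> - B s \<omega>) = 0"
    "integrable M (\<lambda>\<omega>. (B t \<omega> - B s \<omega>)\<^sup>2)" "expectation (\<lambda>\<omega>. (B t \<omega> - B s \<omega>)\<^sup>2) = t - s"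
proof -
  let ?D = "\<lambda>\<omega>. B t \<omega> - B s \<omega>"
  have "integrable M ?D \<and> expectation ?D = 0 \<and> integrable M (\<lambda>\<omega>. (?D \<omega>)\<^sup>2) \<and> expectation (\<lambda>\<omega>. (?D \<omega>)\<^sup>2) = t - s"
  proof (cases "s = t")
    case False
    then have st: "s < t" and pos: "sqrt (t - s) > 0" using assms by auto
    note N = increment_normal[OF assms(1) st]
    have i1: "integrable M ?D"
      using distributed_integrable[OF N, of "\<lambda>x. x"] integrable_normal_moment_nz_1[OF pos, of 0] by simp
    have i2: "integrable M (\<lambda>\<omega>. (?D \<omega>)\<^sup>2)"
      using distributed_integrable[OF N, of "\<lambda>x. x\<^sup>2"] integrable_normal_moment[OF pos, of 0 2] by simp
    have e1: "expectation ?D = 0"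
      by (rule normal_distributed_expectation[OF pos N])
    have "variance ?D = (sqrt (t - s))\<^sup>2"
      by (rule normal_distributed_variance[OF pos N])
    then have e2: "expectation (\<lambda>\<omega>. (?D \<omega>)\<^sup>2) = t - s"
      using e1 st by simp
    show ?thesis using i1 i2 e1 e2 by blast
  qed simp
  then show "integrable M ?D" "expectation ?D = 0"
    "integrable M (\<lambda>\<omega>. (?D \<omega>)\<^sup>2)" "expectation (\<lambda>\<omega>. (?D \<omega>)\<^sup>2) = t - s" by auto
qed

lemma increment_orthogonal:
  assumes "0 \<le> s" "s \<le> t" "X \<in> borel_measurable (\<F> s)" "integrable M X"
  shows "integrable M (\<lambda>\<omega>. X \<omega> * (B t \<omega> - B s \<omega>))" "expectation (\<lambda>\<omega>. X \<omega> * (B t \<omega> - B s \<omega>)) = 0"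
    "integrable M (\<lambda>\<omega>. X \<omega> * (B t \<omega> - B s \<omega>)\<^sup>2)"
    "expectation (\<lambda>\<omega>. X \<omega> * (B t \<omega> - B s \<omega>)\<^sup>2) = expectation X * (t - s)"
proof -
  let ?D = "\<lambda>\<omega>. B t \<omega> - B s \<omega>"
  have "integrable M (\<lambda>\<omega>. X \<omega> * ?D \<omega>) \<and> expectation (\<lambda>\<omega>. X \<omega> * ?D \<omega>) = 0 \<and>
    integrable M (\<lambda>\<omega>. X \<omega> * (?D \<omega>)\<^sup>2) \<and> expectation (\<lambda>\<omega>. X \<omega> * (?D \<omega>)\<^sup>2) = expectation X * (t - s)"
  proof (cases "s = t")
    case False
    then have st: "s < t" using assms by auto
    note m = increment_moments[OF assms(1,2)]
    have i1: "indep_var borel X borel ?D"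
      using increment_indep_var[OF assms(1) st assms(3), of "\<lambda>x. x"] by simp
    have i2: "indep_var borel X borel (\<lambda>\<omega>. (?D \<omega>)\<^sup>2)"
      using increment_indep_var[OF assms(1) st assms(3), of "\<lambda>x. x\<^sup>2"] by simp
    show ?thesis
      using indep_var_lebesgue_integral[OF i1 assms(4) m(1)] indep_var_integrable[OF i1 assms(4) m(1)]
        indep_var_lebesgue_integral[OF i2 assms(4) m(3)] indep_var_integrable[OF i2 assms(4) m(3)] m(2,4)
      by simp
  qed simp
  then show "integrable M (\<lambda>\<omega>. X \<omega> * ?D \<omega>)" "expectation (\<lambda>\<omega>. X \<omega> * ?D \<omega>) = 0"
    "integrable M (\<lambda>\<omega>. X \<omega> * (?D \<omega>)\<^sup>2)" "expectation (\<lambda>\<omega>. X \<omega> * (?D \<omega>)\<^sup>2) = expectation X * (t - s)"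
    by auto
qed

text \<open>The admissible coefficients of an elementary process on an interval that starts at time \<open>s\<close>.\<close>
definition simple_at :: "real \<Rightarrow> ('a \<Rightarrow> real) \<Rightarrow> bool" where
  "simple_at s X \<longleftrightarrow> X \<in> borel_measurable (\<F> s) \<and> bounded (X ` space M)"

lemma simple_at_bounded: "simple_at s X \<Longrightarrow> \<exists>C\<ge>0. \<forall>\<omega>\<in>space M. \<bar>X \<omega>\<bar> \<le> C"
proof -
  assume "simple_at s X"
  then obtain b where "b > 0" "\<forall>x\<in>X ` space M. norm x \<le> b"
    unfolding simple_at_def bounded_pos by blast
  then show ?thesis by (intro exI[of _ b]) auto
qed

lemma simple_at_mult:
  assumes "simple_at s X" "simple_at s Y" shows "simple_at s (\<lambda>\<omega>. X \<omega> * Y \<omega>)"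
proof -
  obtain C D where CD: "C \<ge> 0" "\<And>\<omega>. \<omega> \<in> space M \<Longrightarrow> \<bar>X \<omega>\<bar> \<le> C" "\<And>\<omega>. \<omega> \<in> space M \<Longrightarrow> \<bar>Y \<omega>\<bar> \<le> D"
    using simple_at_bounded[OF assms(1)] simple_at_bounded[OF assms(2)] by blast
  have "\<bar>X \<omega> * Y \<omega>\<bar> \<le> C * D" if "\<omega> \<in> space M" for \<omega>
    unfolding abs_mult using CD(2,3)[OF that] CD(1) by (intro mult_mono) auto
  then have "bounded ((\<lambda>\<omega>. X \<omega> * Y \<omega>) ` space M)"
    by (intro boundedI[of _ "C * D"]) auto
  then show ?thesis
    using assms unfolding simple_at_def by (intro conjI borel_measurable_times) simp_all
qed

lemma simple_at_const: "simple_at s (\<lambda>_. c)"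
  unfolding simple_at_def by (auto intro!: boundedI[of _ "\<bar>c\<bar>"])

lemma simple_at_mono: "simple_at s X \<Longrightarrow> s \<le> t \<Longrightarrow> simple_at t X"
  unfolding simple_at_def by (elim conjE, intro conjI natural_filtration_mono_measurable[of X M B s t])

lemma simple_at_integrable_mult:
  assumes X: "simple_at s X" and V: "integrable M V"
  shows "integrable M (\<lambda>\<omega>. X \<omega> * V \<omega>)"
proof -
  obtain C where C: "\<And>\<omega>. \<omega> \<in> space M \<Longrightarrow> \<bar>X \<omega>\<bar> \<le> C"
    using simple_at_bounded[OF X] by blast
  have "X \<in> borel_measurable M"
    using X unfolding simple_at_def by (intro filtration_measurable_M[of X s]) simp
  then have meas: "(\<lambda>\<omega>. X \<omega> * V \<omega>) \<in> borel_measurable M"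
    by (rule borel_measurable_times[OF _ borel_measurable_integrable[OF V]])
  have "AE \<omega> in M. norm (X \<omega> * V \<omega>) \<le> norm (C * V \<omega>)"
  proof (rule AE_I2)
    fix \<omega> assume "\<omega> \<in> space M"
    then have "\<bar>X \<omega>\<bar> \<le> \<bar>C\<bar>" using C[of \<omega>] by linarith
    then show "norm (X \<omega> * V \<omega>) \<le> norm (C * V \<omega>)"
      by (simp add: abs_mult mult_right_mono)
  qed
  then show ?thesis
    by (rule Bochner_Integration.integrable_bound[OF integrable_mult_right[OF V] meas])
qed

lemma simple_at_integrable: "simple_at s X \<Longrightarrow> integrable M X"
  using simple_at_integrable_mult[of s X "\<lambda>_. 1"] by simp

lemma increment_measurable:
  assumes "0 \<le> a" "a \<le> t" "0 \<le> b" "b \<le> t"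
  shows "(\<lambda>\<omega>. B b \<omega> - B a \<omega>) \<in> borel_measurable (\<F> t)"
  using assms by (intro borel_measurable_diff natural_filtration_measurable)

lemma past_product_orthogonal:
  assumes "0 \<le> a" "a \<le> b" "b \<le> c" "c \<le> d" "simple_at c X" "simple_at c Y"
  shows "integrable M (\<lambda>\<omega>. X \<omega> * (B b \<omega> - B a \<omega>) * (Y \<omega> * (B d \<omega> - B c \<omega>)))"
    "expectation (\<lambda>\<omega>. X \<omega> * (B b \<omega> - B a \<omega>) * (Y \<omega> * (B d \<omega> - B c \<omega>))) = 0"
proof -
  let ?W = "\<lambda>\<omega>. (X \<omega> * Y \<omega>) * (B b \<omega> - B a \<omega>)"
  have "?W \<in> borel_measurable (\<F> c)"
    by (rule borel_measurable_times[OF borel_measurable_times increment_measurable])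
      (use assms(1-4) assms(5,6)[unfolded simple_at_def] in simp_all)
  moreover have "integrable M ?W"
    using assms by (intro simple_at_integrable_mult simple_at_mult increment_moments)
  ultimately have "integrable M (\<lambda>\<omega>. ?W \<omega> * (B d \<omega> - B c \<omega>))" "expectation (\<lambda>\<omega>. ?W \<omega> * (B d \<omega> - B c \<omega>)) = 0"
    using increment_orthogonal[of c d ?W] assms by auto
  then show "integrable M (\<lambda>\<omega>. X \<omega> * (B b \<omega> - B a \<omega>) * (Y \<omega> * (B d \<omega> - B c \<omega>)))"
    "expectation (\<lambda>\<omega>. X \<omega> * (B b \<omega> - B a \<omega>) * (Y \<omega> * (B d \<omega> - B c \<omega>))) = 0"
    by (simp_all add: mult_ac)
qed

text \<open>The part of the first increment before time \<open>c\<close> is orthogonal to the second increment. After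
time \<open>c\<close> both increments start together, and only the square of their common part has a
nonzero mean.\<close>
lemma increment_product_ordered:
  assumes "0 \<le> a" "a \<le> b" "a \<le> c" "c \<le> d" and X: "simple_at a X" and Y: "simple_at c Y"
  shows "has_bochner_integral M (\<lambda>\<omega>. X \<omega> * (B b \<omega> - B a \<omega>) * (Y \<omega> * (B d \<omega> - B c \<omega>)))
    (expectation (\<lambda>\<omega>. X \<omega> * Y \<omega>) * measure lborel ({a..<b} \<inter> {c..<d}))"
proof -
  have Xc: "simple_at c X" using X \<open>a \<le> c\<close> by (rule simple_at_mono)
  show ?thesis
  proof (cases "b \<le> c")
    case True
    then have empty: "{a..<b} \<inter> {c..<d} = {}" by auto
    show ?thesis
      unfolding empty using past_product_orthogonal[OF assms(1,2) True assms(4) Xc Y]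
      by (simp add: has_bochner_integral_iff)
  next
    case False
    define m where "m = min b d"
    define m' where "m' = max b d"
    have m: "c \<le> m" "m \<le> m'" "0 \<le> c" using False assms by (auto simp: m_def m'_def)
    define Z where "Z = (\<lambda>\<omega>. X \<omega> * Y \<omega>)"
    have Z: "simple_at c Z" unfolding Z_def using Xc Y by (rule simple_at_mult)
    have "{a..<b} \<inter> {c..<d} = {c..<m}" using False assms by (auto simp: m_def)
    then have meas: "measure lborel ({a..<b} \<inter> {c..<d}) = m - c" using m by simp
    have h1: "has_bochner_integral M (\<lambda>\<omega>. X \<omega> * (B c \<omega> - B a \<omega>) * (Y \<omega> * (B d \<omega> - B c \<omega>))) 0"
      using past_product_orthogonal[OF assms(1,3) order_refl assms(4) Xc Y]
      by (simp add: has_bochner_integral_iff)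
    have h2: "has_bochner_integral M (\<lambda>\<omega>. Z \<omega> * (B m \<omega> - B c \<omega>)\<^sup>2) (expectation Z * (m - c))"
      using increment_orthogonal(3,4)[of c m Z] m Z simple_at_integrable[OF Z]
      by (auto simp: has_bochner_integral_iff simple_at_def)
    have h3: "has_bochner_integral M (\<lambda>\<omega>. Z \<omega> * (B m \<omega> - B c \<omega>) * (1 * (B m' \<omega> - B m \<omega>))) 0"
      using past_product_orthogonal[of c m m m' Z "\<lambda>_. 1"] m simple_at_mono[OF Z m(1)] simple_at_const
      by (simp add: has_bochner_integral_iff)
    have "X \<omega> * (B b \<omega> - B a \<omega>) * (Y \<omega> * (B d \<omega> - B c \<omega>)) =
      X \<omega> * (B c \<omega> - B a \<omega>) * (Y \<omega> * (B d \<omega> - B c \<omega>)) + (Z \<omega> * (B m \<omega> - B c \<omega>)\<^sup>2 +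
        Z \<omega> * (B m \<omega> - B c \<omega>) * (1 * (B m' \<omega> - B m \<omega>)))" for \<omega>
      by (auto simp: Z_def m_def m'_def min_def max_def algebra_simps power2_eq_square)
    with has_bochner_integral_add[OF h1 has_bochner_integral_add[OF h2 h3]]
    show ?thesis unfolding meas by (simp add: Z_def)
  qed
qed

lemma increment_product:
  assumes "0 \<le> a" "a \<le> b" "0 \<le> c" "c \<le> d" and X: "simple_at a X" and Y: "simple_at c Y"
  shows "has_bochner_integral M (\<lambda>\<omega>. X \<omega> * (B b \<omega> - B a \<omega>) * (Y \<omega> * (B d \<omega> - B c \<omega>)))
    (expectation (\<lambda>\<omega>. X \<omega> * Y \<omega>) * measure lborel ({a..<b} \<inter> {c..<d}))"
proof (cases "a \<le> c")
  case True
  with increment_product_ordered[of a b c d X Y] assms show ?thesis by simp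
next
  case False
  with increment_product_ordered[of c d a b Y X] assms show ?thesis
    by (simp add: mult.commute Int_commute)
qed

text \<open>The intervals may overlap in any way. Hence differences of integrals with respect to different
partitions are covered without passing to a common refinement.\<close>
lemma simple_sum_isometry:
  fixes a b :: "'i \<Rightarrow> real" and X :: "'i \<Rightarrow> 'a \<Rightarrow> real"
  assumes S: "finite S" and i: "\<And>i. i \<in> S \<Longrightarrow> 0 \<le> a i" "\<And>i. i \<in> S \<Longrightarrow> a i \<le> b i"
    "\<And>i. i \<in> S \<Longrightarrow> simple_at (a i) (X i)"
  shows "(\<integral>\<^sup>+\<omega>. ennreal ((\<Sum>i\<in>S. X i \<omega> * (B (b i) \<omega> - B (a i) \<omega>))\<^sup>2) \<partial>M) =
    (\<integral>\<^sup>+\<omega>. (\<integral>\<^sup>+s. ennreal ((\<Sum>i\<in>S. X i \<omega> * indicat_real {a i..<b i} s)\<^sup>2) \<partial>lborel) \<partial>M)"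
proof -
  define I where "I i j = {a i..<b i} \<inter> {a j..<b j}" for i j
  let ?m = "\<lambda>i j. measure lborel (I i j)"
  let ?E = "\<Sum>i\<in>S. \<Sum>j\<in>S. expectation (\<lambda>\<omega>. X i \<omega> * X j \<omega>) * ?m i j"
  have "has_bochner_integral M (\<lambda>\<omega>. \<Sum>i\<in>S. \<Sum>j\<in>S. X i \<omega> * (B (b i) \<omega> - B (a i) \<omega>) * (X j \<omega> * (B (b j) \<omega> - B (a j) \<omega>))) ?E"
    unfolding I_def using i by (intro has_bochner_integral_sum increment_product)
  then have "has_bochner_integral M (\<lambda>\<omega>. (\<Sum>i\<in>S. X i \<omega> * (B (b i) \<omega> - B (a i) \<omega>))\<^sup>2) ?E"
    by (simp add: power2_eq_square sum_product)
  then have 1: "(\<integral>\<^sup>+\<omega>. ennreal ((\<Sum>i\<in>S. X i \<omega> * (B (b i) \<omega> - B (a i) \<omega>))\<^sup>2) \<partial>M) = ennreal ?E"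
    by (subst nn_integral_eq_integral) (auto simp: has_bochner_integral_iff)
  have inner: "has_bochner_integral lborel (\<lambda>s. (\<Sum>i\<in>S. X i \<omega> * indicat_real {a i..<b i} s)\<^sup>2)
    (\<Sum>i\<in>S. \<Sum>j\<in>S. X i \<omega> * X j \<omega> * ?m i j)" for \<omega>
  proof -
    have "has_bochner_integral lborel (\<lambda>s. indicat_real (I i j) s) (?m i j)" for i j
    proof (rule has_bochner_integral_real_indicator)
      have "emeasure lborel (I i j) \<le> emeasure lborel {a i..b i}"
        unfolding I_def by (intro emeasure_mono) auto
      then show "emeasure lborel (I i j) < \<infinity>"
        by (rule le_less_trans) (auto simp: emeasure_lborel_Icc_eq)
    qed (simp add: I_def)
    then have "has_bochner_integral lborel (\<lambda>s. \<Sum>i\<in>S. \<Sum>j\<in>S. X i \<omega> * X j \<omega> * indicat_real (I i j) s)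
      (\<Sum>i\<in>S. \<Sum>j\<in>S. X i \<omega> * X j \<omega> * ?m i j)"
      by (intro has_bochner_integral_sum has_bochner_integral_mult_right)
    moreover have "(\<Sum>i\<in>S. X i \<omega> * indicat_real {a i..<b i} s)\<^sup>2 =
      (\<Sum>i\<in>S. \<Sum>j\<in>S. X i \<omega> * X j \<omega> * indicat_real (I i j) s)" for s
      unfolding power2_eq_square sum_product I_def indicator_inter_arith by (simp only: mult_ac)
    ultimately show ?thesis by simp
  qed
  have outer: "has_bochner_integral M (\<lambda>\<omega>. \<Sum>i\<in>S. \<Sum>j\<in>S. X i \<omega> * X j \<omega> * ?m i j) ?E"
  proof (intro has_bochner_integral_sum has_bochner_integral_mult_left)
    fix i j assume ij: "i \<in> S" "j \<in> S"
    have "integrable M (\<lambda>\<omega>. X i \<omega> * X j \<omega>)"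
      using i ij by (intro simple_at_integrable_mult simple_at_integrable)
    then show "has_bochner_integral M (\<lambda>\<omega>. X i \<omega> * X j \<omega>) (expectation (\<lambda>\<omega>. X i \<omega> * X j \<omega>))"
      by (rule has_bochner_integral_integrable)
  qed
  have nonneg: "0 \<le> (\<Sum>i\<in>S. \<Sum>j\<in>S. X i \<omega> * X j \<omega> * ?m i j)" for \<omega>
    using integral_nonneg_AE[of "\<lambda>s. (\<Sum>i\<in>S. X i \<omega> * indicat_real {a i..<b i} s)\<^sup>2" lborel]
    by (simp del: sum_mult_indicator add: has_bochner_integral_integral_eq[OF inner])
  have "(\<integral>\<^sup>+s. ennreal ((\<Sum>i\<in>S. X i \<omega> * indicat_real {a i..<b i} s)\<^sup>2) \<partial>lborel) =
    ennreal (\<Sum>i\<in>S. \<Sum>j\<in>S. X i \<omega> * X j \<omega> * ?m i j)" for \<omega>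
    using inner[of \<omega>] by (subst nn_integral_eq_integral) (auto simp: has_bochner_integral_iff)
  then have "(\<integral>\<^sup>+\<omega>. (\<integral>\<^sup>+s. ennreal ((\<Sum>i\<in>S. X i \<omega> * indicat_real {a i..<b i} s)\<^sup>2) \<partial>lborel) \<partial>M) = ennreal ?E"
    using outer nonneg by (simp, subst nn_integral_eq_integral) (auto simp: has_bochner_integral_iff)
  with 1 show ?thesis by simp
qed

lemma elementary_process_nonneg:
  assumes "elementary_process M \<F> n p e" "j \<le> n"
  shows "0 \<le> p j"
  using assms(2)
proof (induction j)
  case 0 then show ?case using assms(1) by (simp add: elementary_process_def)
next
  case (Suc j)
  then have "p j \<le> p (Suc j)" using assms(1) by (simp add: elementary_process_def)
  with Suc show ?case by simp
qed

text \<open>The two elementary processes form one finite family indexed by a disjoint sum. Stopping at \<open>t\<close>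
is done by truncating all endpoints at \<open>t\<close> and dropping the coefficients of intervals that
start later, since those are not known at time \<open>t\<close>.\<close>
lemma elementary_isometry:
  assumes t: "t \<ge> 0" and e: "elementary_process M \<F> n p e" and c: "elementary_process M \<F> m q c"
  shows "(\<integral>\<^sup>+\<omega>. ennreal ((elementary_integral B n p e t \<omega> - elementary_integral B m q c t \<omega>)\<^sup>2) \<partial>M) =
    (\<integral>\<^sup>+\<omega>. (\<integral>\<^sup>+s\<in>{0..t}. ennreal ((elementary_value n p e s \<omega> - elementary_value m q c s \<omega>)\<^sup>2) \<partial>lborel) \<partial>M)"
proof -
  define S where "S = {..<n} <+> {..<m}"
  define a where "a = case_sum (\<lambda>j. min t (p j)) (\<lambda>j. min t (q j))"
  define b where "b = case_sum (\<lambda>j. min t (p (Suc j))) (\<lambda>j. min t (q (Suc j)))"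
  define X where "X = case_sum (\<lambda>j \<omega>. if p j < t then e j \<omega> else 0) (\<lambda>j \<omega>. if q j < t then - c j \<omega> else 0)"
  have neg: "bounded ((\<lambda>x. - c j x) ` space M)" if "j < m" for j
  proof -
    have "bounded (uminus ` (c j ` space M))"
      using c that by (simp add: elementary_process_def)
    then show ?thesis by (simp add: image_image)
  qed
  have S: "finite S" by (simp add: S_def)
  have ai: "0 \<le> a i" "a i \<le> b i" "simple_at (a i) (X i)" if "i \<in> S" for i
  proof -
    show "0 \<le> a i"
      using that t elementary_process_nonneg[OF e] elementary_process_nonneg[OF c] by (auto simp: a_def S_def)
    show "a i \<le> b i"
      using that e c by (auto simp: a_def b_def S_def elementary_process_def intro!: min.mono)
    show "simple_at (a i) (X i)"
      using that e c neg by (auto simp: a_def X_def S_def elementary_process_def simple_at_def min_def image_constant_conv)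
  qed
  have 1: "elementary_integral B n p e t \<omega> - elementary_integral B m q c t \<omega> =
    (\<Sum>i\<in>S. X i \<omega> * (B (b i) \<omega> - B (a i) \<omega>))" for \<omega>
  proof -
    have "(\<Sum>j<n. X (Inl j) \<omega> * (B (b (Inl j)) \<omega> - B (a (Inl j)) \<omega>)) = elementary_integral B n p e t \<omega>"
      unfolding elementary_integral_def
    proof (rule sum.cong[OF refl])
      fix j assume "j \<in> {..<n}"
      then have "p j \<le> p (Suc j)" using e by (simp add: elementary_process_def)
      then show "X (Inl j) \<omega> * (B (b (Inl j)) \<omega> - B (a (Inl j)) \<omega>) = e j \<omega> * (B (min t (p (Suc j))) \<omega> - B (min t (p j)) \<omega>)"
        by (auto simp: X_def a_def b_def min_def)
    qed
    moreover have "(\<Sum>j<m. X (Inr j) \<omega> * (B (b (Inr j)) \<omega> - B (a (Inr j)) \<omega>)) = - elementary_integral B m q c t \<omega>"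
      unfolding elementary_integral_def sum_negf[symmetric]
    proof (rule sum.cong[OF refl])
      fix j assume "j \<in> {..<m}"
      then have "q j \<le> q (Suc j)" using c by (simp add: elementary_process_def)
      then show "X (Inr j) \<omega> * (B (b (Inr j)) \<omega> - B (a (Inr j)) \<omega>) = - (c j \<omega> * (B (min t (q (Suc j))) \<omega> - B (min t (q j)) \<omega>))"
        by (auto simp: X_def a_def b_def min_def)
    qed
    ultimately show ?thesis by (simp add: S_def sum.Plus)
  qed
  have 2: "(\<integral>\<^sup>+s\<in>{0..t}. ennreal ((elementary_value n p e s \<omega> - elementary_value m q c s \<omega>)\<^sup>2) \<partial>lborel) =
    (\<integral>\<^sup>+s. ennreal ((\<Sum>i\<in>S. X i \<omega> * indicat_real {a i..<b i} s)\<^sup>2) \<partial>lborel)" for \<omega>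
  proof (rule nn_integral_cong_AE)
    have "AE s in lborel. s \<noteq> t" by (rule AE_lborel_singleton)
    then show "AE s in lborel. ennreal ((elementary_value n p e s \<omega> - elementary_value m q c s \<omega>)\<^sup>2) * indicator {0..t} s =
      ennreal ((\<Sum>i\<in>S. X i \<omega> * indicat_real {a i..<b i} s)\<^sup>2)"
    proof eventually_elim
      case (elim s)
      show ?case
      proof (cases "0 \<le> s \<and> s < t")
        case True
        have "(\<Sum>j<n. X (Inl j) \<omega> * indicat_real {a (Inl j)..<b (Inl j)} s) = elementary_value n p e s \<omega>"
          unfolding elementary_value_def using True
          by (intro sum.cong refl) (auto simp: X_def a_def b_def min_def indicator_def)
        moreover have "(\<Sum>j<m. X (Inr j) \<omega> * indicat_real {a (Inr j)..<b (Inr j)} s) = - elementary_value m q c s \<omega>"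
          unfolding elementary_value_def sum_negf[symmetric] using True
          by (intro sum.cong refl) (auto simp: X_def a_def b_def min_def indicator_def)
        ultimately have "(\<Sum>i\<in>S. X i \<omega> * indicat_real {a i..<b i} s) = elementary_value n p e s \<omega> - elementary_value m q c s \<omega>"
          unfolding S_def by (subst sum.Plus) simp_all
        then show ?thesis using True by (simp only: atLeastAtMost_iff indicator_simps less_imp_le mult_1_right simp_thms)
      next
        case False
        then have "s < 0 \<or> t < s" using elim by auto
        then have "indicat_real {a i..<b i} s = 0" if "i \<in> S" for i
          using ai(1)[OF that] that by (auto simp: S_def a_def b_def indicator_def)
        then have "(\<Sum>i\<in>S. X i \<omega> * indicat_real {a i..<b i} s) = 0"
          by (intro sum.neutral ballI) (simp only: mult_zero_right)
        moreover have "indicator {0..t} s = (0::ennreal)"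
          using \<open>s < 0 \<or> t < s\<close> by (auto simp: indicator_def)
        ultimately show ?thesis by (simp only: mult_zero_right) simp
      qed
    qed
  qed
  show ?thesis
    unfolding 1 2 by (rule simple_sum_isometry[OF S ai])
qed

end

section \<open>Ito integrals of deterministic C1 integrands\<close>

lemma ennreal_square_triangle:
  "ennreal ((x + y)\<^sup>2) \<le> 2 * ennreal (x\<^sup>2) + 2 * ennreal ((y::real)\<^sup>2)"
proof -
  have "(x + y)\<^sup>2 \<le> 2 * x\<^sup>2 + 2 * y\<^sup>2"
    using zero_le_power2[of "x - y"] by (simp add: power2_sum power2_diff)
  then have "ennreal ((x + y)\<^sup>2) \<le> ennreal (2 * x\<^sup>2 + 2 * y\<^sup>2)" by (rule ennreal_leI)
  also have "\<dots> = 2 * ennreal (x\<^sup>2) + 2 * ennreal (y\<^sup>2)"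
    by (subst ennreal_plus) (simp_all add: ennreal_mult')
  finally show ?thesis .
qed

lemma grid_indicator_sum:
  assumes t: "t \<ge> 0" and s: "0 \<le> s" "s < t"
  shows "(\<Sum>k<Suc m. indicat_real {grid t m k..<grid t m (Suc k)} s) = 1"
proof -
  have "(\<Sum>k<n. indicat_real {grid t m k..<grid t m (Suc k)} s) = indicat_real {0..<grid t m n} s" for n
  proof (induction n)
    case (Suc n)
    have "indicat_real {0..<grid t m n} s + indicat_real {grid t m n..<grid t m (Suc n)} s = indicat_real {0..<grid t m (Suc n)} s"
      using grid_mono[OF t, of n "Suc n" m] grid_bounds(1)[OF t, of m n] by (auto simp: indicator_def)
    with Suc show ?case by simp
  qed simp
  from this[of "Suc m"] show ?thesis using s by (simp only: grid_end) simp
qed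

abbreviation step_value :: "(real \<Rightarrow> real) \<Rightarrow> real \<Rightarrow> nat \<Rightarrow> real \<Rightarrow> 'b \<Rightarrow> real" where
  "step_value \<sigma> t m \<equiv> elementary_value (Suc m) (grid t m) (\<lambda>k _. \<sigma> (grid t m k))"

abbreviation square_error :: "(real \<Rightarrow> real) \<Rightarrow> real \<Rightarrow> (real \<Rightarrow> real) \<Rightarrow> ennreal" where
  "square_error \<sigma> t v \<equiv> (\<integral>\<^sup>+s\<in>{0..t}. ennreal ((\<sigma> s - v s)\<^sup>2) \<partial>lborel)"

text \<open>The grid cells partition \<open>[0, t)\<close>, so the error is a convex combination of oscillations of
\<open>\<sigma>\<close> within one cell.\<close>
lemma step_approximation_uniform:
  fixes \<sigma> :: "real \<Rightarrow> real"
  assumes t: "t \<ge> 0" and \<sigma>: "continuous_on {0..t} \<sigma>" and e: "e > 0"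
  shows "eventually (\<lambda>m. \<forall>s. 0 \<le> s \<longrightarrow> s < t \<longrightarrow>
    \<bar>step_value \<sigma> t m s \<omega> - \<sigma> s\<bar> \<le> e) sequentially"
proof -
  have "uniformly_continuous_on {0..t} \<sigma>"
    using \<sigma> by (intro compact_uniformly_continuous) auto
  then obtain \<delta> where \<delta>: "\<delta> > 0" "\<And>x y. x \<in> {0..t} \<Longrightarrow> y \<in> {0..t} \<Longrightarrow> dist y x < \<delta> \<Longrightarrow> dist (\<sigma> y) (\<sigma> x) < e"
    using e unfolding uniformly_continuous_on_def by metis
  show ?thesis
    using grid_fine[OF \<delta>(1), of t]
  proof eventually_elim
    case (elim m)
    show ?case
    proof (intro allI impI)
      fix s assume s: "0 \<le> s" "s < t"
      let ?i = "\<lambda>k. indicat_real {grid t m k..<grid t m (Suc k)} s"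
      have "step_value \<sigma> t m s \<omega> - \<sigma> s =
        (\<Sum>k<Suc m. (\<sigma> (grid t m k) - \<sigma> s) * ?i k)"
        unfolding elementary_value_def left_diff_distrib sum_subtractf sum_distrib_left[symmetric]
        by (subst grid_indicator_sum[OF t s]) simp
      also have "\<bar>\<dots>\<bar> \<le> (\<Sum>k<Suc m. e * ?i k)"
      proof (rule order_trans[OF sum_abs], rule sum_mono)
        fix k assume k: "k \<in> {..<Suc m}"
        show "\<bar>(\<sigma> (grid t m k) - \<sigma> s) * ?i k\<bar> \<le> e * ?i k"
        proof (cases "s \<in> {grid t m k..<grid t m (Suc k)}")
          case True
          then have "dist (grid t m k) s < \<delta>"
            using elim grid_step[of t m k] by (auto simp: dist_real_def)
          moreover have "grid t m k \<in> {0..t}"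
            using grid_bounds[OF t, of m k] grid_bounds(2)[OF t, of k m] k by auto
          ultimately have "dist (\<sigma> (grid t m k)) (\<sigma> s) < e"
            using s by (intro \<delta>(2)) auto
          then show ?thesis using True by (simp add: dist_real_def)
        qed simp
      qed
      also have "\<dots> = e"
        unfolding sum_distrib_left[symmetric] by (subst grid_indicator_sum[OF t s]) simp
      finally show "\<bar>step_value \<sigma> t m s \<omega> - \<sigma> s\<bar> \<le> e" .
    qed
  qed
qed

lemma step_approximation_L2:
  fixes \<sigma> :: "real \<Rightarrow> real"
  assumes t: "t \<ge> 0" and \<sigma>: "continuous_on {0..t} \<sigma>"
  shows "(\<lambda>m. square_error \<sigma> t (\<lambda>s. step_value \<sigma> t m s \<omega>)) \<longlonglongrightarrow> 0"
    (is "?R \<longlonglongrightarrow> 0")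
proof (rule tendsto_zero_ennreal)
  show "\<And>e. 0 < e \<Longrightarrow> eventually (\<lambda>m. ?R m < ennreal e) sequentially"
  proof -
    fix e :: real assume e: "e > 0"
    define q where "q = e / (t + 1)"
    define d where "d = sqrt q / 2"
    have q: "q > 0" "q * (t + 1) = e" using e t by (auto simp: q_def)
    have d: "d > 0" "4 * d\<^sup>2 = q" using q by (auto simp: d_def power_divide)
    show "eventually (\<lambda>m. ?R m < ennreal e) sequentially"
      using step_approximation_uniform[OF t \<sigma> d(1), of \<omega>]
    proof eventually_elim
      case (elim m)
      have "?R m \<le> (\<integral>\<^sup>+s. ennreal (d\<^sup>2) * indicator {0..t} s \<partial>lborel)"
      proof (rule nn_integral_mono_AE)
        have "AE s in lborel. s \<noteq> t" by (rule AE_lborel_singleton)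
        then show "AE s in lborel. ennreal ((\<sigma> s - step_value \<sigma> t m s \<omega>)\<^sup>2) * indicator {0..t} s
          \<le> ennreal (d\<^sup>2) * indicator {0..t} s"
        proof eventually_elim
          case (elim s)
          show ?case
          proof (cases "s \<in> {0..t}")
            case True
            then have "\<bar>step_value \<sigma> t m s \<omega> - \<sigma> s\<bar> \<le> \<bar>d\<bar>"
              using \<open>\<forall>s\<ge>0. s < t \<longrightarrow> _\<close> elim d(1) by auto
            then have "(step_value \<sigma> t m s \<omega> - \<sigma> s)\<^sup>2 \<le> d\<^sup>2"
              by (simp only: abs_le_square_iff)
            then show ?thesis
              by (intro mult_right_mono ennreal_leI) (simp_all add: power2_commute)
          qed simp
        qed
      qed
      also have "\<dots> = ennreal (d\<^sup>2 * t)"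
        using t by (simp add: nn_integral_cmult ennreal_mult')
      also have "\<dots> < ennreal e"
      proof (rule ennreal_lessI[OF e])
        have "d\<^sup>2 * t \<le> d\<^sup>2 * (t + 1)" by (intro mult_left_mono) auto
        also have "\<dots> < 4 * d\<^sup>2 * (t + 1)" using d(1) t by simp
        also have "\<dots> = e" unfolding d(2) by (rule q)
        finally show "d\<^sup>2 * t < e" .
      qed
      finally show ?case .
    qed
  qed
qed

context brownian_motion
begin

text \<open>The Ito integral of a smooth deterministic integrand as a limit of elementary integrals. Taking \<open>lim\<close> for
every \<open>\<omega>\<close>, also where it does not exist, keeps the integral measurable with respect to the raw filtration.\<close>
definition ito_sum :: "(real \<Rightarrow> real) \<Rightarrow> real \<Rightarrow> nat \<Rightarrow> 'a \<Rightarrow> real" where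
  "ito_sum \<sigma> t m = elementary_integral B (Suc m) (grid t m) (\<lambda>k _. \<sigma> (grid t m k)) t"

definition wiener_integral :: "(real \<Rightarrow> real) \<Rightarrow> real \<Rightarrow> 'a \<Rightarrow> real" where
  "wiener_integral \<sigma> t \<omega> = lim (\<lambda>m. ito_sum \<sigma> t m \<omega>)"

lemma ito_sum_eq:
  assumes t: "t \<ge> 0"
  shows "ito_sum \<sigma> t m \<omega> = (\<Sum>k<Suc m. \<sigma> (grid t m k) * (B (grid t m (Suc k)) \<omega> - B (grid t m k) \<omega>))"
  unfolding ito_sum_def elementary_integral_def
proof (rule sum.cong[OF refl])
  fix k assume "k \<in> {..<Suc m}"
  then have "min t (grid t m k) = grid t m k" "min t (grid t m (Suc k)) = grid t m (Suc k)"
    using grid_bounds(2)[OF t, of k m] grid_bounds(2)[OF t, of "Suc k" m] by auto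
  then show "\<sigma> (grid t m k) * (B (min t (grid t m (Suc k))) \<omega> - B (min t (grid t m k)) \<omega>) =
    \<sigma> (grid t m k) * (B (grid t m (Suc k)) \<omega> - B (grid t m k) \<omega>)" by (simp only:)
qed

lemma ito_sum_measurable:
  assumes t: "t \<ge> 0"
  shows "ito_sum \<sigma> t m \<in> borel_measurable (\<F> t)"
proof -
  have "ito_sum \<sigma> t m = (\<lambda>\<omega>. \<Sum>k<Suc m. \<sigma> (grid t m k) * (B (grid t m (Suc k)) \<omega> - B (grid t m k) \<omega>))"
    by (rule ext) (rule ito_sum_eq[OF t])
  also have "\<dots> \<in> borel_measurable (\<F> t)"
  proof (intro borel_measurable_sum borel_measurable_times borel_measurable_const increment_measurable)
    fix k assume "k \<in> {..<Suc m}"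
    then show "grid t m k \<le> t" "grid t m (Suc k) \<le> t"
      using grid_bounds(2)[OF t, of k m] grid_bounds(2)[OF t, of "Suc k" m] by auto
  qed (rule grid_bounds[OF t])+
  finally show ?thesis .
qed

lemma wiener_integral_measurable:
  assumes t: "t \<ge> 0"
  shows "wiener_integral \<sigma> t \<in> borel_measurable (\<F> t)"
  unfolding wiener_integral_def[abs_def] by (intro borel_measurable_lim_metric ito_sum_measurable t)

lemma ito_sum_tendsto_path:
  assumes t: "t \<ge> 0" and b: "continuous_on {0..t} (\<lambda>s. B s \<omega>)" and D: "continuous_on {0..t} D"
    and \<sigma>: "\<And>s. s \<in> {0..t} \<Longrightarrow> (\<sigma> has_real_derivative D s) (at s within {0..t})"
  shows "(\<lambda>m. ito_sum \<sigma> t m \<omega>) \<longlonglongrightarrow> path_integral \<sigma> D (\<lambda>s. B s \<omega>) t"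
  unfolding ito_sum_eq[OF t] by (rule path_integral_tendsto[OF t b D \<sigma>])

lemma wiener_integral_path:
  assumes t: "t \<ge> 0" and b: "continuous_on {0..t} (\<lambda>s. B s \<omega>)" and D: "continuous_on {0..t} D"
    and \<sigma>: "\<And>s. s \<in> {0..t} \<Longrightarrow> (\<sigma> has_real_derivative D s) (at s within {0..t})"
  shows "wiener_integral \<sigma> t \<omega> = path_integral \<sigma> D (\<lambda>s. B s \<omega>) t"
  unfolding wiener_integral_def by (rule limI[OF ito_sum_tendsto_path[OF t b D \<sigma>]])

lemma elementary_grid: "t \<ge> 0 \<Longrightarrow> elementary_process M \<F> (Suc m) (grid t m) (\<lambda>k _. \<sigma> (grid t m k))"
  unfolding elementary_process_def using grid_mono[of t _ _ m]
  by (auto simp: image_constant_conv)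

lemma elementary_integral_measurable:
  assumes "elementary_process M \<F> n p e" "t \<ge> 0"
  shows "elementary_integral B n p e t \<in> borel_measurable M"
proof -
  have "e j \<in> borel_measurable M" if "j < n" for j
    using assms(1) that by (intro filtration_measurable_M[of _ "p j"]) (simp add: elementary_process_def)
  then show ?thesis
    unfolding elementary_integral_def[abs_def] using elementary_process_nonneg[OF assms(1)] assms(2)
    by (intro borel_measurable_sum borel_measurable_times borel_measurable_diff random_variable) auto
qed

text \<open>The isometry applies to \<open>ito_sum \<sigma> t m\<close> in place of \<open>J\<close>; Fatou's lemma passes to the limit \<open>m \<rightarrow> \<infinity>\<close>. With the
grid processes for \<open>e\<close> this gives existence of the Ito integral, with an arbitrary approximating sequence its
uniqueness.\<close>
lemma elementary_integral_distance:
  assumes t: "t \<ge> 0" and \<sigma>: "continuous_on {0..t} \<sigma>"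
    and J: "AE \<omega> in M. (\<lambda>m. ito_sum \<sigma> t m \<omega>) \<longlonglongrightarrow> J \<omega>"
    and e: "elementary_process M \<F> n p e"
  shows "(\<integral>\<^sup>+\<omega>. ennreal ((J \<omega> - elementary_integral B n p e t \<omega>)\<^sup>2) \<partial>M) \<le>
    2 * (\<integral>\<^sup>+\<omega>. square_error \<sigma> t (\<lambda>s. elementary_value n p e s \<omega>) \<partial>M)"
proof -
  let ?E = "elementary_integral B n p e t"
  let ?v = "\<lambda>(m::nat) (s::real). step_value \<sigma> t m s (undefined :: 'a)"
  let ?A = "\<integral>\<^sup>+\<omega>. square_error \<sigma> t (\<lambda>s. elementary_value n p e s \<omega>) \<partial>M"
  let ?R = "\<lambda>m. square_error \<sigma> t (\<lambda>s. ?v m s)"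
  define \<sigma>' where "\<sigma>' s = indicat_real {0..t} s * \<sigma> s" for s
  have \<sigma>'[measurable]: "\<sigma>' \<in> borel_measurable borel"
    using borel_measurable_continuous_on_indicator[OF _ \<sigma>] by (simp add: \<sigma>'_def[abs_def])
  have \<sigma>'_eq: "\<sigma>' s = \<sigma> s" if "s \<in> {0..t}" for s using that by (simp add: \<sigma>'_def)
  have [measurable]: "e j \<in> borel_measurable M" if "j < n" for j
    using e that by (intro filtration_measurable_M[of _ "p j"]) (simp add: elementary_process_def)
  have ev[measurable]: "(\<lambda>(\<omega>, s). elementary_value n p e s \<omega>) \<in> borel_measurable (M \<Otimes>\<^sub>M lborel)"
    unfolding elementary_value_def case_prod_beta'
    by (intro borel_measurable_sum borel_measurable_times) (measurable; simp)+
  have inner: "(\<integral>\<^sup>+s\<in>{0..t}. ennreal ((elementary_value n p e s \<omega> - ?v m s)\<^sup>2) \<partial>lborel) \<le>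
      2 * square_error \<sigma> t (\<lambda>s. elementary_value n p e s \<omega>) + 2 * ?R m" for \<omega> m
  proof -
    have [measurable]: "(\<lambda>s. elementary_value n p e s \<omega>) \<in> borel_measurable borel" "?v m \<in> borel_measurable borel"
      unfolding elementary_value_def by measurable
    have "(\<integral>\<^sup>+s\<in>{0..t}. ennreal ((elementary_value n p e s \<omega> - ?v m s)\<^sup>2) \<partial>lborel) \<le>
      (\<integral>\<^sup>+s. 2 * (ennreal ((\<sigma>' s - elementary_value n p e s \<omega>)\<^sup>2) * indicator {0..t} s) +
        2 * (ennreal ((\<sigma>' s - ?v m s)\<^sup>2) * indicator {0..t} s) \<partial>lborel)"
    proof (rule nn_integral_mono)
      fix s
      show "ennreal ((elementary_value n p e s \<omega> - ?v m s)\<^sup>2) * indicator {0..t} s \<le>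
        2 * (ennreal ((\<sigma>' s - elementary_value n p e s \<omega>)\<^sup>2) * indicator {0..t} s) +
        2 * (ennreal ((\<sigma>' s - ?v m s)\<^sup>2) * indicator {0..t} s)"
        using ennreal_square_triangle[of "elementary_value n p e s \<omega> - \<sigma>' s" "\<sigma>' s - ?v m s"]
        by (auto simp: indicator_def power2_commute)
    qed
    also have "\<dots> = 2 * (\<integral>\<^sup>+s\<in>{0..t}. ennreal ((\<sigma>' s - elementary_value n p e s \<omega>)\<^sup>2) \<partial>lborel) +
        2 * (\<integral>\<^sup>+s\<in>{0..t}. ennreal ((\<sigma>' s - ?v m s)\<^sup>2) \<partial>lborel)"
      by (simp add: nn_integral_add nn_integral_cmult)
    also have "(\<integral>\<^sup>+s\<in>{0..t}. ennreal ((\<sigma>' s - elementary_value n p e s \<omega>)\<^sup>2) \<partial>lborel) =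
      square_error \<sigma> t (\<lambda>s. elementary_value n p e s \<omega>)"
      by (rule nn_integral_cong) (auto simp: indicator_def \<sigma>'_eq)
    also have "(\<integral>\<^sup>+s\<in>{0..t}. ennreal ((\<sigma>' s - ?v m s)\<^sup>2) \<partial>lborel) = ?R m"
      by (rule nn_integral_cong) (auto simp: indicator_def \<sigma>'_eq)
    finally show ?thesis .
  qed
  have A_meas: "(\<lambda>\<omega>. square_error \<sigma> t (\<lambda>s. elementary_value n p e s \<omega>)) \<in> borel_measurable M"
  proof -
    have "(\<lambda>\<omega>. \<integral>\<^sup>+s. ennreal ((\<sigma>' s - elementary_value n p e s \<omega>)\<^sup>2) * indicator {0..t} s \<partial>lborel) \<in> borel_measurable M"
      by (rule lborel.borel_measurable_nn_integral) measurable
    also have "(\<lambda>\<omega>. \<integral>\<^sup>+s. ennreal ((\<sigma>' s - elementary_value n p e s \<omega>)\<^sup>2) * indicator {0..t} s \<partial>lborel) =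
      (\<lambda>\<omega>. square_error \<sigma> t (\<lambda>s. elementary_value n p e s \<omega>))"
      by (intro ext nn_integral_cong) (auto simp: indicator_def \<sigma>'_eq)
    finally show ?thesis .
  qed
  have bound: "(\<integral>\<^sup>+\<omega>. ennreal ((?E \<omega> - ito_sum \<sigma> t m \<omega>)\<^sup>2) \<partial>M) \<le> 2 * ?A + 2 * ?R m" for m
  proof -
    have "(\<integral>\<^sup>+\<omega>. ennreal ((?E \<omega> - ito_sum \<sigma> t m \<omega>)\<^sup>2) \<partial>M) =
      (\<integral>\<^sup>+\<omega>. (\<integral>\<^sup>+s\<in>{0..t}. ennreal ((elementary_value n p e s \<omega> - ?v m s)\<^sup>2) \<partial>lborel) \<partial>M)"
      unfolding ito_sum_def elementary_isometry[OF t e elementary_grid[OF t]] elementary_value_def ..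
    also have "\<dots> \<le> (\<integral>\<^sup>+\<omega>. 2 * square_error \<sigma> t (\<lambda>s. elementary_value n p e s \<omega>) + 2 * ?R m \<partial>M)"
      by (rule nn_integral_mono[OF inner])
    also have "\<dots> = 2 * ?A + 2 * ?R m"
      using A_meas by (simp add: nn_integral_add nn_integral_cmult emeasure_space_1)
    finally show ?thesis .
  qed
  have E_meas: "?E \<in> borel_measurable M" by (rule elementary_integral_measurable[OF e t])
  have S_meas: "ito_sum \<sigma> t m \<in> borel_measurable M" for m
    by (rule filtration_measurable_M[OF ito_sum_measurable[OF t]])
  have "(\<integral>\<^sup>+\<omega>. ennreal ((J \<omega> - ?E \<omega>)\<^sup>2) \<partial>M) = (\<integral>\<^sup>+\<omega>. liminf (\<lambda>m. ennreal ((?E \<omega> - ito_sum \<sigma> t m \<omega>)\<^sup>2)) \<partial>M)"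
  proof (rule nn_integral_cong_AE)
    show "AE \<omega> in M. ennreal ((J \<omega> - ?E \<omega>)\<^sup>2) = liminf (\<lambda>m. ennreal ((?E \<omega> - ito_sum \<sigma> t m \<omega>)\<^sup>2))"
      using J
    proof eventually_elim
      case (elim \<omega>)
      then have "(\<lambda>m. ennreal ((?E \<omega> - ito_sum \<sigma> t m \<omega>)\<^sup>2)) \<longlonglongrightarrow> ennreal ((?E \<omega> - J \<omega>)\<^sup>2)"
        by (intro tendsto_ennrealI tendsto_intros)
      from lim_imp_Liminf[OF sequentially_bot this] show ?case by (simp add: power2_commute)
    qed
  qed
  also have "\<dots> \<le> liminf (\<lambda>m. \<integral>\<^sup>+\<omega>. ennreal ((?E \<omega> - ito_sum \<sigma> t m \<omega>)\<^sup>2) \<partial>M)"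
    using E_meas S_meas by (intro nn_integral_liminf) simp
  also have "\<dots> \<le> liminf (\<lambda>m. 2 * ?A + 2 * ?R m)"
    by (intro Liminf_mono always_eventually allI bound)
  also have "(\<lambda>m. 2 * ?A + 2 * ?R m) \<longlonglongrightarrow> 2 * ?A + 2 * 0"
    by (intro tendsto_add tendsto_const ennreal_tendsto_cmult step_approximation_L2[OF t \<sigma>]) simp
  then have "liminf (\<lambda>m. 2 * ?A + 2 * ?R m) = 2 * ?A"
    using lim_imp_Liminf[OF sequentially_bot] by fastforce
  finally show ?thesis .
qed

lemma has_ito_integral_exists:
  assumes t: "t \<ge> 0" and \<sigma>: "continuous_on {0..t} \<sigma>"
    and J: "AE \<omega> in M. (\<lambda>m. ito_sum \<sigma> t m \<omega>) \<longlonglongrightarrow> J \<omega>" and J_meas: "J \<in> borel_measurable M"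
  shows "has_ito_integral M \<F> B (\<lambda>s _. \<sigma> s) t J"
  unfolding has_ito_integral_def
proof (intro conjI exI allI)
  show "adapted \<F> (\<lambda>s _. \<sigma> s)" by (simp add: adapted_def)
  have "\<sigma> \<in> borel_measurable (restrict_space borel {0..t})"
    using \<sigma> by (rule borel_measurable_continuous_on_restrict)
  then show "(\<lambda>(s, \<omega>). \<sigma> s) \<in> borel_measurable (restrict_space borel {0..t} \<Otimes>\<^sub>M M)"
    unfolding case_prod_beta' by (rule measurable_compose[OF measurable_fst])
  show "J \<in> borel_measurable M" by (rule J_meas)
  show "elementary_process M \<F> (Suc m) (grid t m) (\<lambda>k _. \<sigma> (grid t m k))" for m
    by (rule elementary_grid[OF t])
  show lim: "(\<lambda>m. \<integral>\<^sup>+\<omega>. square_error \<sigma> t (\<lambda>s. step_value \<sigma> t m s \<omega>) \<partial>M) \<longlonglongrightarrow> 0"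
    unfolding elementary_value_def nn_integral_const emeasure_space_1 mult_1_right
    by (rule step_approximation_L2[OF t \<sigma>, unfolded elementary_value_def])
  show "(\<lambda>m. \<integral>\<^sup>+\<omega>. ennreal ((J \<omega> - elementary_integral B (Suc m) (grid t m) (\<lambda>k _. \<sigma> (grid t m k)) t \<omega>)\<^sup>2) \<partial>M) \<longlonglongrightarrow> 0"
  proof (rule tendsto_sandwich[OF _ _ tendsto_const])
    show "(\<lambda>m. 2 * (\<integral>\<^sup>+\<omega>. square_error \<sigma> t (\<lambda>s. step_value \<sigma> t m s \<omega>) \<partial>M)) \<longlonglongrightarrow> 0"
      using ennreal_tendsto_cmult[OF _ lim, of 2] by simp
  qed (auto intro!: always_eventually elementary_integral_distance[OF t \<sigma> J elementary_grid[OF t]])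
qed

lemma has_ito_integral_unique:
  assumes t: "t \<ge> 0" and \<sigma>: "continuous_on {0..t} \<sigma>"
    and J: "AE \<omega> in M. (\<lambda>m. ito_sum \<sigma> t m \<omega>) \<longlonglongrightarrow> J \<omega>" and J_meas: "J \<in> borel_measurable M"
    and I: "has_ito_integral M \<F> B (\<lambda>s _. \<sigma> s) t I"
  shows "AE \<omega> in M. I \<omega> = J \<omega>"
proof -
  from I obtain n p e where "\<forall>k. elementary_process M \<F> (n k) (p k) (e k)"
    and e1: "(\<lambda>k. \<integral>\<^sup>+\<omega>. square_error \<sigma> t (\<lambda>s. elementary_value (n k) (p k) (e k) s \<omega>) \<partial>M) \<longlonglongrightarrow> 0"
    and e2: "(\<lambda>k. \<integral>\<^sup>+\<omega>. ennreal ((I \<omega> - elementary_integral B (n k) (p k) (e k) t \<omega>)\<^sup>2) \<partial>M) \<longlonglongrightarrow> 0"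
    and I_meas: "I \<in> borel_measurable M"
    unfolding has_ito_integral_def by (elim conjE exE)
  then have e: "\<And>k. elementary_process M \<F> (n k) (p k) (e k)" by simp
  let ?a = "\<lambda>k. \<integral>\<^sup>+\<omega>. square_error \<sigma> t (\<lambda>s. elementary_value (n k) (p k) (e k) s \<omega>) \<partial>M"
  let ?b = "\<lambda>k. \<integral>\<^sup>+\<omega>. ennreal ((I \<omega> - elementary_integral B (n k) (p k) (e k) t \<omega>)\<^sup>2) \<partial>M"
  have "(\<integral>\<^sup>+\<omega>. ennreal ((I \<omega> - J \<omega>)\<^sup>2) \<partial>M) \<le> 2 * ?b k + 2 * (2 * ?a k)" for k
  proof -
    let ?E = "elementary_integral B (n k) (p k) (e k) t"
    have [measurable]: "?E \<in> borel_measurable M" by (rule elementary_integral_measurable[OF e t])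
    note [measurable] = I_meas J_meas
    have "(\<integral>\<^sup>+\<omega>. ennreal ((I \<omega> - J \<omega>)\<^sup>2) \<partial>M) \<le>
      (\<integral>\<^sup>+\<omega>. 2 * ennreal ((I \<omega> - ?E \<omega>)\<^sup>2) + 2 * ennreal ((J \<omega> - ?E \<omega>)\<^sup>2) \<partial>M)"
    proof (rule nn_integral_mono)
      fix \<omega>
      show "ennreal ((I \<omega> - J \<omega>)\<^sup>2) \<le> 2 * ennreal ((I \<omega> - ?E \<omega>)\<^sup>2) + 2 * ennreal ((J \<omega> - ?E \<omega>)\<^sup>2)"
        using ennreal_square_triangle[of "I \<omega> - ?E \<omega>" "?E \<omega> - J \<omega>"] by (simp add: power2_commute)
    qed
    also have "\<dots> = 2 * ?b k + 2 * (\<integral>\<^sup>+\<omega>. ennreal ((J \<omega> - ?E \<omega>)\<^sup>2) \<partial>M)"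
      by (simp add: nn_integral_add nn_integral_cmult)
    also have "\<dots> \<le> 2 * ?b k + 2 * (2 * ?a k)"
      by (intro add_left_mono mult_left_mono elementary_integral_distance[OF t \<sigma> J e]) auto
    finally show ?thesis .
  qed
  moreover have "(\<lambda>k. 2 * ?b k + 2 * (2 * ?a k)) \<longlonglongrightarrow> 2 * 0 + 2 * (2 * 0)"
    by (intro tendsto_add ennreal_tendsto_cmult e1 e2) simp_all
  ultimately have "(\<integral>\<^sup>+\<omega>. ennreal ((I \<omega> - J \<omega>)\<^sup>2) \<partial>M) \<le> 0"
    using LIMSEQ_le_const by fastforce
  then have "(\<integral>\<^sup>+\<omega>. ennreal ((I \<omega> - J \<omega>)\<^sup>2) \<partial>M) = 0" by simp
  then have "AE \<omega> in M. ennreal ((I \<omega> - J \<omega>)\<^sup>2) = 0"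
    using I_meas J_meas by (subst (asm) nn_integral_0_iff_AE) auto
  then show ?thesis by eventually_elim (simp add: ennreal_eq_0_iff)
qed

end

section \<open>Smooth bumps driven by Brownian motion\<close>

definition bump :: "real \<Rightarrow> real" where "bump x = (max 0 (1 - x\<^sup>2))\<^sup>2"
definition bump' :: "real \<Rightarrow> real" where "bump' x = - 4 * x * max 0 (1 - x\<^sup>2)"

lemma square_positive_part_deriv:
  "((\<lambda>u. (max 0 u)\<^sup>2) has_real_derivative 2 * max 0 u) (at (u :: real))"
proof (cases u "0::real" rule: linorder_cases)
  case less
  have "((\<lambda>_. 0) has_real_derivative 2 * max 0 u) (at u)" using less by (auto intro!: derivative_eq_intros)
  then show ?thesis
    by (rule has_field_derivative_transform_within_open[of _ _ _ "{..<0}"]) (use less in auto)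
next
  case greater
  have "((\<lambda>u. u\<^sup>2) has_real_derivative 2 * max 0 u) (at u)" using greater by (auto intro!: derivative_eq_intros)
  then show ?thesis
    by (rule has_field_derivative_transform_within_open[of _ _ _ "{0<..}"]) (use greater in auto)
next
  case equal
  have "((\<lambda>h::real. (max 0 h)\<^sup>2 / h) \<longlongrightarrow> 0) (at 0)"
  proof (rule Lim_null_comparison[of _ "\<lambda>h. \<bar>h\<bar>"])
    show "eventually (\<lambda>h::real. norm ((max 0 h)\<^sup>2 / h) \<le> \<bar>h\<bar>) (at 0)"
      by (intro always_eventually allI) (auto simp: max_def power2_eq_square)
    show "(abs \<longlongrightarrow> 0) (at (0::real))" by (intro tendsto_rabs_zero tendsto_ident_at)
  qed
  then show ?thesis using equal by (simp add: DERIV_def)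
qed

lemma bump_deriv: "(bump has_real_derivative bump' x) (at x)"
proof -
  have "((\<lambda>x::real. 1 - x\<^sup>2) has_real_derivative - (2 * x)) (at x)"
    by (auto intro!: derivative_eq_intros)
  from DERIV_chain2[OF square_positive_part_deriv this] show ?thesis
    by (simp add: bump_def[abs_def] bump'_def mult_ac)
qed

lemma bump_nonneg: "0 \<le> bump x" and bump_le_1: "bump x \<le> 1" and bump_0: "bump 0 = 1"
  by (auto simp: bump_def max_def intro!: power_le_one)

lemma bump_pos: "\<bar>x\<bar> < 1 \<Longrightarrow> bump x > 0"
proof -
  assume "\<bar>x\<bar> < 1"
  then have "x\<^sup>2 < 1" by (simp add: abs_square_less_1)
  then show ?thesis by (simp add: bump_def)
qed

lemma bump_outside: "\<bar>x\<bar> \<ge> 1 \<Longrightarrow> bump x = 0" "\<bar>x\<bar> \<ge> 1 \<Longrightarrow> bump' x = 0"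
proof -
  assume "\<bar>x\<bar> \<ge> 1"
  then have "x\<^sup>2 \<ge> 1" using abs_le_square_iff[of 1 x] by simp
  then show "bump x = 0" "bump' x = 0" by (simp_all add: bump_def bump'_def)
qed

lemma bump'_bound: "\<bar>bump' x\<bar> \<le> 4"
proof (cases "\<bar>x\<bar> \<ge> 1")
  case False
  have "\<bar>x\<bar> * max 0 (1 - x\<^sup>2) \<le> 1 * 1"
    using False by (intro mult_mono) auto
  then show ?thesis by (simp add: bump'_def abs_mult)
qed (simp add: bump_outside)

lemma bump_continuous: "continuous_on S bump" "continuous_on S bump'"
  unfolding bump_def[abs_def] bump'_def[abs_def] by (intro continuous_intros)+

definition atom :: "real \<Rightarrow> real \<Rightarrow> real \<Rightarrow> real \<Rightarrow> real" where
  "atom x w c t = c * bump ((t - x) / w)"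
definition atom' :: "real \<Rightarrow> real \<Rightarrow> real \<Rightarrow> real \<Rightarrow> real" where
  "atom' x w c t = c / w * bump' ((t - x) / w)"

lemma atom_deriv: "w > 0 \<Longrightarrow> (atom x w c has_real_derivative atom' x w c t) (at t)"
proof -
  assume "w > 0"
  then have "((\<lambda>t. (t - x) / w) has_real_derivative 1 / w) (at t)"
    by (auto intro!: derivative_eq_intros)
  from DERIV_cmult[OF DERIV_chain2[OF bump_deriv this], of c] show ?thesis
    by (simp add: atom_def[abs_def] atom'_def)
qed

lemma atom_continuous: "w > 0 \<Longrightarrow> continuous_on S (atom x w c)" "w > 0 \<Longrightarrow> continuous_on S (atom' x w c)"
  unfolding atom_def[abs_def] atom'_def[abs_def]
  by (intro continuous_intros continuous_on_compose2[OF bump_continuous(1)] continuous_on_compose2[OF bump_continuous(2)]; force)+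

lemma atom_outside:
  assumes "w > 0" "t \<le> x - w \<or> x + w \<le> t"
  shows "atom x w c t = 0" "atom' x w c t = 0"
proof -
  have "\<bar>(t - x) / w\<bar> \<ge> 1" using assms by (auto simp: field_simps abs_if)
  then show "atom x w c t = 0" "atom' x w c t = 0" by (simp_all add: atom_def atom'_def bump_outside)
qed

lemma atom_bounds: "c \<ge> 0 \<Longrightarrow> 0 \<le> atom x w c t" "c \<ge> 0 \<Longrightarrow> atom x w c t \<le> c"
  unfolding atom_def using bump_nonneg bump_le_1 by (auto intro: mult_left_le)

lemma atom_center: "atom x w c x = c"
  by (simp add: atom_def bump_0)

lemma atom_pos: "c > 0 \<Longrightarrow> w > 0 \<Longrightarrow> x - w < t \<Longrightarrow> t < x + w \<Longrightarrow> 0 < atom x w c t"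
  unfolding atom_def by (intro mult_pos_pos bump_pos) (auto simp: field_simps abs_less_iff)

lemma atom_energy:
  assumes "w > 0" "c \<ge> 0"
  shows "(\<integral>\<^sup>+s. ennreal ((atom x w c s)\<^sup>2) \<partial>lborel) \<le> ennreal (2 * w * c\<^sup>2)"
proof -
  have "(\<integral>\<^sup>+s. ennreal ((atom x w c s)\<^sup>2) \<partial>lborel) \<le> (\<integral>\<^sup>+s. ennreal (c\<^sup>2) * indicator {x - w..x + w} s \<partial>lborel)"
  proof (rule nn_integral_mono)
    fix s
    show "ennreal ((atom x w c s)\<^sup>2) \<le> ennreal (c\<^sup>2) * indicator {x - w..x + w} s"
    proof (cases "s \<in> {x - w..x + w}")
      case True
      have "(atom x w c s)\<^sup>2 \<le> c\<^sup>2" using atom_bounds[OF assms(2)] by (intro power_mono) auto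
      with True show ?thesis by (simp add: ennreal_leI)
    next
      case False
      then have "atom x w c s = 0" using assms by (intro atom_outside) auto
      then show ?thesis by simp
    qed
  qed
  also have "\<dots> = ennreal (2 * w * c\<^sup>2)"
    using assms by (simp add: nn_integral_cmult mult_ac flip: ennreal_mult')
  finally show ?thesis .
qed

lemma path_integral_const:
  assumes t: "t \<ge> 0" and \<sigma>: "\<And>s. (\<sigma> has_real_derivative D s) (at s)"
  shows "path_integral \<sigma> D (\<lambda>_. c) t = 0"
proof -
  have "(D has_integral (\<sigma> t - \<sigma> 0)) {0..t}"
    using t \<sigma> by (intro fundamental_theorem_of_calculus)
      (auto simp flip: has_real_derivative_iff_has_vector_derivative intro: has_field_derivative_at_within)
  then have "integral {0..t} (\<lambda>s. D s * c) = (\<sigma> t - \<sigma> 0) * c"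
    by (intro integral_unique has_integral_mult_left)
  then show ?thesis by (simp add: path_integral_def algebra_simps)
qed

lemma path_integral_shift:
  assumes t: "t \<ge> 0" and \<sigma>: "\<And>s. (\<sigma> has_real_derivative D s) (at s)"
    and D: "continuous_on {0..t} D" and b: "continuous_on {0..t} b"
  shows "path_integral \<sigma> D b t = path_integral \<sigma> D (\<lambda>s. b s - c) t"
proof -
  have "integral {0..t} (\<lambda>s. D s * (b s - c)) = integral {0..t} (\<lambda>s. D s * b s) - integral {0..t} (\<lambda>s. D s * c)"
    unfolding right_diff_distrib
    by (intro Henstock_Kurzweil_Integration.integral_diff integrable_continuous_interval continuous_intros D b)
  then have "path_integral \<sigma> D (\<lambda>s. b s - c) t = path_integral \<sigma> D b t - path_integral \<sigma> D (\<lambda>_. c) t"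
    by (simp add: path_integral_def algebra_simps)
  then show ?thesis using path_integral_const[OF t \<sigma>] by simp
qed

text \<open>Constants integrate to zero, so \<open>b\<close> may be replaced by \<open>b - b x\<close>, which is at most \<open>d\<close> on the support.
The boundary term contributes \<open>c * d\<close>; the integral contributes at most \<open>8 * c * d\<close>, because the
derivative is at most \<open>4 * c / w\<close> on a support of length \<open>2 * w\<close>. The width \<open>w\<close> cancels.\<close>
lemma path_integral_atom_bound:
  assumes w: "0 < w" "w \<le> x" and c: "c \<ge> 0" and t: "t \<ge> 0" and b: "continuous_on {0..} b"
    and osc: "\<And>s. s \<in> {x - w..x + w} \<Longrightarrow> \<bar>b s - b x\<bar> \<le> d"
  shows "\<bar>path_integral (atom x w c) (atom' x w c) b t\<bar> \<le> 9 * c * d"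
proof -
  let ?b = "\<lambda>s. b s - b x"
  let ?W = "{x - w..x + w}"
  have d: "d \<ge> 0" using osc[of x] w by auto
  have bt: "continuous_on {0..t} b" using b by (rule continuous_on_subset) auto
  have eq: "path_integral (atom x w c) (atom' x w c) b t = path_integral (atom x w c) (atom' x w c) ?b t"
    by (rule path_integral_shift[OF t atom_deriv[OF w(1)] atom_continuous(2)[OF w(1)] bt])
  have 1: "\<bar>atom x w c t * ?b t\<bar> \<le> c * d"
  proof (cases "t \<in> ?W")
    case True
    then show ?thesis unfolding abs_mult using osc[OF True] atom_bounds[OF c, of x w t] c d
      by (intro mult_mono) auto
  next
    case False
    then have "atom x w c t = 0" using w by (intro atom_outside) auto
    then show ?thesis using c d by simp
  qed
  have 2: "atom x w c 0 = 0" using w by (intro atom_outside) auto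
  define g where "g s = (if s \<in> ?W then 4 * c / w * d else 0)" for s
  have g_int: "(g has_integral (4 * c / w * d) * measure lborel ({0..t} \<inter> ?W)) {0..t}"
  proof -
    have "{0..t} \<inter> ?W = {max 0 (x - w)..min t (x + w)}" by auto
    then have "((\<lambda>s. 4 * c / w * d) has_integral (4 * c / w * d) * measure lborel ({0..t} \<inter> ?W)) ({0..t} \<inter> ?W)"
      using has_integral_const_real[of "4 * c / w * d" "max 0 (x - w)" "min t (x + w)"] by (simp add: mult.commute)
    then show ?thesis unfolding g_def has_integral_restrict_Int by (simp only: Int_commute)
  qed
  have "norm (integral {0..t} (\<lambda>s. atom' x w c s * ?b s)) \<le> integral {0..t} g"
  proof (rule integral_norm_bound_integral)
    show "(\<lambda>s. atom' x w c s * ?b s) integrable_on {0..t}"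
      by (intro integrable_continuous_interval continuous_intros atom_continuous w bt)
    show "g integrable_on {0..t}" using g_int by (rule has_integral_integrable)
    fix s assume "s \<in> {0..t}"
    show "norm (atom' x w c s * ?b s) \<le> g s"
    proof (cases "s \<in> ?W")
      case True
      have A: "\<bar>atom' x w c s\<bar> \<le> 4 * c / w"
        unfolding atom'_def abs_mult using mult_left_mono[OF bump'_bound[of "(s - x) / w"], of "c / w"] w c
        by (simp add: mult.commute)
      have "norm (atom' x w c s * ?b s) \<le> 4 * c / w * d"
        unfolding real_norm_def abs_mult using w c by (intro mult_mono A osc[OF True]) auto
      then show ?thesis using True by (simp only: g_def if_True)
    next
      case False
      then have "atom' x w c s = 0" using w by (intro atom_outside) auto
      then show ?thesis using False by (simp only: g_def if_False mult_zero_left norm_zero order_refl)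
    qed
  qed
  also have "integral {0..t} g = (4 * c / w * d) * measure lborel ({0..t} \<inter> ?W)"
    using g_int by (rule integral_unique)
  also have "\<dots> \<le> (4 * c / w * d) * (2 * w)"
  proof (rule mult_left_mono)
    have "{0..t} \<inter> ?W = {max 0 (x - w)..min t (x + w)}" by auto
    then show "measure lborel ({0..t} \<inter> ?W) \<le> 2 * w" using w by (auto simp: content_real_if)
  qed (use c d w in auto)
  also have "\<dots> = 8 * c * d" using w by simp
  finally have 3: "\<bar>integral {0..t} (\<lambda>s. atom' x w c s * ?b s)\<bar> \<le> 8 * c * d" by simp
  have "\<bar>path_integral (atom x w c) (atom' x w c) ?b t\<bar> \<le> c * d + 8 * c * d"
    using 1 3 unfolding path_integral_def 2 by linarith
  then show ?thesis by (simp add: eq)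
qed

context brownian_motion
begin

text \<open>Rational times make this a countable union of measurable sets; along a continuous path they
control all times.\<close>
definition osc_event :: "real \<Rightarrow> real \<Rightarrow> real \<Rightarrow> 'a set" where
  "osc_event x w d = (\<Union>s\<in>\<rat> \<inter> {x - w..x + w}. {\<omega> \<in> space M. d < \<bar>B s \<omega> - B x \<omega>\<bar>})"

lemma osc_event_measurable:
  assumes "0 < w" "w \<le> x"
  shows "osc_event x w d \<in> sets M"
  unfolding osc_event_def
proof (rule sets.countable_UN'')
  show "countable (\<rat> \<inter> {x - w..x + w})" using countable_rat by (rule countable_Int1)
  fix s assume "s \<in> \<rat> \<inter> {x - w..x + w}"
  then have [measurable]: "B s \<in> borel_measurable M" "B x \<in> borel_measurable M"
    using assms by (auto intro!: random_variable)
  show "{\<omega> \<in> space M. d < \<bar>B s \<omega> - B x \<omega>\<bar>} \<in> sets M" by measurable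
qed

lemma osc_event_outside:
  assumes w: "0 < w" "w \<le> x" and \<omega>: "\<omega> \<in> space M" "\<omega> \<notin> osc_event x w d"
    and b: "continuous_on {0..} (\<lambda>s. B s \<omega>)" and s: "s \<in> {x - w..x + w}"
  shows "\<bar>B s \<omega> - B x \<omega>\<bar> \<le> d"
proof (rule ccontr)
  assume "\<not> ?thesis"
  then have e: "\<bar>B s \<omega> - B x \<omega>\<bar> - d > 0" by simp
  have "s \<in> {0..}" using w s by auto
  then obtain \<delta> where \<delta>: "\<delta> > 0" "\<And>r. r \<in> {0..} \<Longrightarrow> dist r s < \<delta> \<Longrightarrow> dist (B r \<omega>) (B s \<omega>) < \<bar>B s \<omega> - B x \<omega>\<bar> - d"
    using b e unfolding continuous_on_iff by metis
  have "max (x - w) (s - \<delta>) < min (x + w) (s + \<delta>)" using w s \<delta>(1) by auto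
  then obtain r where r: "r \<in> \<rat>" "max (x - w) (s - \<delta>) < r" "r < min (x + w) (s + \<delta>)"
    using Rats_dense_in_real by blast
  then have "\<bar>B r \<omega> - B s \<omega>\<bar> < \<bar>B s \<omega> - B x \<omega>\<bar> - d"
    using \<delta>(2)[of r] w by (auto simp: dist_real_def)
  then have "d < \<bar>B r \<omega> - B x \<omega>\<bar>" by linarith
  then have "\<omega> \<in> osc_event x w d"
    unfolding osc_event_def using r \<omega>(1) by (auto intro!: bexI[of _ r])
  then show False using \<omega>(2) by simp
qed

text \<open>Continuity from above of the probability. Both choices below, of a narrow window and of a large
level, rest on this.\<close>
lemma decreasing_events_small:
  assumes A: "\<And>n. A n \<in> sets M" "\<And>n. A (Suc n) \<subseteq> A n" and null: "AE \<omega> in M. \<exists>n::nat. \<omega> \<notin> A n" and p: "p > 0"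
  shows "\<exists>n. prob (A n) < p"
proof -
  have "(\<lambda>n. prob (A n)) \<longlonglongrightarrow> prob (\<Inter>n. A n)"
    using A by (intro finite_Lim_measure_decseq decseq_SucI) auto
  also have "prob (\<Inter>n. A n) = 0"
    using A null by (subst prob_eq_0) auto
  finally show ?thesis
    using order_tendstoD(2)[of "\<lambda>n. prob (A n)" 0 sequentially p] p by (auto simp: eventually_sequentially)
qed

lemma osc_event_small_window:
  assumes x: "x \<ge> 1" and d: "d > 0" and p: "p > 0" and w0: "w0 > 0"
  shows "\<exists>w>0. w \<le> w0 \<and> w \<le> 1 \<and> prob (osc_event x w d) < p"
proof -
  define v where "v n = min 1 w0 / real (Suc n)" for n
  have v: "0 < v n" "v n \<le> 1" "v n \<le> w0" "v (Suc n) \<le> v n" for n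
  proof -
    define a where "a = min 1 w0"
    have a: "0 < a" "a \<le> 1" "a \<le> w0" using w0 by (auto simp: a_def)
    have v_eq: "v k = a / real (Suc k)" for k by (simp add: v_def a_def)
    have "a / real (Suc n) \<le> a / 1" using a by (intro divide_left_mono) auto
    moreover have "a / real (Suc (Suc n)) \<le> a / real (Suc n)" using a by (intro divide_left_mono) auto
    moreover have "0 < a / real (Suc n)" using a by (intro divide_pos_pos) auto
    ultimately show "0 < v n" "v n \<le> 1" "v n \<le> w0" "v (Suc n) \<le> v n"
      unfolding v_eq using a by linarith+
  qed
  have "\<exists>n. prob (osc_event x (v n) d) < p"
  proof (rule decreasing_events_small[OF _ _ _ p])
    show "osc_event x (v n) d \<in> sets M" for n using v[of n] x by (intro osc_event_measurable) auto
    show "osc_event x (v (Suc n)) d \<subseteq> osc_event x (v n) d" for n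
      unfolding osc_event_def using v(4)[of n] by (intro UN_mono) auto
    show "AE \<omega> in M. \<exists>n. \<omega> \<notin> osc_event x (v n) d"
      using continuous[unfolded continuous_process_def]
    proof eventually_elim
      case (elim \<omega>)
      then obtain \<delta> where \<delta>: "\<delta> > 0" "\<And>r. r \<in> {0..} \<Longrightarrow> dist r x < \<delta> \<Longrightarrow> dist (B r \<omega>) (B x \<omega>) < d"
        using d x unfolding continuous_on_iff by (metis atLeast_iff zero_le_one order_trans)
      have "v \<longlonglongrightarrow> 0" unfolding v_def by (rule LIMSEQ_Suc[OF lim_const_over_n])
      then have "eventually (\<lambda>n. v n < \<delta>) sequentially" using \<delta>(1) by (rule order_tendstoD)
      then obtain n where n: "v n < \<delta>" by (auto simp: eventually_sequentially)
      have "\<omega> \<notin> osc_event x (v n) d"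
      proof
        assume "\<omega> \<in> osc_event x (v n) d"
        then obtain s where "s \<in> {x - v n..x + v n}" "d < \<bar>B s \<omega> - B x \<omega>\<bar>" by (auto simp: osc_event_def)
        moreover from this have "\<bar>s - x\<bar> < \<delta>" using n by auto
        ultimately show False using \<delta>(2)[of s] x v(2)[of n] by (auto simp: dist_real_def)
      qed
      then show ?case ..
    qed
  qed
  then show ?thesis using v by blast
qed

lemma osc_event_large_level:
  assumes x: "x \<ge> 1" and p: "p > 0"
  shows "\<exists>K>0. prob (osc_event x 1 K) < p"
proof -
  have "\<exists>n. prob (osc_event x 1 (real (Suc n))) < p"
  proof (rule decreasing_events_small[OF _ _ _ p])
    show "osc_event x 1 (real (Suc n)) \<in> sets M" for n using x by (intro osc_event_measurable) auto
    show "osc_event x 1 (real (Suc (Suc n))) \<subseteq> osc_event x 1 (real (Suc n))" for n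
      unfolding osc_event_def by (intro UN_mono) auto
    show "AE \<omega> in M. \<exists>n. \<omega> \<notin> osc_event x 1 (real (Suc n))"
      using continuous[unfolded continuous_process_def]
    proof eventually_elim
      case (elim \<omega>)
      have "continuous_on {x - 1..x + 1} (\<lambda>s. B s \<omega> - B x \<omega>)"
        using x by (intro continuous_intros continuous_on_subset[OF elim]) auto
      then have "bounded ((\<lambda>s. B s \<omega> - B x \<omega>) ` {x - 1..x + 1})"
        by (intro compact_imp_bounded compact_continuous_image) auto
      then obtain C where C: "\<And>s. s \<in> {x - 1..x + 1} \<Longrightarrow> \<bar>B s \<omega> - B x \<omega>\<bar> \<le> C"
        unfolding bounded_iff real_norm_def by (metis imageI)
      obtain n where n: "C \<le> real n" using real_arch_simple by blast
      have "\<omega> \<notin> osc_event x 1 (real (Suc n))"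
      proof
        assume "\<omega> \<in> osc_event x 1 (real (Suc n))"
        then obtain s where "s \<in> {x - 1..x + 1}" "real (Suc n) < \<bar>B s \<omega> - B x \<omega>\<bar>" by (auto simp: osc_event_def)
        then show False using C[of s] n by auto
      qed
      then show ?case ..
    qed
  qed
  then obtain n where "prob (osc_event x 1 (real (Suc n))) < p" ..
  then show ?thesis by (intro exI[of _ "real (Suc n)"]) auto
qed

lemma path_integral_add:
  assumes t: "t \<ge> 0" and D: "continuous_on {0..t} D1" "continuous_on {0..t} D2" and b: "continuous_on {0..t} b"
  shows "path_integral (\<lambda>s. \<sigma>1 s + \<sigma>2 s) (\<lambda>s. D1 s + D2 s) b t = path_integral \<sigma>1 D1 b t + path_integral \<sigma>2 D2 b t"
proof -
  have "integral {0..t} (\<lambda>s. (D1 s + D2 s) * b s) = integral {0..t} (\<lambda>s. D1 s * b s) + integral {0..t} (\<lambda>s. D2 s * b s)"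
    unfolding distrib_right
    by (intro Henstock_Kurzweil_Integration.integral_add integrable_continuous_interval continuous_intros D b)
  then show ?thesis by (simp add: path_integral_def algebra_simps)
qed

end

text \<open>The \<open>k\<close>-th summand of the noise intensity, centred at \<open>k + 1\<close> and supported in \<open>[k, k + 2]\<close>. Its peak reaches
\<open>sqrt (\<Gamma> (k + 1))\<close>, but it is low at distance at least \<open>1 / 2\<close> from the centre, so that spikes of consecutive
summands do not add up. Its energy, and outside an unlikely event its stochastic
integral, are at most \<open>\<epsilon>\<close>.\<close>
locale noise_piece = brownian_motion +
  fixes \<Gamma> :: "real \<Rightarrow> real" and k :: nat and \<epsilon> :: real and a a' :: "real \<Rightarrow> real"
  assumes deriv: "(a has_real_derivative a' t) (at t)" and deriv_continuous: "continuous_on UNIV a'"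
    and nonneg: "0 \<le> a t" and positive: "real k < t \<Longrightarrow> t < real k + 2 \<Longrightarrow> 0 < a t"
    and outside: "t \<le> real k \<or> real k + 2 \<le> t \<Longrightarrow> a t = 0" "t \<le> real k \<or> real k + 2 \<le> t \<Longrightarrow> a' t = 0"
    and energy: "(\<integral>\<^sup>+s. ennreal ((a s)\<^sup>2) \<partial>lborel) \<le> ennreal \<epsilon>"
    and peak: "sqrt (\<Gamma> (real k + 1)) \<le> a (real k + 1)"
    and upper: "t \<ge> 0 \<Longrightarrow> a t \<le> (1 + 1 / (real k + 1)) * sqrt (\<Gamma> t) + 1 / (real k + 1)"
    and away: "1 / 2 \<le> \<bar>t - (real k + 1)\<bar> \<Longrightarrow> a t \<le> 1 / (real k + 1)"
    and unlikely: "\<exists>E\<in>sets M. prob E \<le> (1 / 2) ^ k \<and>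
      (\<forall>\<omega>\<in>space M - E. continuous_on {0..} (\<lambda>s. B s \<omega>) \<longrightarrow>
        (\<forall>t\<ge>0. \<bar>path_integral a a' (\<lambda>s. B s \<omega>) t\<bar> \<le> \<epsilon>))"

context brownian_motion
begin

text \<open>First choose a level \<open>K\<close> that the oscillation on the whole support rarely exceeds, then the height \<open>c\<close> of the wide
bump in terms of \<open>K\<close>. The height \<open>G\<close> of the spike is prescribed; its width \<open>w\<close> is chosen so that the
oscillation on it rarely exceeds \<open>\<epsilon> / (18 * G)\<close>. Each of the two bumps then contributes at most \<open>\<epsilon> / 2\<close>, by the factor
9 in the bound for a single bump.\<close>
lemma noise_piece_exists:
  assumes \<Gamma>: "continuous_on {0..} \<Gamma>" "\<And>t. t \<ge> 0 \<Longrightarrow> \<Gamma> t > 0" and \<epsilon>: "\<epsilon> > 0"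
  shows "\<exists>a a'. noise_piece M B \<Gamma> k \<epsilon> a a'"
proof -
  define x where "x = real k + 1"
  have x: "x \<ge> 1" "real k = x - 1" by (auto simp: x_def)
  define G where "G = sqrt (\<Gamma> x)"
  have G: "G > 0" using \<Gamma>(2)[of x] x by (simp add: G_def)
  define p where "p = (1 / 2 :: real) ^ k / 2"
  have p: "p > 0" by (simp add: p_def)
  obtain K where K: "K > 0" "prob (osc_event x 1 K) < p"
    using osc_event_large_level[OF x(1) p] by blast
  define c where "c = Min {1 / x, \<epsilon> / (18 * K), 1, \<epsilon> / 8}"
  have c: "c > 0" "c \<le> 1 / x" "c \<le> \<epsilon> / (18 * K)" "c \<le> 1" "c \<le> \<epsilon> / 8"
    using x \<epsilon> K by (auto simp: c_def)
  have "continuous_on {0..} (\<lambda>t. (1 + 1 / x) * sqrt (\<Gamma> t))"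
    by (intro continuous_intros \<Gamma>(1))
  moreover have "x \<in> {0..}" "G / x > 0" using x G by auto
  ultimately obtain \<delta> where \<delta>: "\<delta> > 0" "\<And>t. t \<in> {0..} \<Longrightarrow> dist t x < \<delta> \<Longrightarrow>
      dist ((1 + 1 / x) * sqrt (\<Gamma> t)) ((1 + 1 / x) * sqrt (\<Gamma> x)) < G / x"
    unfolding continuous_on_iff by metis
  have near: "G \<le> (1 + 1 / x) * sqrt (\<Gamma> t)" if "t \<ge> 0" "\<bar>t - x\<bar> < \<delta>" for t
  proof -
    have "(1 + 1 / x) * G - (1 + 1 / x) * sqrt (\<Gamma> t) < G / x"
      using \<delta>(2)[of t] that by (auto simp: dist_real_def G_def)
    then show ?thesis by (simp add: algebra_simps)
  qed
  define w0 where "w0 = Min {1 / 2, \<delta> / 2, \<epsilon> / (8 * G\<^sup>2)}"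
  have w0: "w0 > 0" "w0 \<le> 1 / 2" "w0 \<le> \<delta> / 2" "w0 \<le> \<epsilon> / (8 * G\<^sup>2)"
    using \<delta>(1) \<epsilon> G by (auto simp: w0_def)
  have "\<epsilon> / (18 * G) > 0" using \<epsilon> G by simp
  from osc_event_small_window[OF x(1) this p w0(1)]
  obtain w where w: "w > 0" "w \<le> w0" "w \<le> 1" "prob (osc_event x w (\<epsilon> / (18 * G))) < p" by blast
  define a where "a t = atom x 1 c t + atom x w G t" for t
  define a' where "a' t = atom' x 1 c t + atom' x w G t" for t
  have "noise_piece M B \<Gamma> k \<epsilon> a a'"
  proof unfold_locales
    fix t
    show "(a has_real_derivative a' t) (at t)"
      unfolding a_def[abs_def] a'_def by (intro DERIV_add atom_deriv w zero_less_one)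
    show "0 \<le> a t"
      unfolding a_def using c G by (intro add_nonneg_nonneg atom_bounds) auto
    show "0 < a t" if "real k < t" "t < real k + 2"
      unfolding a_def using c G that x by (intro add_pos_nonneg atom_bounds atom_pos) auto
    show "a t = 0" "a' t = 0" if "t \<le> real k \<or> real k + 2 \<le> t"
      using atom_outside[of 1 t x c] atom_outside[of w t x G] that x w by (auto simp: a_def a'_def)
  next
    show "continuous_on UNIV a'"
      unfolding a'_def[abs_def] by (intro continuous_intros atom_continuous w zero_less_one)
    show "sqrt (\<Gamma> (real k + 1)) \<le> a (real k + 1)"
      using c by (simp add: a_def x_def[symmetric] atom_center G_def)
  next
    have [measurable]: "atom x 1 c \<in> borel_measurable borel" "atom x w G \<in> borel_measurable borel"
      using w by (auto intro!: borel_measurable_continuous_onI atom_continuous)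
    have "(\<integral>\<^sup>+s. ennreal ((a s)\<^sup>2) \<partial>lborel) \<le>
      (\<integral>\<^sup>+s. ennreal (2 * (atom x 1 c s)\<^sup>2) + ennreal (2 * (atom x w G s)\<^sup>2) \<partial>lborel)"
    proof (rule nn_integral_mono)
      fix s
      have "(a s)\<^sup>2 \<le> 2 * (atom x 1 c s)\<^sup>2 + 2 * (atom x w G s)\<^sup>2"
        using zero_le_power2[of "atom x 1 c s - atom x w G s"] by (simp add: a_def power2_sum power2_diff)
      then have "ennreal ((a s)\<^sup>2) \<le> ennreal (2 * (atom x 1 c s)\<^sup>2 + 2 * (atom x w G s)\<^sup>2)" by (rule ennreal_leI)
      then show "ennreal ((a s)\<^sup>2) \<le> ennreal (2 * (atom x 1 c s)\<^sup>2) + ennreal (2 * (atom x w G s)\<^sup>2)"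
        by (subst (asm) ennreal_plus) auto
    qed
    also have "\<dots> = 2 * (\<integral>\<^sup>+s. ennreal ((atom x 1 c s)\<^sup>2) \<partial>lborel) + 2 * (\<integral>\<^sup>+s. ennreal ((atom x w G s)\<^sup>2) \<partial>lborel)"
      by (simp add: nn_integral_add nn_integral_cmult ennreal_mult')
    also have "\<dots> \<le> 2 * ennreal (2 * 1 * c\<^sup>2) + 2 * ennreal (2 * w * G\<^sup>2)"
      using c G w by (intro add_mono mult_left_mono atom_energy) auto
    also have "\<dots> = ennreal (4 * c\<^sup>2 + 4 * w * G\<^sup>2)"
    proof -
      have "2 * ennreal y = ennreal (2 * y)" for y using ennreal_mult'[of 2 y] by simp
      then show ?thesis using w by (simp add: mult.assoc flip: ennreal_plus)
    qed
    also have "\<dots> \<le> ennreal \<epsilon>"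
    proof (rule ennreal_leI)
      have "c\<^sup>2 \<le> 1 * (\<epsilon> / 8)" unfolding power2_eq_square using c by (intro mult_mono) auto
      moreover have "w * G\<^sup>2 \<le> \<epsilon> / (8 * G\<^sup>2) * G\<^sup>2"
        using w w0 by (intro mult_right_mono) auto
      then have "w * G\<^sup>2 \<le> \<epsilon> / 8" using G by simp
      ultimately show "4 * c\<^sup>2 + 4 * w * G\<^sup>2 \<le> \<epsilon>" by linarith
    qed
    finally show "(\<integral>\<^sup>+s. ennreal ((a s)\<^sup>2) \<partial>lborel) \<le> ennreal \<epsilon>" .
  next
    fix t :: real assume t: "t \<ge> 0"
    have "atom x 1 c t \<le> 1 / x" using atom_bounds(2)[of c x 1 t] c by linarith
    moreover have "atom x w G t \<le> (1 + 1 / x) * sqrt (\<Gamma> t)"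
    proof (cases "\<bar>t - x\<bar> < w")
      case True
      then have "\<bar>t - x\<bar> < \<delta>" using w w0 \<delta>(1) by linarith
      then show ?thesis using near[OF t] atom_bounds(2)[of G x w t] G by linarith
    next
      case False
      then have "atom x w G t = 0" using w by (intro atom_outside) auto
      then show ?thesis using \<Gamma>(2)[OF t] x by simp
    qed
    ultimately show "a t \<le> (1 + 1 / (real k + 1)) * sqrt (\<Gamma> t) + 1 / (real k + 1)"
      by (simp add: a_def x_def)
  next
    fix t assume t: "1 / 2 \<le> \<bar>t - (real k + 1)\<bar>"
    have "atom x w G t = 0" using w w0 t by (intro atom_outside) (auto simp: x_def abs_if split: if_splits)
    moreover have "atom x 1 c t \<le> 1 / x" using atom_bounds(2)[of c x 1 t] c by linarith
    ultimately show "a t \<le> 1 / (real k + 1)" by (simp add: a_def x_def)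
  next
    let ?E1 = "osc_event x 1 K" and ?E2 = "osc_event x w (\<epsilon> / (18 * G))"
    have sets: "?E1 \<in> sets M" "?E2 \<in> sets M" using w x by (auto intro!: osc_event_measurable)
    show "\<exists>E\<in>sets M. prob E \<le> (1 / 2) ^ k \<and> (\<forall>\<omega>\<in>space M - E. continuous_on {0..} (\<lambda>s. B s \<omega>) \<longrightarrow>
        (\<forall>t\<ge>0. \<bar>path_integral a a' (\<lambda>s. B s \<omega>) t\<bar> \<le> \<epsilon>))"
    proof (intro bexI[of _ "?E1 \<union> ?E2"] conjI ballI impI allI)
      have "prob (?E1 \<union> ?E2) \<le> prob ?E1 + prob ?E2"
        using sets by (intro measure_Un_le)
      also have "\<dots> \<le> (1 / 2) ^ k" using K w by (simp add: p_def)
      finally show "prob (?E1 \<union> ?E2) \<le> (1 / 2) ^ k" .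
      show "?E1 \<union> ?E2 \<in> sets M" using sets by blast
    next
      fix \<omega> t assume \<omega>: "\<omega> \<in> space M - (?E1 \<union> ?E2)" and b: "continuous_on {0..} (\<lambda>s. B s \<omega>)" and t: "(0::real) \<le> t"
      have 1: "\<bar>path_integral (atom x 1 c) (atom' x 1 c) (\<lambda>s. B s \<omega>) t\<bar> \<le> 9 * c * K"
        using \<omega> c x by (intro path_integral_atom_bound b t osc_event_outside) auto
      have 2: "\<bar>path_integral (atom x w G) (atom' x w G) (\<lambda>s. B s \<omega>) t\<bar> \<le> 9 * G * (\<epsilon> / (18 * G))"
        using \<omega> G w x by (intro path_integral_atom_bound b t osc_event_outside) auto
      have "path_integral a a' (\<lambda>s. B s \<omega>) t = path_integral (atom x 1 c) (atom' x 1 c) (\<lambda>s. B s \<omega>) t +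
        path_integral (atom x w G) (atom' x w G) (\<lambda>s. B s \<omega>) t"
        unfolding a_def[abs_def] a'_def[abs_def]
        using w by (intro path_integral_add t atom_continuous continuous_on_subset[OF b]) auto
      moreover have "9 * c * K \<le> \<epsilon> / 2" using c(3) K by (simp add: field_simps)
      moreover have "9 * G * (\<epsilon> / (18 * G)) = \<epsilon> / 2" using G by simp
      ultimately show "\<bar>path_integral a a' (\<lambda>s. B s \<omega>) t\<bar> \<le> \<epsilon>" using 1 2 by linarith
    qed
  qed
  then show ?thesis by blast
qed

end

section \<open>Superposition of bumps\<close>

text \<open>At most two summands are nonzero at any time, so the series are locally finite sums.\<close>
locale piece_sum =
  fixes a a' :: "nat \<Rightarrow> real \<Rightarrow> real"
  assumes deriv: "\<And>k t. (a k has_real_derivative a' k t) (at t)"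
    and cont: "\<And>k. continuous_on UNIV (a' k)"
    and nonneg: "\<And>k t. 0 \<le> a k t"
    and positive: "\<And>k t. real k < t \<Longrightarrow> t < real k + 2 \<Longrightarrow> 0 < a k t"
    and outside: "\<And>k t. t \<le> real k \<or> real k + 2 \<le> t \<Longrightarrow> a k t = 0"
      "\<And>k t. t \<le> real k \<or> real k + 2 \<le> t \<Longrightarrow> a' k t = 0"
begin

definition \<sigma> :: "real \<Rightarrow> real" where "\<sigma> t = (\<Sum>k. a k t)"
definition \<sigma>' :: "real \<Rightarrow> real" where "\<sigma>' t = (\<Sum>k. a' k t)"

lemma \<sigma>_finite: "t \<le> real N \<Longrightarrow> \<sigma> t = (\<Sum>k<N. a k t)"
  unfolding \<sigma>_def by (rule suminf_finite) (auto intro!: outside)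

lemma \<sigma>'_finite: "t \<le> real N \<Longrightarrow> \<sigma>' t = (\<Sum>k<N. a' k t)"
  unfolding \<sigma>'_def by (rule suminf_finite) (auto intro!: outside)

lemma \<sigma>_deriv: "(\<sigma> has_real_derivative \<sigma>' t) (at t)"
proof -
  obtain N where N: "t < real N" using reals_Archimedean2 by blast
  have "((\<lambda>t. \<Sum>k<N. a k t) has_real_derivative \<sigma>' t) (at t)"
    unfolding \<sigma>'_finite[OF less_imp_le[OF N]] by (intro DERIV_sum deriv)
  then show ?thesis
    by (rule has_field_derivative_transform_within_open[of _ _ _ "{..<real N}"]) (use N in \<open>auto simp: \<sigma>_finite[of _ N] less_imp_le\<close>)
qed

lemma \<sigma>'_continuous: "continuous_on S \<sigma>'"
proof -
  have "isCont \<sigma>' t" for t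
  proof -
    obtain N where N: "t < real N" using reals_Archimedean2 by blast
    have "continuous_on {..<real N} (\<lambda>t. \<Sum>k<N. a' k t)"
      by (intro continuous_on_sum continuous_on_subset[OF cont]) auto
    then have "continuous_on {..<real N} \<sigma>'"
      by (rule continuous_on_eq) (auto simp: \<sigma>'_finite[of _ N] less_imp_le)
    then show ?thesis using N by (simp add: continuous_on_eq_continuous_at)
  qed
  then show ?thesis by (simp add: continuous_at_imp_continuous_on)
qed

lemma \<sigma>_continuous: "continuous_on S \<sigma>"
  by (intro continuous_at_imp_continuous_on ballI DERIV_isCont[OF \<sigma>_deriv])

lemma a_continuous: "continuous_on S (a k)"
  by (intro continuous_at_imp_continuous_on ballI DERIV_isCont[OF deriv])

lemma \<sigma>_pos:
  assumes "t > 0"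
  shows "\<sigma> t > 0"
proof -
  define n where "n = nat \<lceil>t\<rceil> - 1"
  have n: "real n < t" "t \<le> real (Suc n)"
    using assms by (auto simp: n_def of_nat_diff) linarith+
  have "(\<Sum>k<Suc n. a k t) > 0"
    by (rule sum_pos2[of _ n]) (use n in \<open>auto intro!: positive nonneg\<close>)
  then show ?thesis using \<sigma>_finite[OF n(2)] by simp
qed

lemma \<sigma>_two:
  assumes "real n + 1 \<le> s" "s \<le> real n + 2"
  shows "\<sigma> s = a n s + a (Suc n) s"
proof -
  have "\<sigma> s = (\<Sum>k<Suc (Suc n). a k s)" by (rule \<sigma>_finite) (use assms in auto)
  moreover have "(\<Sum>k<n. a k s) = 0"
    by (rule sum.neutral) (use assms in \<open>auto intro!: outside\<close>)
  ultimately show ?thesis by simp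
qed

lemma \<sigma>_square_le: "ennreal ((\<sigma> s)\<^sup>2) \<le> (\<Sum>k. ennreal (2 * (a k s)\<^sup>2))"
proof (cases "s \<le> 1")
  case True
  then have "\<sigma> s = a 0 s" using \<sigma>_finite[of s 1] by simp
  then have "ennreal ((\<sigma> s)\<^sup>2) \<le> (\<Sum>k<1. ennreal (2 * (a k s)\<^sup>2))" by (simp add: ennreal_leI)
  also have "\<dots> \<le> (\<Sum>k. ennreal (2 * (a k s)\<^sup>2))" by (rule sum_le_suminf) auto
  finally show ?thesis .
next
  case False
  define n where "n = nat \<lceil>s\<rceil> - 2"
  have n: "real n + 1 \<le> s" "s \<le> real n + 2"
    using False by (auto simp: n_def of_nat_diff) linarith+
  have "(\<sigma> s)\<^sup>2 \<le> 2 * (a n s)\<^sup>2 + 2 * (a (Suc n) s)\<^sup>2"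
    unfolding \<sigma>_two[OF n] using zero_le_power2[of "a n s - a (Suc n) s"] by (simp add: power2_sum power2_diff)
  then have "ennreal ((\<sigma> s)\<^sup>2) \<le> ennreal (2 * (a n s)\<^sup>2 + 2 * (a (Suc n) s)\<^sup>2)" by (rule ennreal_leI)
  also have "\<dots> = (\<Sum>k\<in>{n, Suc n}. ennreal (2 * (a k s)\<^sup>2))"
    by (subst ennreal_plus) auto
  also have "\<dots> \<le> (\<Sum>k. ennreal (2 * (a k s)\<^sup>2))" by (rule sum_le_suminf) auto
  finally show ?thesis .
qed

text \<open>Only summands with \<open>k + 2 > t\<close> are nonzero on \<open>[t, \<infinity>)\<close>, and for them \<open>\<epsilon> (k + 2) \<le> \<epsilon> t\<close>. The factor 2 from squaring a
sum of two terms turns the weights \<open>2 ^ (- (k + 2))\<close> into the series \<open>2 ^ (- (k + 1))\<close>, whose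
sum is 1.\<close>
lemma energy_bound:
  assumes \<epsilon>: "\<And>t. t \<ge> 0 \<Longrightarrow> \<epsilon> t > 0" "\<And>s t. 0 \<le> s \<Longrightarrow> s \<le> t \<Longrightarrow> \<epsilon> t \<le> \<epsilon> s"
    and E: "\<And>k. (\<integral>\<^sup>+s. ennreal ((a k s)\<^sup>2) \<partial>lborel) \<le> ennreal (\<epsilon> (real k + 2) * (1 / 2) ^ (k + 2))"
    and t: "t \<ge> 0"
  shows "set_integrable lborel {t..} (\<lambda>s. (\<sigma> s)\<^sup>2)" "tail_energy \<sigma> t \<le> \<epsilon> t"
proof -
  have [measurable]: "a k \<in> borel_measurable borel" for k by (rule borel_measurable_continuous_onI[OF a_continuous])
  have [measurable]: "\<sigma> \<in> borel_measurable borel" by (rule borel_measurable_continuous_onI[OF \<sigma>_continuous])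
  have "(\<integral>\<^sup>+s. ennreal (indicator {t..} s * (\<sigma> s)\<^sup>2) \<partial>lborel) \<le>
    (\<integral>\<^sup>+s. (\<Sum>k. ennreal (2 * (a k s)\<^sup>2) * indicator {t..} s) \<partial>lborel)"
  proof (rule nn_integral_mono)
    fix s
    show "ennreal (indicator {t..} s * (\<sigma> s)\<^sup>2) \<le> (\<Sum>k. ennreal (2 * (a k s)\<^sup>2) * indicator {t..} s)"
      using \<sigma>_square_le[of s] by (cases "t \<le> s") simp_all
  qed
  also have "\<dots> = (\<Sum>k. \<integral>\<^sup>+s. ennreal (2 * (a k s)\<^sup>2) * indicator {t..} s \<partial>lborel)"
    by (rule nn_integral_suminf) measurable
  also have "\<dots> \<le> (\<Sum>k. ennreal (\<epsilon> t * (1 / 2) ^ Suc k))"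
  proof (rule suminf_le[OF _ summableI summableI])
    fix k
    show "(\<integral>\<^sup>+s. ennreal (2 * (a k s)\<^sup>2) * indicator {t..} s \<partial>lborel) \<le> ennreal (\<epsilon> t * (1 / 2) ^ Suc k)"
    proof (cases "real k + 2 \<le> t")
      case True
      then have "ennreal (2 * (a k s)\<^sup>2) * indicator {t..} s = 0" for s
        using outside(1)[of s k] by (cases "t \<le> s") auto
      then show ?thesis by (simp only: nn_integral_const mult_zero_left zero_le)
    next
      case False
      have "(\<integral>\<^sup>+s. ennreal (2 * (a k s)\<^sup>2) * indicator {t..} s \<partial>lborel) \<le> (\<integral>\<^sup>+s. 2 * ennreal ((a k s)\<^sup>2) \<partial>lborel)"
        by (rule nn_integral_mono) (auto simp: indicator_def ennreal_mult')
      also have "\<dots> = 2 * (\<integral>\<^sup>+s. ennreal ((a k s)\<^sup>2) \<partial>lborel)" by (rule nn_integral_cmult) measurable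
      also have "\<dots> \<le> 2 * ennreal (\<epsilon> (real k + 2) * (1 / 2) ^ (k + 2))" by (intro mult_left_mono E) auto
      also have "\<dots> = ennreal (\<epsilon> (real k + 2) * (1 / 2) ^ Suc k)"
        using ennreal_mult'[of 2 "\<epsilon> (real k + 2) * (1 / 2) ^ (k + 2)"] by (simp add: mult_ac)
      also have "\<dots> \<le> ennreal (\<epsilon> t * (1 / 2) ^ Suc k)"
        using False t by (intro ennreal_leI mult_right_mono \<epsilon>(2)) auto
      finally show ?thesis .
    qed
  qed
  also have "\<dots> = ennreal (\<epsilon> t)"
  proof -
    have "(\<lambda>k. \<epsilon> t * (1 / 2) ^ Suc k) sums (\<epsilon> t * 1)"
      by (rule sums_mult) (use power_half_series in simp)
    then show ?thesis using \<epsilon>(1)[OF t] by (subst suminf_ennreal2) (auto simp: sums_iff)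
  qed
  finally have bound: "(\<integral>\<^sup>+s. ennreal (indicator {t..} s * (\<sigma> s)\<^sup>2) \<partial>lborel) \<le> ennreal (\<epsilon> t)" .
  have meas: "(\<lambda>s. indicator {t..} s * (\<sigma> s)\<^sup>2) \<in> borel_measurable lborel" by measurable
  have int: "integrable lborel (\<lambda>s. indicator {t..} s * (\<sigma> s)\<^sup>2)"
    by (rule integrableI_nonneg[OF meas]) (use bound in \<open>auto intro: le_less_trans\<close>)
  then show "set_integrable lborel {t..} (\<lambda>s. (\<sigma> s)\<^sup>2)" by (simp add: set_integrable_def)
  have "ennreal (tail_energy \<sigma> t) = (\<integral>\<^sup>+s. ennreal (indicator {t..} s * (\<sigma> s)\<^sup>2) \<partial>lborel)"
    unfolding tail_energy_def set_lebesgue_integral_def real_scaleR_def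
    by (rule nn_integral_eq_integral[OF int, symmetric]) auto
  with bound have "ennreal (tail_energy \<sigma> t) \<le> ennreal (\<epsilon> t)" by simp
  then show "tail_energy \<sigma> t \<le> \<epsilon> t"
    using \<epsilon>(1)[OF t] by (subst (asm) ennreal_le_iff) auto
qed

lemma path_integral_\<sigma>:
  assumes t: "0 \<le> t" "t \<le> real N" and b: "continuous_on {0..t} b"
  shows "path_integral \<sigma> \<sigma>' b t = (\<Sum>k<N. path_integral (a k) (a' k) b t)"
proof -
  have "integral {0..t} (\<lambda>s. \<sigma>' s * b s) = integral {0..t} (\<lambda>s. \<Sum>k<N. a' k s * b s)"
    by (rule Henstock_Kurzweil_Integration.integral_cong) (use t in \<open>auto simp: \<sigma>'_finite[of _ N] sum_distrib_right\<close>)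
  also have "\<dots> = (\<Sum>k<N. integral {0..t} (\<lambda>s. a' k s * b s))"
    by (rule Henstock_Kurzweil_Integration.integral_sum)
      (auto intro!: integrable_continuous_interval continuous_intros b continuous_on_subset[OF cont])
  finally show ?thesis
    unfolding path_integral_def using t
    by (simp add: \<sigma>_finite[of t N] \<sigma>_finite[of 0 N] sum_subtractf sum_distrib_right)
qed

lemma path_integral_piece_early: "t \<le> real k \<Longrightarrow> path_integral (a k) (a' k) b t = 0"
proof -
  assume t: "t \<le> real k"
  have "integral {0..t} (\<lambda>s. a' k s * b s) = integral {0..t} (\<lambda>s. 0)"
    by (rule Henstock_Kurzweil_Integration.integral_cong) (use t in \<open>auto simp: outside\<close>)
  then show ?thesis using t by (simp add: path_integral_def outside)
qed

lemma path_integral_piece_late: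
  assumes t: "real k + 2 \<le> t" and b: "continuous_on {0..} b"
  shows "path_integral (a k) (a' k) b t = path_integral (a k) (a' k) b (real k + 2)"
proof -
  have "integral {0..real k + 2} (\<lambda>s. a' k s * b s) + integral {real k + 2..t} (\<lambda>s. a' k s * b s) =
    integral {0..t} (\<lambda>s. a' k s * b s)"
    using t by (intro Henstock_Kurzweil_Integration.integral_combine integrable_continuous_interval continuous_intros
        continuous_on_subset[OF cont] continuous_on_subset[OF b]) auto
  moreover have "integral {real k + 2..t} (\<lambda>s. a' k s * b s) = integral {real k + 2..t} (\<lambda>s. 0)"
    by (rule Henstock_Kurzweil_Integration.integral_cong) (auto simp: outside)
  ultimately show ?thesis using t by (simp add: path_integral_def outside)
qed

text \<open>The integral of the \<open>k\<close>-th summand has reached its final value at time \<open>k + 2\<close>. The limit of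
the whole integral is the sum of these final values, and at time \<open>t\<close> only the summands with
\<open>k + 2 > t\<close> are still unfinished.\<close>
lemma path_integral_tail:
  assumes \<epsilon>: "\<And>t. t \<ge> 0 \<Longrightarrow> \<epsilon> t > 0" "\<And>s t. 0 \<le> s \<Longrightarrow> s \<le> t \<Longrightarrow> \<epsilon> t \<le> \<epsilon> s"
    and b: "continuous_on {0..} b"
    and K: "\<And>k t. k \<ge> K \<Longrightarrow> t \<ge> 0 \<Longrightarrow> \<bar>path_integral (a k) (a' k) b t\<bar> \<le> \<epsilon> (real k + 2) * (1 / 2) ^ (k + 2)"
  shows "\<exists>J. \<forall>t\<ge>real K + 2. \<bar>J - path_integral \<sigma> \<sigma>' b t\<bar> \<le> \<epsilon> t"
proof -
  let ?J = "\<lambda>k t. path_integral (a k) (a' k) b t"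
  have half: "(\<lambda>k. c * (1 / 2) ^ Suc k) sums c" for c :: real
    using sums_mult[OF power_half_series, of c] by simp
  have summ: "summable (\<lambda>k. ?J k (real k + 2))"
  proof (rule summable_comparison_test_ev)
    show "summable (\<lambda>k. \<epsilon> 0 * (1 / 2) ^ Suc k)" using half by (rule sums_summable)
    show "eventually (\<lambda>k. norm (?J k (real k + 2)) \<le> \<epsilon> 0 * (1 / 2) ^ Suc k) sequentially"
      using eventually_ge_at_top[of K]
    proof eventually_elim
      case (elim k)
      have "\<bar>?J k (real k + 2)\<bar> \<le> \<epsilon> (real k + 2) * (1 / 2) ^ (k + 2)" by (rule K) (use elim in auto)
      also have "\<dots> \<le> \<epsilon> 0 * (1 / 2) ^ Suc k"
        using \<epsilon>(1)[of 0] \<epsilon>(2)[of 0 "real k + 2"] by (intro mult_mono) auto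
      finally show ?case by simp
    qed
  qed
  show ?thesis
  proof (intro exI allI impI)
    fix t assume t: "t \<ge> real K + 2"
    obtain N where N: "t \<le> real N" using real_arch_simple by blast
    have fin: "(\<lambda>k. ?J k t) sums path_integral \<sigma> \<sigma>' b t"
    proof -
      have "(\<lambda>k. ?J k t) sums (\<Sum>k<N. ?J k t)"
        by (rule sums_finite) (use N in \<open>auto intro!: path_integral_piece_early\<close>)
      then show ?thesis
        using t N by (subst path_integral_\<sigma>[of t N]) (auto intro: continuous_on_subset[OF b])
    qed
    have diff: "(\<lambda>k. ?J k (real k + 2) - ?J k t) sums ((\<Sum>k. ?J k (real k + 2)) - path_integral \<sigma> \<sigma>' b t)"
      by (rule sums_diff[OF summable_sums[OF summ] fin])
    have piece_le: "\<bar>?J k (real k + 2) - ?J k t\<bar> \<le> \<epsilon> t * (1 / 2) ^ Suc k" for k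
    proof (cases "real k + 2 \<le> t")
      case True
      then show ?thesis using path_integral_piece_late[OF True b] \<epsilon>(1)[of t] t by simp
    next
      case False
      then have k: "k \<ge> K" using t by linarith
      have "\<bar>?J k (real k + 2)\<bar> \<le> \<epsilon> (real k + 2) * (1 / 2) ^ (k + 2)" "\<bar>?J k t\<bar> \<le> \<epsilon> (real k + 2) * (1 / 2) ^ (k + 2)"
        by (rule K[OF k], use t in simp)+
      moreover have "\<epsilon> (real k + 2) * (1 / 2) ^ (k + 2) \<le> \<epsilon> t * (1 / 2) ^ (k + 2)"
        using False t by (intro mult_right_mono \<epsilon>(2)) auto
      moreover have "\<epsilon> t * (1 / 2) ^ Suc k = \<epsilon> t * (1 / 2) ^ (k + 2) + \<epsilon> t * (1 / 2) ^ (k + 2)" by simp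
      ultimately show ?thesis by linarith
    qed
    have "\<bar>(\<Sum>k. ?J k (real k + 2)) - path_integral \<sigma> \<sigma>' b t\<bar> \<le> (\<Sum>k. \<epsilon> t * (1 / 2) ^ Suc k)"
    proof -
      have "norm (\<Sum>k. ?J k (real k + 2) - ?J k t) \<le> (\<Sum>k. \<epsilon> t * (1 / 2) ^ Suc k)"
        using piece_le by (intro norm_suminf_le sums_summable[OF half]) simp
      then show ?thesis using diff by (simp add: sums_iff)
    qed
    also have "\<dots> = \<epsilon> t" using half by (simp add: sums_iff)
    finally show "\<bar>(\<Sum>k. ?J k (real k + 2)) - path_integral \<sigma> \<sigma>' b t\<bar> \<le> \<epsilon> t" .
  qed
qed

text \<open>At any time at most one of the two active summands is near its centre. It is at most
\<open>(1 + O (1 / t)) * sqrt (\<Gamma> t) + O (1 / t)\<close>, the other one at most \<open>O (1 / t)\<close>. Since \<open>\<Gamma> t \<ge> 1\<close> eventually, the ratio is at most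
\<open>(1 + O (1 / t))\<^sup>2\<close>. At the positive integers it is at least 1.\<close>
lemma Limsup_ratio:
  assumes \<Gamma>: "\<And>t. t \<ge> 0 \<Longrightarrow> \<Gamma> t > 0" "filterlim \<Gamma> at_top at_top"
    and peak: "\<And>k. sqrt (\<Gamma> (real k + 1)) \<le> a k (real k + 1)"
    and upper: "\<And>k t. t \<ge> 0 \<Longrightarrow> a k t \<le> (1 + 1 / (real k + 1)) * sqrt (\<Gamma> t) + 1 / (real k + 1)"
    and away: "\<And>k t. 1 / 2 \<le> \<bar>t - (real k + 1)\<bar> \<Longrightarrow> a k t \<le> 1 / (real k + 1)"
  shows "Limsup at_top (\<lambda>t. ereal ((\<sigma> t)\<^sup>2 / \<Gamma> t)) = 1"
proof (rule antisym)
  have bound: "\<sigma> t \<le> (1 + 1 / (real n + 1)) * sqrt (\<Gamma> t) + 2 / (real n + 1)" if t: "real n + 1 \<le> t" "t \<le> real n + 2" for n t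
  proof -
    have "t \<ge> 0" using t by simp
    define r where "r = 1 / (real n + 1)"
    have r: "1 / (real (Suc n) + 1) \<le> r" "r > 0" by (auto simp: r_def field_simps)
    have s: "sqrt (\<Gamma> t) \<ge> 0" using \<Gamma>(1)[OF \<open>t \<ge> 0\<close>] by simp
    have up: "a n t \<le> (1 + r) * sqrt (\<Gamma> t) + r" using upper[OF \<open>t \<ge> 0\<close>, of n] by (simp add: r_def)
    have "(1 + 1 / (real (Suc n) + 1)) * sqrt (\<Gamma> t) \<le> (1 + r) * sqrt (\<Gamma> t)"
      using r s by (intro mult_right_mono) auto
    then have up': "a (Suc n) t \<le> (1 + r) * sqrt (\<Gamma> t) + r" using upper[OF \<open>t \<ge> 0\<close>, of "Suc n"] r by linarith
    have "0 \<le> (1 + r) * sqrt (\<Gamma> t)" using r s by simp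
    then have "a n t + a (Suc n) t \<le> (1 + r) * sqrt (\<Gamma> t) + 2 * r"
    proof (cases "1 / 2 \<le> \<bar>t - (real n + 1)\<bar>")
      case True
      then show ?thesis using away[of t n] up' by (simp add: r_def)
    next
      case False
      then have "1 / 2 \<le> \<bar>t - (real (Suc n) + 1)\<bar>" by (auto simp: abs_if split: if_splits)
      from away[OF this] show ?thesis using up r by linarith
    qed
    then show ?thesis using \<sigma>_two[OF t] by (simp add: r_def)
  qed
  have lim: "((\<lambda>t::real. 1 + 3 / (t - 1)) \<longlongrightarrow> 1) at_top"
  proof -
    have "filterlim (\<lambda>t::real. t - 1) at_top at_top"
      using filterlim_tendsto_add_at_top[OF tendsto_const filterlim_ident, of "- 1 :: real"] by simp
    then have "((\<lambda>t::real. 1 + 3 / (t - 1)) \<longlongrightarrow> 1 + (0::real)) at_top"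
      by (intro tendsto_add tendsto_const real_tendsto_divide_at_top[OF tendsto_const])
    then show ?thesis by simp
  qed
  have ev: "eventually (\<lambda>t. (\<sigma> t)\<^sup>2 / \<Gamma> t \<le> (1 + 3 / (t - 1))\<^sup>2) at_top"
  proof -
    have "eventually (\<lambda>t. \<Gamma> t \<ge> 1 \<and> t > 1) at_top"
      using \<Gamma>(2) eventually_gt_at_top[of "1::real"] by (auto simp: filterlim_at_top eventually_conj_iff)
    then show ?thesis
    proof eventually_elim
      case (elim t)
      define n where "n = nat \<lceil>t\<rceil> - 2"
      have n: "real n + 1 \<le> t" "t \<le> real n + 2"
        using elim by (auto simp: n_def of_nat_diff) linarith+
      have S: "sqrt (\<Gamma> t) \<ge> 1" using elim by simp
      define r where "r = 1 / (real n + 1)"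
      have "r \<le> 1 / (t - 1)" unfolding r_def using n elim by (intro divide_left_mono) auto
      then have r: "3 * r \<le> 3 / (t - 1)" by simp
      have "r * 1 \<le> r * sqrt (\<Gamma> t)"
        using S by (intro mult_left_mono) (auto simp: r_def)
      moreover have "\<sigma> t \<le> (1 + r) * sqrt (\<Gamma> t) + 2 * r"
        using bound[OF n] by (simp add: r_def)
      ultimately have "\<sigma> t \<le> (1 + 3 * r) * sqrt (\<Gamma> t)"
        by (simp add: distrib_right)
      also have "\<dots> \<le> (1 + 3 / (t - 1)) * sqrt (\<Gamma> t)"
        using r S by (intro mult_right_mono) auto
      finally have "(\<sigma> t)\<^sup>2 \<le> ((1 + 3 / (t - 1)) * sqrt (\<Gamma> t))\<^sup>2"
        using \<sigma>_pos[of t] elim by (intro power_mono) auto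
      also have "\<dots> = (1 + 3 / (t - 1))\<^sup>2 * \<Gamma> t" using elim unfolding power_mult_distrib by simp
      finally show ?case using elim by (subst pos_divide_le_eq) auto
    qed
  qed
  have "((\<lambda>t. ereal ((1 + 3 / (t - 1))\<^sup>2)) \<longlongrightarrow> ereal (1\<^sup>2)) at_top"
    by (intro tendsto_intros lim)
  then have "Limsup at_top (\<lambda>t. ereal ((1 + 3 / (t - 1))\<^sup>2)) = 1"
    by (intro lim_imp_Limsup) (auto simp: one_ereal_def)
  moreover have "Limsup at_top (\<lambda>t. ereal ((\<sigma> t)\<^sup>2 / \<Gamma> t)) \<le> Limsup at_top (\<lambda>t. ereal ((1 + 3 / (t - 1))\<^sup>2))"
    by (rule Limsup_mono) (use ev in simp)
  ultimately show "Limsup at_top (\<lambda>t. ereal ((\<sigma> t)\<^sup>2 / \<Gamma> t)) \<le> 1" by simp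
  show "1 \<le> Limsup at_top (\<lambda>t. ereal ((\<sigma> t)\<^sup>2 / \<Gamma> t))"
    unfolding Limsup_def
  proof (rule INF_greatest)
    fix P assume "P \<in> {P. eventually P (at_top :: real filter)}"
    then obtain T where T: "\<And>t. t \<ge> T \<Longrightarrow> P t" by (auto simp: eventually_at_top_linorder)
    obtain k where k: "T \<le> real k" using real_arch_simple by blast
    define t where "t = real k + 1"
    have "\<Gamma> t > 0" unfolding t_def by (rule \<Gamma>) simp
    have "sqrt (\<Gamma> t) \<le> a k t" using peak[of k] by (simp add: t_def)
    also have "a k t \<le> (\<Sum>j<Suc k. a j t)"
      using nonneg by (intro member_le_sum) auto
    also have "\<dots> = \<sigma> t" by (rule \<sigma>_finite[symmetric]) (simp add: t_def)
    finally have "(sqrt (\<Gamma> t))\<^sup>2 \<le> (\<sigma> t)\<^sup>2" using \<open>\<Gamma> t > 0\<close> by (intro power_mono) auto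
    then have "1 \<le> (\<sigma> t)\<^sup>2 / \<Gamma> t" using \<open>\<Gamma> t > 0\<close> by simp
    then have "1 \<le> ereal ((\<sigma> t)\<^sup>2 / \<Gamma> t)" by (simp add: one_ereal_def)
    also have "\<dots> \<le> (SUP t\<in>Collect P. ereal ((\<sigma> t)\<^sup>2 / \<Gamma> t))"
      using T[of t] k by (intro SUP_upper) (auto simp: t_def)
    finally show "1 \<le> (SUP t\<in>Collect P. ereal ((\<sigma> t)\<^sup>2 / \<Gamma> t))" .
  qed
qed

end

section \<open>Picard iteration for the integral equation\<close>

text \<open>Iterating an integral inequality gains a factor \<open>L * t / n\<close> in step \<open>n\<close>. Used for a sequence of
Picard differences it gives convergence; used for a constant sequence it gives uniqueness.\<close>
lemma picard_power_bound:
  fixes d :: "nat \<Rightarrow> real \<Rightarrow> real"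
  assumes L: "L \<ge> 0" and d0: "\<And>t. 0 \<le> t \<Longrightarrow> t \<le> T \<Longrightarrow> d 0 t \<le> C"
    and cont: "\<And>n. continuous_on {0..T} (d n)"
    and step: "\<And>n t. 0 \<le> t \<Longrightarrow> t \<le> T \<Longrightarrow> d (Suc n) t \<le> L * integral {0..t} (d n)"
    and t: "0 \<le> t" "t \<le> T"
  shows "d n t \<le> C * (L * t) ^ n / fact n"
  using t
proof (induction n arbitrary: t)
  case 0 then show ?case using d0 by simp
next
  case (Suc n)
  have "((\<lambda>s. C * L ^ n / fact n * s ^ n) has_integral (C * L ^ n / fact n * (t ^ Suc n / Suc n))) {0..t}"
  proof (rule has_integral_mult_right)
    have "((\<lambda>s. s ^ n) has_integral (t ^ Suc n / Suc n - 0 ^ Suc n / Suc n)) {0..t}"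
    proof (rule fundamental_theorem_of_calculus[OF Suc.prems(1)])
      fix x assume "x \<in> {0..t}"
      have "((\<lambda>s. s ^ Suc n / real (Suc n)) has_real_derivative (real (Suc n) * x ^ n / real (Suc n))) (at x within {0..t})"
        using DERIV_cdivide[OF DERIV_pow[of "Suc n" x "{0..t}"], of "real (Suc n)"] by simp
      then show "((\<lambda>s. s ^ Suc n / real (Suc n)) has_vector_derivative x ^ n) (at x within {0..t})"
        by (simp add: has_real_derivative_iff_has_vector_derivative[symmetric] del: of_nat_Suc power_Suc)
    qed
    then show "((\<lambda>s. s ^ n) has_integral (t ^ Suc n / Suc n)) {0..t}" by simp
  qed
  then have I: "((\<lambda>s. C * (L * s) ^ n / fact n) has_integral (C * L ^ n / fact n * (t ^ Suc n / Suc n))) {0..t}"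
    by (simp add: power_mult_distrib mult_ac)
  have "integral {0..t} (d n) \<le> C * L ^ n / fact n * (t ^ Suc n / Suc n)"
  proof (rule has_integral_le[OF integrable_integral I])
    show "d n integrable_on {0..t}"
      using Suc.prems by (intro integrable_continuous_interval continuous_on_subset[OF cont]) auto
    show "d n s \<le> C * (L * s) ^ n / fact n" if "s \<in> {0..t}" for s
      using that Suc.prems by (intro Suc.IH) auto
  qed
  then have "L * integral {0..t} (d n) \<le> L * (C * L ^ n / fact n * (t ^ Suc n / Suc n))"
    using L by (rule mult_left_mono)
  also have "\<dots> = C * (L * t) ^ Suc n / fact (Suc n)"
    by (simp add: power_mult_distrib field_simps)
  finally show ?case using step[OF Suc.prems, of n] by linarith
qed

lemma power_over_fact_tendsto_0: "(\<lambda>n. C * x ^ n / fact n) \<longlonglongrightarrow> (0::real)"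
proof -
  have "(\<lambda>n. x ^ n / fact n) \<longlonglongrightarrow> 0"
    using summable_LIMSEQ_zero[OF summable_exp[of x]] by (simp add: divide_inverse mult.commute)
  from tendsto_mult_left[OF this, of C] show ?thesis by simp
qed

lemma integral_equation_unique:
  fixes g x y j :: "real \<Rightarrow> real"
  assumes g: "L-lipschitz_on UNIV g" and x: "continuous_on {0..T} x" and y: "continuous_on {0..T} y"
    and x_eq: "\<And>t. 0 \<le> t \<Longrightarrow> t \<le> T \<Longrightarrow> x t = j t - integral {0..t} (\<lambda>s. g (x s))"
    and y_eq: "\<And>t. 0 \<le> t \<Longrightarrow> t \<le> T \<Longrightarrow> y t = j t - integral {0..t} (\<lambda>s. g (y s))"
    and t: "0 \<le> t" "t \<le> T"
  shows "x t = y t"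
proof -
  have L: "L \<ge> 0" using g by (rule lipschitz_on_nonneg)
  have gc: "continuous_on S g" for S using lipschitz_on_continuous_on[OF g] continuous_on_subset by blast
  define d where "d s = \<bar>x s - y s\<bar>" for s
  have dc: "continuous_on {0..T} d" unfolding d_def by (intro continuous_intros x y)
  obtain C where C: "\<And>s. s \<in> {0..T} \<Longrightarrow> \<bar>d s\<bar> \<le> C"
    using compact_imp_bounded[OF compact_continuous_image[OF dc compact_Icc]] unfolding bounded_iff real_norm_def by (metis imageI)
  have bound: "d t \<le> C * (L * t) ^ n / fact n" for n
  proof (rule picard_power_bound[OF L _ _ _ t, of "\<lambda>_. d"])
    show "d s \<le> C" if "0 \<le> s" "s \<le> T" for s using C[of s] that by auto
    show "continuous_on {0..T} d" by (rule dc)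
    fix s assume s: "0 \<le> s" "s \<le> T"
    have sub: "{0..s} \<subseteq> {0..T}" using s by auto
    have c: "continuous_on {0..s} (\<lambda>r. g (x r))" "continuous_on {0..s} (\<lambda>r. g (y r))"
      by (rule continuous_on_compose2[OF gc[of UNIV] continuous_on_subset[OF x sub]]
          continuous_on_compose2[OF gc[of UNIV] continuous_on_subset[OF y sub]]; simp)+
    have "x s - y s = integral {0..s} (\<lambda>r. g (y r)) - integral {0..s} (\<lambda>r. g (x r))"
      using x_eq[OF s] y_eq[OF s] by simp
    also have "\<dots> = integral {0..s} (\<lambda>r. g (y r) - g (x r))"
      using c by (intro Henstock_Kurzweil_Integration.integral_diff[symmetric] integrable_continuous_interval)
    finally have "d s = norm (integral {0..s} (\<lambda>r. g (y r) - g (x r)))" by (simp add: d_def)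
    also have "\<dots> \<le> integral {0..s} (\<lambda>r. L * d r)"
    proof (rule integral_norm_bound_integral)
      show "(\<lambda>r. g (y r) - g (x r)) integrable_on {0..s}"
        using c by (intro integrable_continuous_interval continuous_intros)
      show "(\<lambda>r. L * d r) integrable_on {0..s}"
        by (intro integrable_continuous_interval continuous_intros continuous_on_subset[OF dc sub])
      show "norm (g (y r) - g (x r)) \<le> L * d r" for r
        using lipschitz_onD[OF g, of "y r" "x r"] by (simp add: d_def dist_real_def abs_minus_commute)
    qed
    finally show "d s \<le> L * integral {0..s} d" by simp
  qed
  have "d t \<le> 0"
    using LIMSEQ_le_const[OF power_over_fact_tendsto_0] bound by blast
  then show ?thesis by (simp add: d_def)
qed

lemma continuous_on_nonneg_reals:
  fixes f :: "real \<Rightarrow> real"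
  assumes "\<And>T. continuous_on {0..T} f"
  shows "continuous_on {0..} f"
  unfolding continuous_on_iff
proof (intro ballI allI impI)
  fix t e :: real assume t: "t \<in> {0..}" and "e > 0"
  then have "t \<in> {0..t + 1}" by simp
  then obtain d where d: "d > 0" "\<And>s. s \<in> {0..t + 1} \<Longrightarrow> dist s t < d \<Longrightarrow> dist (f s) (f t) < e"
    using assms[of "t + 1"] \<open>e > 0\<close> unfolding continuous_on_iff by metis
  show "\<exists>d>0. \<forall>s\<in>{0..}. dist s t < d \<longrightarrow> dist (f s) (f t) < e"
    by (rule exI[of _ "min d 1"]) (use d in \<open>auto simp: dist_real_def\<close>)
qed

text \<open>The integral in the Picard step is a limit of Riemann sums, so that \<open>picard g j n t\<close> is built from countably many
values of \<open>j\<close> at times in \<open>[0, t]\<close>.\<close>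
fun picard :: "(real \<Rightarrow> real) \<Rightarrow> (real \<Rightarrow> real) \<Rightarrow> nat \<Rightarrow> real \<Rightarrow> real" where
  "picard g j 0 t = j t"
| "picard g j (Suc n) t = j t - lim (\<lambda>m. \<Sum>k<Suc m. g (picard g j n (grid t m k)) * (t / real (Suc m)))"

declare picard.simps(2) [simp del]

text \<open>The differences of consecutive iterates are dominated on \<open>[0, T]\<close> by the terms of an exponential series, so
the iterates converge uniformly there and the integrals converge along.\<close>
lemma picard_converges:
  fixes g j :: "real \<Rightarrow> real"
  assumes g: "L-lipschitz_on UNIV g" and j: "continuous_on {0..} j"
  shows "\<exists>x. continuous_on {0..} x \<and> (\<forall>t\<ge>0. (\<lambda>n. picard g j n t) \<longlonglongrightarrow> x t) \<and>
    (\<forall>t\<ge>0. x t = j t - integral {0..t} (\<lambda>s. g (x s)))"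
proof -
  have L: "L \<ge> 0" using g by (rule lipschitz_on_nonneg)
  have gc: "continuous_on S g" for S using lipschitz_on_continuous_on[OF g] continuous_on_subset by blast
  have gx: "continuous_on S (\<lambda>s. g (x s))" if "continuous_on S x" for S x
    using that by (intro continuous_on_compose2[OF gc[of UNIV]]) auto
  let ?p = "picard g j"
  have p: "continuous_on {0..} (?p n) \<and> (\<forall>t\<ge>0. ?p (Suc n) t = j t - integral {0..t} (\<lambda>s. g (?p n s)))" for n
  proof (induction n)
    case 0
    have "continuous_on {0..} (?p 0)" using j by simp
    moreover have "?p (Suc 0) t = j t - integral {0..t} (\<lambda>s. g (?p 0 s))" if "t \<ge> 0" for t
      unfolding picard.simps(2) using that
      by (subst limI[OF riemann_sum_tendsto[OF that]]) (auto intro!: gx continuous_on_subset[OF j])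
    ultimately show ?case by blast
  next
    case (Suc n)
    have "continuous_on {0..} (\<lambda>t. j t - integral {0..t} (\<lambda>s. g (?p n s)))"
    proof (intro continuous_on_diff j)
      show "continuous_on {0..} (\<lambda>t. integral {0..t} (\<lambda>s. g (?p n s)))"
        using Suc.IH
        by (intro continuous_on_nonneg_reals indefinite_integral_continuous_1 integrable_continuous_interval gx)
          (auto intro: continuous_on_subset)
    qed
    then have c: "continuous_on {0..} (?p (Suc n))"
      by (rule continuous_on_eq) (use Suc.IH in auto)
    moreover have "?p (Suc (Suc n)) t = j t - integral {0..t} (\<lambda>s. g (?p (Suc n) s))" if "t \<ge> 0" for t
      unfolding picard.simps(2)[of _ _ "Suc n"] using that
      by (subst limI[OF riemann_sum_tendsto[OF that]]) (auto intro!: gx continuous_on_subset[OF c] simp del: picard.simps)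
    ultimately show ?case by blast
  qed
  define x where "x t = j t + (\<Sum>i. ?p (Suc i) t - ?p i t)" for t
  have unif: "uniform_limit {0..T} ?p x sequentially" for T
  proof -
    have pT: "continuous_on {0..T} (?p n)" for n
      using p[of n] by (auto intro: continuous_on_subset)
    have dc: "continuous_on {0..T} (\<lambda>t. \<bar>?p (Suc n) t - ?p n t\<bar>)" for n
      by (intro continuous_intros pT)
    have "bounded ((\<lambda>s. \<bar>?p (Suc 0) s - ?p 0 s\<bar>) ` {0..T})"
      by (intro compact_imp_bounded compact_continuous_image dc compact_Icc)
    then obtain C where "\<forall>y\<in>(\<lambda>s. \<bar>?p (Suc 0) s - ?p 0 s\<bar>) ` {0..T}. norm y \<le> C"
      unfolding bounded_iff by blast
    then have C: "\<bar>?p (Suc 0) s - ?p 0 s\<bar> \<le> C" if "s \<in> {0..T}" for s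
      using that by auto
    have bound: "\<bar>?p (Suc n) t - ?p n t\<bar> \<le> C * (L * t) ^ n / fact n" if t: "0 \<le> t" "t \<le> T" for n t
    proof (rule picard_power_bound[where d = "\<lambda>n t. \<bar>?p (Suc n) t - ?p n t\<bar>", OF L _ dc _ t])
      show "\<bar>?p (Suc 0) s - ?p 0 s\<bar> \<le> C" if "0 \<le> s" "s \<le> T" for s
        using C[of s] that by (simp only: atLeastAtMost_iff)
      fix n s assume s: "0 \<le> s" "s \<le> T"
      have sub: "{0..s} \<subseteq> {0..T}" using s by auto
      have c: "continuous_on {0..s} (\<lambda>r. g (?p k r))" for k
        by (intro gx continuous_on_subset[OF pT sub])
      have "?p (Suc (Suc n)) s - ?p (Suc n) s = integral {0..s} (\<lambda>r. g (?p n r)) - integral {0..s} (\<lambda>r. g (?p (Suc n) r))"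
        using p[of n] p[of "Suc n"] s by simp
      also have "\<dots> = integral {0..s} (\<lambda>r. g (?p n r) - g (?p (Suc n) r))"
        using c by (intro Henstock_Kurzweil_Integration.integral_diff[symmetric] integrable_continuous_interval)
      finally have "\<bar>?p (Suc (Suc n)) s - ?p (Suc n) s\<bar> = norm (integral {0..s} (\<lambda>r. g (?p n r) - g (?p (Suc n) r)))"
        by (simp only: real_norm_def)
      also have "\<dots> \<le> integral {0..s} (\<lambda>r. L * \<bar>?p (Suc n) r - ?p n r\<bar>)"
      proof (rule integral_norm_bound_integral)
        show "(\<lambda>r. g (?p n r) - g (?p (Suc n) r)) integrable_on {0..s}"
          using c by (intro integrable_continuous_interval continuous_on_diff)
        show "(\<lambda>r. L * \<bar>?p (Suc n) r - ?p n r\<bar>) integrable_on {0..s}"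
          by (intro integrable_continuous_interval continuous_on_mult continuous_on_const continuous_on_subset[OF dc sub])
        show "norm (g (?p n r) - g (?p (Suc n) r)) \<le> L * \<bar>?p (Suc n) r - ?p n r\<bar>" for r
          using lipschitz_onD[OF g, of "?p n r" "?p (Suc n) r"] by (simp only: dist_real_def UNIV_I abs_minus_commute real_norm_def)
      qed
      finally show "\<bar>?p (Suc (Suc n)) s - ?p (Suc n) s\<bar> \<le> L * integral {0..s} (\<lambda>r. \<bar>?p (Suc n) r - ?p n r\<bar>)"
        by (simp only: integral_mult_right)
    qed
    have "uniform_limit {0..T} (\<lambda>n t. \<Sum>i<n. ?p (Suc i) t - ?p i t) (\<lambda>t. \<Sum>i. ?p (Suc i) t - ?p i t) sequentially"
    proof (rule Weierstrass_m_test)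
      show "norm (?p (Suc n) t - ?p n t) \<le> \<bar>C\<bar> * (L * T) ^ n / fact n" if t: "t \<in> {0..T}" for n t
      proof -
        have "C * (L * t) ^ n / fact n \<le> \<bar>C\<bar> * (L * T) ^ n / fact n"
          using t L by (intro divide_right_mono mult_mono power_mono mult_left_mono) auto
        moreover have "\<bar>?p (Suc n) t - ?p n t\<bar> \<le> C * (L * t) ^ n / fact n"
          using t by (intro bound) auto
        ultimately show ?thesis unfolding real_norm_def by linarith
      qed
      have "summable (\<lambda>n. \<bar>C\<bar> * (inverse (fact n) * (L * T) ^ n))"
        by (intro summable_mult summable_exp)
      then show "summable (\<lambda>n. \<bar>C\<bar> * (L * T) ^ n / fact n)"
        by (simp only: divide_inverse mult_ac)
    qed
    then have "uniform_limit {0..T} (\<lambda>n t. j t + (\<Sum>i<n. ?p (Suc i) t - ?p i t)) x sequentially"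
      unfolding x_def by (intro uniform_limit_add uniform_limit_const)
    moreover have "j t + (\<Sum>i<n. ?p (Suc i) t - ?p i t) = ?p n t" for n t
      by (subst sum_lessThan_telescope) simp
    ultimately show ?thesis by (simp only:)
  qed
  have xT: "continuous_on {0..T} x" for T
    by (rule uniform_limit_theorem[OF _ unif]) (auto intro!: always_eventually continuous_on_subset[OF conjunct1[OF p]])
  have lim: "(\<lambda>n. ?p n t) \<longlonglongrightarrow> x t" if "t \<ge> 0" for t
    using tendsto_uniform_limitI[OF unif[of t]] that by simp
  have "x t = j t - integral {0..t} (\<lambda>s. g (x s))" if t: "t \<ge> 0" for t
  proof (rule LIMSEQ_unique)
    show "(\<lambda>n. ?p (Suc n) t) \<longlonglongrightarrow> x t" using lim[OF t] by (rule LIMSEQ_Suc)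
    show "(\<lambda>n. ?p (Suc n) t) \<longlonglongrightarrow> j t - integral {0..t} (\<lambda>s. g (x s))"
    proof (rule tendstoI)
      fix e :: real assume "e > 0"
      define e' where "e' = e / (L * t + 1)"
      have Lt: "L * t + 1 > 0" using L t by (simp add: add_nonneg_pos)
      then have e': "e' > 0" using \<open>e > 0\<close> by (simp add: e'_def)
      show "eventually (\<lambda>n. dist (?p (Suc n) t) (j t - integral {0..t} (\<lambda>s. g (x s))) < e) sequentially"
        using uniform_limitD[OF unif e', of t]
      proof eventually_elim
        case (elim n)
        have c: "continuous_on {0..t} (\<lambda>r. g (x r))" "continuous_on {0..t} (\<lambda>r. g (?p n r))"
          using p[of n] by (auto intro!: gx xT intro: continuous_on_subset)
        have "?p (Suc n) t - (j t - integral {0..t} (\<lambda>s. g (x s))) = integral {0..t} (\<lambda>s. g (x s)) - integral {0..t} (\<lambda>s. g (?p n s))"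
          using p[of n] t by simp
        also have "\<dots> = integral {0..t} (\<lambda>s. g (x s) - g (?p n s))"
          using c by (intro Henstock_Kurzweil_Integration.integral_diff[symmetric] integrable_continuous_interval)
        also have "norm \<dots> \<le> (L * e') * (t - 0)"
        proof (rule integral_bound[OF t])
          show "continuous_on {0..t} (\<lambda>s. g (x s) - g (?p n s))" using c by (intro continuous_on_diff)
          fix s assume s: "s \<in> {0..t}"
          have "dist (g (x s)) (g (?p n s)) \<le> L * dist (x s) (?p n s)" using g by (rule lipschitz_onD) auto
          also have "\<dots> \<le> L * e'" using elim s L by (intro mult_left_mono) (auto simp: dist_commute less_imp_le)
          finally show "norm (g (x s) - g (?p n s)) \<le> L * e'" by (simp add: dist_real_def)
        qed
        also have "\<dots> < e"
        proof -
          have "L * e' * t < e' * (L * t + 1)" using e' by (simp add: algebra_simps)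
          also have "\<dots> = e" using Lt by (simp add: e'_def)
          finally show ?thesis by simp
        qed
        finally show ?case by (simp only: dist_real_def real_norm_def)
      qed
    qed
  qed
  then show ?thesis using lim continuous_on_nonneg_reals[OF xT] by blast
qed

section \<open>Existence of solutions of the stochastic equation\<close>

definition truncate :: "real \<Rightarrow> real \<Rightarrow> real" where
  "truncate R x = max (- R) (min R x)"

lemma truncate_lipschitz: "\<bar>truncate R x - truncate R y\<bar> \<le> \<bar>x - y\<bar>"
  unfolding truncate_def by (auto simp: max_def min_def)

lemma truncated_lipschitz:
  assumes f: "locally_lipschitz f" and R: "R \<ge> 0"
  shows "\<exists>L. L-lipschitz_on UNIV (\<lambda>x. f (truncate R x))"
proof -
  obtain L where L: "L > 0" "L-lipschitz_on {- R..R} f"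
    using locally_lipschitz_imp_lipschitz_on_interval[OF f] by blast
  have "L-lipschitz_on UNIV (\<lambda>x. f (truncate R x))"
  proof (rule lipschitz_onI)
    fix x y :: real
    have "dist (f (truncate R x)) (f (truncate R y)) \<le> L * dist (truncate R x) (truncate R y)"
      using R by (intro lipschitz_onD[OF L(2)]) (auto simp: truncate_def)
    also have "\<dots> \<le> L * dist x y"
      using L(1) truncate_lipschitz[of R x y] by (intro mult_left_mono) (auto simp: dist_real_def)
    finally show "dist (f (truncate R x)) (f (truncate R y)) \<le> L * dist x y" .
  qed (use L in simp)
  then show ?thesis ..
qed

text \<open>The truncation must not matter: the difference \<open>x - j\<close> cannot rise above the bound \<open>m\<close> of \<open>j\<close>, since beyond it
\<open>x\<close> is positive and the drift points downwards. The bound depends on \<open>m\<close> only, not on the truncation level.\<close>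
lemma restoring_bound_above:
  fixes g x j :: "real \<Rightarrow> real"
  assumes g: "continuous_on UNIV g" "\<And>x. x > 0 \<Longrightarrow> g x \<ge> 0"
    and x: "continuous_on {0..T} x" and x_eq: "\<And>t. 0 \<le> t \<Longrightarrow> t \<le> T \<Longrightarrow> x t = j t - integral {0..t} (\<lambda>s. g (x s))"
    and j: "\<And>t. 0 \<le> t \<Longrightarrow> t \<le> T \<Longrightarrow> \<bar>j t\<bar> \<le> m" and t: "0 \<le> t" "t \<le> T"
  shows "x t \<le> 2 * m"
proof -
  have m: "m \<ge> 0" using j[OF t] by simp
  define y where "y s = - integral {0..s} (\<lambda>s. g (x s))" for s
  have gx: "continuous_on {0..T} (\<lambda>s. g (x s))"
    by (rule continuous_on_compose2[OF g(1) x]) auto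
  have "y t \<le> m"
  proof (rule barrier_le[OF _ t(1)])
    show "continuous_on {0..t} y"
      unfolding y_def using t
      by (intro continuous_on_minus indefinite_integral_continuous_1 integrable_continuous_interval continuous_on_subset[OF gx]) auto
    show "y 0 \<le> m" using m by (simp add: y_def)
    fix s assume s: "0 < s" "s < t" "y s > m"
    have "((\<lambda>s. integral {0..s} (\<lambda>s. g (x s))) has_real_derivative g (x s)) (at s within {0..T})"
      using s t by (intro integral_has_real_derivative gx) auto
    then have "((\<lambda>s. integral {0..s} (\<lambda>s. g (x s))) has_real_derivative g (x s)) (at s)"
      using s t at_within_Icc_at[of 0 s T] by simp
    then have "(y has_real_derivative - g (x s)) (at s)"
      unfolding y_def by (rule DERIV_minus)
    moreover have "x s > 0" using x_eq[of s] j[of s] s t by (simp add: y_def)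
    then have "g (x s) \<ge> 0" by (rule g)
    ultimately show "\<exists>D. (y has_real_derivative D) (at s) \<and> D \<le> 0" by force
  qed
  then show ?thesis using x_eq[OF t] j[OF t] by (simp add: y_def)
qed

lemma restoring_bound:
  fixes g x j :: "real \<Rightarrow> real"
  assumes g: "continuous_on UNIV g" "\<And>x. x > 0 \<Longrightarrow> g x \<ge> 0" "\<And>x. x < 0 \<Longrightarrow> g x \<le> 0"
    and x: "continuous_on {0..T} x" and x_eq: "\<And>t. 0 \<le> t \<Longrightarrow> t \<le> T \<Longrightarrow> x t = j t - integral {0..t} (\<lambda>s. g (x s))"
    and j: "\<And>t. 0 \<le> t \<Longrightarrow> t \<le> T \<Longrightarrow> \<bar>j t\<bar> \<le> m" and t: "0 \<le> t" "t \<le> T"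
  shows "\<bar>x t\<bar> \<le> 2 * m"
proof -
  have "x t \<le> 2 * m" by (rule restoring_bound_above[OF g(1,2) x x_eq j t])
  moreover have "- x t \<le> 2 * m"
  proof (rule restoring_bound_above[where g = "\<lambda>x. - g (- x)" and j = "\<lambda>t. - j t", OF _ _ _ _ _ t])
    show "continuous_on UNIV (\<lambda>x. - g (- x))"
      by (intro continuous_on_minus continuous_on_compose2[OF g(1)]) (auto intro!: continuous_intros)
    show "- g (- x) \<ge> 0" if "x > 0" for x using g(3)[of "- x"] that by simp
    show "continuous_on {0..T} (\<lambda>t. - x t)" using x by (rule continuous_on_minus)
    show "- x s = - j s - integral {0..s} (\<lambda>s. - g (- (- x s)))" if "0 \<le> s" "s \<le> T" for s
      using x_eq[OF that] by simp
    show "\<bar>- j s\<bar> \<le> m" if "0 \<le> s" "s \<le> T" for s using j[OF that] by simp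
  qed
  ultimately show ?thesis by simp
qed

text \<open>The truncation level is removed by a limit and not by a choice that depends on the path, so
that the result at time \<open>t\<close> depends measurably on the path up to time \<open>t\<close> only. Along a continuous
path the sequence is eventually constant.\<close>
definition solver :: "(real \<Rightarrow> real) \<Rightarrow> (real \<Rightarrow> real) \<Rightarrow> real \<Rightarrow> real" where
  "solver f j t = lim (\<lambda>R. lim (\<lambda>n. picard (\<lambda>x. f (truncate (real R) x)) j n t))"

lemma solver_correct:
  fixes f j :: "real \<Rightarrow> real"
  assumes f: "locally_lipschitz f" and sign: "\<And>x. x > 0 \<Longrightarrow> f x \<ge> 0" "\<And>x. x < 0 \<Longrightarrow> f x \<le> 0"
    and j: "continuous_on {0..} j"
  shows "continuous_on {0..} (solver f j)"
    "\<And>t. t \<ge> 0 \<Longrightarrow> solver f j t = j t - integral {0..t} (\<lambda>s. f (solver f j s))"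
proof -
  let ?g = "\<lambda>R x. f (truncate (real R) x)"
  define y where "y R t = lim (\<lambda>n. picard (?g R) j n t)" for R t
  have y: "continuous_on {0..} (y R)" "t \<ge> 0 \<Longrightarrow> y R t = j t - integral {0..t} (\<lambda>s. ?g R (y R s))" for R t
  proof -
    obtain L where "L-lipschitz_on UNIV (?g R)" using truncated_lipschitz[OF f, of "real R"] by auto
    from picard_converges[OF this j] obtain x where x: "continuous_on {0..} x"
      "\<And>t. t \<ge> 0 \<Longrightarrow> (\<lambda>n. picard (?g R) j n t) \<longlonglongrightarrow> x t"
      "\<And>t. t \<ge> 0 \<Longrightarrow> x t = j t - integral {0..t} (\<lambda>s. ?g R (x s))" by blast
    have eq: "y R t = x t" if "t \<ge> 0" for t unfolding y_def by (rule limI[OF x(2)[OF that]])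
    show "continuous_on {0..} (y R)" by (rule continuous_on_eq[OF x(1)]) (simp add: eq)
    show "t \<ge> 0 \<Longrightarrow> y R t = j t - integral {0..t} (\<lambda>s. ?g R (y R s))"
    proof -
      assume t: "t \<ge> 0"
      have "integral {0..t} (\<lambda>s. ?g R (y R s)) = integral {0..t} (\<lambda>s. ?g R (x s))"
        by (rule Henstock_Kurzweil_Integration.integral_cong) (simp add: eq)
      then show ?thesis using x(3)[OF t] eq[OF t] by simp
    qed
  qed
  have loc: "\<exists>N. \<forall>t. 0 \<le> t \<and> t \<le> T \<longrightarrow> solver f j t = y N t \<and> truncate (real N) (y N t) = y N t" for T
  proof -
    have "compact (j ` {0..T})" by (intro compact_continuous_image continuous_on_subset[OF j]) auto
    then have "bounded (j ` {0..T})" by (rule compact_imp_bounded)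
    then obtain m where "m > 0" "\<forall>x\<in>j ` {0..T}. norm x \<le> m"
      unfolding bounded_pos by blast
    then have m: "m > 0" "\<And>t. 0 \<le> t \<Longrightarrow> t \<le> T \<Longrightarrow> \<bar>j t\<bar> \<le> m" by auto
    obtain N where N: "2 * m \<le> real N" using real_arch_simple by blast
    obtain L where L: "L-lipschitz_on UNIV (?g N)" using truncated_lipschitz[OF f, of "real N"] by auto
    have yT: "continuous_on {0..T} (y R)" for R using y(1) by (rule continuous_on_subset) auto
    have bound: "\<bar>y R t\<bar> \<le> 2 * m" if R: "R \<ge> N" and t: "0 \<le> t" "t \<le> T" for R t
    proof (rule restoring_bound[OF _ _ _ yT y(2) m(2) t])
      show "continuous_on UNIV (?g R)"
        by (intro continuous_on_compose2[OF locally_lipschitz_imp_continuous[OF f, of UNIV]])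
          (auto simp: truncate_def intro!: continuous_intros)
      have "real N \<le> real R" using R by simp
      then have "real R > 0" using N m(1) by linarith
      then show "0 \<le> ?g R x" if "x > 0" for x using that by (intro sign) (auto simp: truncate_def)
      show "?g R x \<le> 0" if "x < 0" for x using that \<open>real R > 0\<close> by (intro sign) (auto simp: truncate_def)
    qed
    have trunc: "truncate (real R') (y R t) = y R t" if "R \<ge> N" "R' \<ge> N" "0 \<le> t" "t \<le> T" for R R' t
    proof -
      have "\<bar>y R t\<bar> \<le> real R'" using bound[OF that(1,3,4)] N that(2) by linarith
      then show ?thesis by (auto simp: truncate_def)
    qed
    have same: "y R t = y N t" if R: "R \<ge> N" and t: "0 \<le> t" "t \<le> T" for R t
    proof (rule integral_equation_unique[OF L yT yT _ _ t])
      show "y N s = j s - integral {0..s} (\<lambda>r. ?g N (y N r))" if "0 \<le> s" for s using that by (rule y)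
      show "y R s = j s - integral {0..s} (\<lambda>r. ?g N (y R r))" if s: "0 \<le> s" "s \<le> T" for s
      proof -
        have "integral {0..s} (\<lambda>r. ?g R (y R r)) = integral {0..s} (\<lambda>r. ?g N (y R r))"
          by (rule Henstock_Kurzweil_Integration.integral_cong) (use s R in \<open>simp add: trunc\<close>)
        then show ?thesis using y(2)[OF s(1), of R] by simp
      qed
    qed
    have "solver f j t = y N t" if t: "0 \<le> t" "t \<le> T" for t
      unfolding solver_def y_def[symmetric]
    proof (rule limI, rule tendsto_eventually)
      show "eventually (\<lambda>R. y R t = y N t) sequentially"
        using eventually_ge_at_top[of N] by eventually_elim (use same t in blast)
    qed
    then show ?thesis using trunc by blast
  qed
  show "continuous_on {0..} (solver f j)"
  proof (rule continuous_on_nonneg_reals)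
    fix T
    obtain N where N: "\<And>t. 0 \<le> t \<Longrightarrow> t \<le> T \<Longrightarrow> solver f j t = y N t" using loc[of T] by blast
    have "continuous_on {0..T} (y N)" using y(1) by (rule continuous_on_subset) auto
    then show "continuous_on {0..T} (solver f j)" by (rule continuous_on_eq) (simp add: N)
  qed
  show "solver f j t = j t - integral {0..t} (\<lambda>s. f (solver f j s))" if t: "t \<ge> 0" for t
  proof -
    obtain N where N: "\<And>s. 0 \<le> s \<Longrightarrow> s \<le> t \<Longrightarrow> solver f j s = y N s"
      "\<And>s. 0 \<le> s \<Longrightarrow> s \<le> t \<Longrightarrow> truncate (real N) (y N s) = y N s" using loc[of t] by blast
    have "integral {0..t} (\<lambda>s. f (solver f j s)) = integral {0..t} (\<lambda>s. ?g N (y N s))"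
      by (rule Henstock_Kurzweil_Integration.integral_cong) (simp add: N)
    then show ?thesis using y(2)[OF t, of N] N(1)[of t] t by simp
  qed
qed

lemma interval_integral_eq_HK:
  fixes g :: "real \<Rightarrow> real"
  assumes "t \<ge> 0" "continuous_on {0..t} g"
  shows "(LBINT s=0..t. g s) = integral {0..t} g"
proof -
  have "set_integrable lborel {0..t} g"
    using assms(2) by (rule borel_integrable_atLeastAtMost')
  then show ?thesis using interval_integral_eq_integral[of 0 t g] assms(1) by (simp add: zero_ereal_def)
qed

context brownian_motion
begin

lemma wiener_integral_continuous_path:
  assumes D: "continuous_on UNIV D" and \<sigma>: "\<And>s. (\<sigma> has_real_derivative D s) (at s)"
    and b: "continuous_on {0..} (\<lambda>s. B s \<omega>)" and t: "t \<ge> 0"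
  shows "(\<lambda>m. ito_sum \<sigma> t m \<omega>) \<longlonglongrightarrow> wiener_integral \<sigma> t \<omega>"
    "wiener_integral \<sigma> t \<omega> = path_integral \<sigma> D (\<lambda>s. B s \<omega>) t"
proof -
  have *: "continuous_on {0..t} (\<lambda>s. B s \<omega>)" "continuous_on {0..t} D"
    "s \<in> {0..t} \<Longrightarrow> (\<sigma> has_real_derivative D s) (at s within {0..t})" for s
    using D b \<sigma> by (auto intro: continuous_on_subset has_field_derivative_at_within)
  show eq: "wiener_integral \<sigma> t \<omega> = path_integral \<sigma> D (\<lambda>s. B s \<omega>) t"
    by (rule wiener_integral_path[OF t *])
  show "(\<lambda>m. ito_sum \<sigma> t m \<omega>) \<longlonglongrightarrow> wiener_integral \<sigma> t \<omega>"
    unfolding eq by (rule ito_sum_tendsto_path[OF t *])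
qed

lemma path_integral_continuous:
  assumes D: "continuous_on UNIV D" and \<sigma>: "\<And>s. (\<sigma> has_real_derivative D s) (at s)"
    and b: "continuous_on {0..} b"
  shows "continuous_on {0..} (path_integral \<sigma> D b)"
proof -
  have \<sigma>c: "continuous_on S \<sigma>" for S
    by (intro continuous_at_imp_continuous_on ballI DERIV_isCont[OF \<sigma>])
  have "continuous_on {0..} (\<lambda>t. integral {0..t} (\<lambda>s. D s * b s))"
    by (intro continuous_on_nonneg_reals indefinite_integral_continuous_1 integrable_continuous_interval
        continuous_on_mult continuous_on_subset[OF D] continuous_on_subset[OF b]) auto
  then show ?thesis
    unfolding path_integral_def[abs_def] by (intro continuous_on_diff continuous_on_mult \<sigma>c b continuous_on_const)
qed

lemma picard_measurable:
  assumes g: "continuous_on UNIV g" and J: "\<And>t. t \<ge> 0 \<Longrightarrow> J t \<in> borel_measurable (\<F> t)" and t: "t \<ge> 0"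
  shows "(\<lambda>\<omega>. picard g (\<lambda>s. J s \<omega>) n t) \<in> borel_measurable (\<F> t)"
  using t
proof (induction n arbitrary: t)
  case 0 then show ?case using J by simp
next
  case (Suc n)
  have g_meas: "g \<in> borel_measurable borel" using g by (rule borel_measurable_continuous_onI)
  show ?case
    unfolding picard.simps(2)
  proof (intro borel_measurable_diff J Suc.prems borel_measurable_lim_metric borel_measurable_sum
      borel_measurable_times borel_measurable_const)
    fix m k assume "k \<in> {..<Suc m}"
    then have "grid t m k \<le> t" using grid_bounds(2)[OF Suc.prems, of k m] by simp
    with Suc.IH[OF grid_bounds(1)[OF Suc.prems]]
    have "(\<lambda>\<omega>. picard g (\<lambda>s. J s \<omega>) n (grid t m k)) \<in> borel_measurable (\<F> t)"
      by (rule natural_filtration_mono_measurable)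
    then show "(\<lambda>\<omega>. g (picard g (\<lambda>s. J s \<omega>) n (grid t m k))) \<in> borel_measurable (\<F> t)"
      using g_meas by (rule measurable_compose)
  qed
qed

text \<open>On paths that are not continuous the limits may be meaningless, but they remain adapted, and these paths form a null
set.\<close>
lemma sde_solution_exists:
  assumes f: "locally_lipschitz f" and sign: "\<And>x. x > 0 \<Longrightarrow> f x \<ge> 0" "\<And>x. x < 0 \<Longrightarrow> f x \<le> 0"
    and D: "continuous_on UNIV D" and \<sigma>: "\<And>s. (\<sigma> has_real_derivative D s) (at s)"
  shows "\<exists>X. sde_solution M B f \<sigma> \<xi> X"
proof -
  define J where "J t \<omega> = \<xi> + wiener_integral \<sigma> t \<omega>" for t \<omega>
  define X where "X t \<omega> = solver f (\<lambda>s. J s \<omega>) t" for t \<omega>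
  have fc: "continuous_on S f" for S using f by (rule locally_lipschitz_imp_continuous)
  have good: "AE \<omega> in M. continuous_on {0..} (\<lambda>s. B s \<omega>)"
    using continuous by (simp add: continuous_process_def)
  have Jc: "continuous_on {0..} (\<lambda>s. J s \<omega>)" if b: "continuous_on {0..} (\<lambda>s. B s \<omega>)" for \<omega>
  proof -
    have "continuous_on {0..} (\<lambda>t. \<xi> + path_integral \<sigma> D (\<lambda>s. B s \<omega>) t)"
      by (intro continuous_on_add continuous_on_const path_integral_continuous D \<sigma> b)
    then show ?thesis
      by (rule continuous_on_eq) (simp add: J_def wiener_integral_continuous_path(2)[OF D \<sigma> b])
  qed
  have Xc: "continuous_on {0..} (\<lambda>t. X t \<omega>)" and
    X_eq: "\<And>t. t \<ge> 0 \<Longrightarrow> X t \<omega> = J t \<omega> - integral {0..t} (\<lambda>s. f (X s \<omega>))"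
    if b: "continuous_on {0..} (\<lambda>s. B s \<omega>)" for \<omega>
    unfolding X_def using solver_correct[OF f sign Jc[OF b]] by (auto simp: fun_eq_iff)
  have J_meas: "J t \<in> borel_measurable (\<F> t)" if "t \<ge> 0" for t
    unfolding J_def[abs_def] using that by (intro borel_measurable_add borel_measurable_const wiener_integral_measurable)
  have "sde_solution M B f \<sigma> \<xi> X"
    unfolding sde_solution_def
  proof (intro conjI exI[of _ "wiener_integral \<sigma>"] allI impI)
    show "continuous_process M X"
      unfolding continuous_process_def using good by eventually_elim (rule Xc)
    show "adapted \<F> X"
      unfolding adapted_def X_def[abs_def] solver_def
    proof (intro allI impI borel_measurable_lim_metric picard_measurable J_meas)
      show "continuous_on UNIV (\<lambda>x. f (truncate (real R) x))" for R
        by (intro continuous_on_compose2[OF fc[of UNIV]]) (auto simp: truncate_def intro!: continuous_intros)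
    qed
    show "AE \<omega> in M. X 0 \<omega> = \<xi>"
      using good
    proof eventually_elim
      case (elim \<omega>)
      have "wiener_integral \<sigma> 0 \<omega> = 0"
        using wiener_integral_continuous_path(2)[OF D \<sigma> elim, of 0] by (simp add: path_integral_def)
      then show ?case using X_eq[OF elim, of 0] by (simp add: J_def)
    qed
    fix t :: real assume t: "t \<ge> 0"
    show "has_ito_integral M \<F> B (\<lambda>s _. \<sigma> s) t (wiener_integral \<sigma> t)"
    proof (rule has_ito_integral_exists[OF t])
      show "continuous_on {0..t} \<sigma>"
        by (intro continuous_at_imp_continuous_on ballI DERIV_isCont[OF \<sigma>])
      show "AE \<omega> in M. (\<lambda>m. ito_sum \<sigma> t m \<omega>) \<longlonglongrightarrow> wiener_integral \<sigma> t \<omega>"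
        using good by eventually_elim (rule wiener_integral_continuous_path(1)[OF D \<sigma> _ t])
      show "wiener_integral \<sigma> t \<in> borel_measurable M"
        by (rule filtration_measurable_M[OF wiener_integral_measurable[OF t]])
    qed
  next
    show "AE \<omega> in M. \<forall>t\<ge>0. X t \<omega> = \<xi> - (LBINT s=0..t. f (X s \<omega>)) + wiener_integral \<sigma> t \<omega>"
      using good
    proof eventually_elim
      case (elim \<omega>)
      show ?case
      proof (intro allI impI)
        fix t :: real assume t: "t \<ge> 0"
        have "continuous_on {0..t} (\<lambda>s. f (X s \<omega>))"
          by (rule continuous_on_compose2[OF fc[of UNIV] continuous_on_subset[OF Xc[OF elim]]]) auto
        then show "X t \<omega> = \<xi> - (LBINT s=0..t. f (X s \<omega>)) + wiener_integral \<sigma> t \<omega>"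
          using X_eq[OF elim t] interval_integral_eq_HK[OF t] by (simp add: J_def)
      qed
    qed
  qed
  then show ?thesis by blast
qed

end

section \<open>Rare high spikes and the limit theorem\<close>

context brownian_motion
begin

text \<open>Almost surely all but finitely many summands obey their bounds, by the Borel-Cantelli
lemma; the weights \<open>2 ^ (- (k + 2))\<close> make the bounds add up to \<open>\<epsilon> t\<close>.\<close>
lemma noise_exists:
  assumes \<Gamma>: "continuous_on {0..} \<Gamma>" "\<And>t. t \<ge> 0 \<Longrightarrow> \<Gamma> t > 0" "filterlim \<Gamma> at_top at_top"
    and \<epsilon>: "\<And>t. t \<ge> 0 \<Longrightarrow> \<epsilon> t > 0" "\<And>s t. 0 \<le> s \<Longrightarrow> s \<le> t \<Longrightarrow> \<epsilon> t \<le> \<epsilon> s"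
  obtains \<sigma> D where "\<And>t. (\<sigma> has_real_derivative D t) (at t)" "continuous_on UNIV D"
    "\<And>t. t > 0 \<Longrightarrow> \<sigma> t > 0"
    "\<And>t. t \<ge> 0 \<Longrightarrow> set_integrable lborel {t..} (\<lambda>s. (\<sigma> s)\<^sup>2)" "\<And>t. t \<ge> 0 \<Longrightarrow> tail_energy \<sigma> t \<le> \<epsilon> t"
    "Limsup at_top (\<lambda>t. ereal ((\<sigma> t)\<^sup>2 / \<Gamma> t)) = 1"
    "AE \<omega> in M. \<exists>J T. \<forall>t\<ge>T. \<bar>J - path_integral \<sigma> D (\<lambda>s. B s \<omega>) t\<bar> \<le> \<epsilon> t"
proof -
  define \<epsilon>' where "\<epsilon>' k = \<epsilon> (real k + 2) * (1 / 2) ^ (k + 2)" for k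
  have "\<exists>a a'. noise_piece M B \<Gamma> k (\<epsilon>' k) a a'" for k
    by (rule noise_piece_exists[OF \<Gamma>(1,2)]) (auto simp: \<epsilon>'_def \<epsilon>(1))
  then obtain a a' where np: "\<And>k. noise_piece M B \<Gamma> k (\<epsilon>' k) (a k) (a' k)" by metis
  note nps = noise_piece.deriv[OF np] noise_piece.deriv_continuous[OF np] noise_piece.nonneg[OF np]
    noise_piece.positive[OF np] noise_piece.outside[OF np]
  interpret piece_sum a a'
    by unfold_locales (fact nps | erule nps)+
  have "\<forall>k. \<exists>E. E \<in> sets M \<and> prob E \<le> (1 / 2) ^ k \<and>
      (\<forall>\<omega>\<in>space M - E. continuous_on {0..} (\<lambda>s. B s \<omega>) \<longrightarrow>
        (\<forall>t\<ge>0. \<bar>path_integral (a k) (a' k) (\<lambda>s. B s \<omega>) t\<bar> \<le> \<epsilon>' k))"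
    using noise_piece.unlikely[OF np] unfolding Bex_def by (rule allI)
  from choice[OF this] obtain E where E_all: "\<forall>k. E k \<in> sets M \<and> prob (E k) \<le> (1 / 2) ^ k \<and>
      (\<forall>\<omega>\<in>space M - E k. continuous_on {0..} (\<lambda>s. B s \<omega>) \<longrightarrow>
        (\<forall>t\<ge>0. \<bar>path_integral (a k) (a' k) (\<lambda>s. B s \<omega>) t\<bar> \<le> \<epsilon>' k))" ..
  then have E: "\<And>k. E k \<in> sets M" "\<And>k. prob (E k) \<le> (1 / 2) ^ k"
    "\<And>k \<omega> t. \<omega> \<in> space M - E k \<Longrightarrow> continuous_on {0..} (\<lambda>s. B s \<omega>) \<Longrightarrow> t \<ge> 0 \<Longrightarrow>
      \<bar>path_integral (a k) (a' k) (\<lambda>s. B s \<omega>) t\<bar> \<le> \<epsilon>' k"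
    by blast+
  have "summable (\<lambda>k. prob (E k))"
    by (rule summable_comparison_test_ev[OF always_eventually, of _ "\<lambda>k. (1 / 2) ^ k"])
      (use E(2) in \<open>simp_all add: summable_geometric\<close>)
  then have "AE \<omega> in M. eventually (\<lambda>k. \<omega> \<in> space M - E k) sequentially"
    by (intro borel_cantelli_AE1 E(1)) (simp_all add: less_top[symmetric])
  then have tail: "AE \<omega> in M. \<exists>J T. \<forall>t\<ge>T. \<bar>J - path_integral \<sigma> \<sigma>' (\<lambda>s. B s \<omega>) t\<bar> \<le> \<epsilon> t"
    using continuous[unfolded continuous_process_def]
  proof eventually_elim
    case (elim \<omega>)
    then obtain K where K: "\<And>k. k \<ge> K \<Longrightarrow> \<omega> \<in> space M - E k"
      by (auto simp: eventually_sequentially)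
    have "\<exists>J. \<forall>t\<ge>real K + 2. \<bar>J - path_integral \<sigma> \<sigma>' (\<lambda>s. B s \<omega>) t\<bar> \<le> \<epsilon> t"
    proof (rule path_integral_tail[OF \<epsilon> elim(2)])
      fix k and t :: real assume "K \<le> k" "0 \<le> t"
      then show "\<bar>path_integral (a k) (a' k) (\<lambda>s. B s \<omega>) t\<bar> \<le> \<epsilon> (real k + 2) * (1 / 2) ^ (k + 2)"
        using E(3)[OF K elim(2), of k t] by (simp only: \<epsilon>'_def)
    qed
    then show ?case by blast
  qed
  show ?thesis
  proof (rule that[OF \<sigma>_deriv \<sigma>'_continuous _ _ _ _ tail])
    show "\<sigma> t > 0" if "t > 0" for t using that by (rule \<sigma>_pos)
    show "Limsup at_top (\<lambda>t. ereal ((\<sigma> t)\<^sup>2 / \<Gamma> t)) = 1"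
      by (rule Limsup_ratio[OF \<Gamma>(2,3) noise_piece.peak[OF np] noise_piece.upper[OF np] noise_piece.away[OF np]])
    fix t :: real assume "t \<ge> 0"
    from energy_bound[OF \<epsilon> noise_piece.energy[OF np, unfolded \<epsilon>'_def] this]
    show "set_integrable lborel {t..} (\<lambda>s. (\<sigma> s)\<^sup>2)" "tail_energy \<sigma> t \<le> \<epsilon> t" by simp_all
  qed
qed

text \<open>For every fixed time the two sides agree almost surely. Rational times and continuity give one null set for all
times.\<close>
lemma ito_integral_path_AE:
  assumes D: "continuous_on UNIV D" and \<sigma>: "\<And>s. (\<sigma> has_real_derivative D s) (at s)"
    and I: "\<And>t. t \<ge> 0 \<Longrightarrow> has_ito_integral M \<F> B (\<lambda>s _. \<sigma> s) t (I t)"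
    and Ic: "AE \<omega> in M. continuous_on {0..} (\<lambda>t. I t \<omega>)"
  shows "AE \<omega> in M. \<forall>t\<ge>0. I t \<omega> = path_integral \<sigma> D (\<lambda>s. B s \<omega>) t"
proof -
  have good: "AE \<omega> in M. continuous_on {0..} (\<lambda>s. B s \<omega>)"
    using continuous by (simp add: continuous_process_def)
  have "AE \<omega> in M. \<forall>q\<in>\<rat> \<inter> {0..}. I q \<omega> = wiener_integral \<sigma> q \<omega>"
  proof (rule AE_ball_countable')
    show "countable (\<rat> \<inter> {0::real..})" using countable_rat by (rule countable_Int1)
    fix q :: real assume "q \<in> \<rat> \<inter> {0..}"
    then have q: "q \<ge> 0" by simp
    show "AE \<omega> in M. I q \<omega> = wiener_integral \<sigma> q \<omega>"
    proof (rule has_ito_integral_unique[OF q _ _ _ I[OF q]])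
      show "continuous_on {0..q} \<sigma>"
        by (intro continuous_at_imp_continuous_on ballI DERIV_isCont[OF \<sigma>])
      show "AE \<omega> in M. (\<lambda>m. ito_sum \<sigma> q m \<omega>) \<longlonglongrightarrow> wiener_integral \<sigma> q \<omega>"
        using good by eventually_elim (rule wiener_integral_continuous_path(1)[OF D \<sigma> _ q])
      show "wiener_integral \<sigma> q \<in> borel_measurable M"
        by (rule filtration_measurable_M[OF wiener_integral_measurable[OF q]])
    qed
  qed
  then show ?thesis
    using Ic good
  proof eventually_elim
    case (elim \<omega>)
    let ?d = "\<lambda>t. I t \<omega> - path_integral \<sigma> D (\<lambda>s. B s \<omega>) t"
    have d: "continuous_on {0..} ?d"
      by (intro continuous_on_diff elim(2) path_integral_continuous D \<sigma> elim(3))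
    have d0: "?d q = 0" if "q \<in> \<rat> \<inter> {0..}" for q
      using elim(1) that wiener_integral_continuous_path(2)[OF D \<sigma> elim(3), of q] by simp
    show ?case
    proof (intro allI impI)
      fix t :: real assume t: "t \<ge> 0"
      have "?d t = 0"
      proof (rule ccontr)
        assume "?d t \<noteq> 0"
        then have "\<bar>?d t\<bar> > 0" by simp
        then obtain \<delta> where \<delta>: "\<delta> > 0" "\<And>s. s \<in> {0..} \<Longrightarrow> dist s t < \<delta> \<Longrightarrow> dist (?d s) (?d t) < \<bar>?d t\<bar>"
          using d t unfolding continuous_on_iff by (metis atLeast_iff)
        obtain q where q: "q \<in> \<rat>" "t < q" "q < t + \<delta>"
          using Rats_dense_in_real[of t "t + \<delta>"] \<delta>(1) by auto
        then have "dist (?d q) (?d t) < \<bar>?d t\<bar>" using t by (intro \<delta>(2)) (auto simp: dist_real_def)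
        then show False using d0[of q] q t by (simp add: dist_real_def)
      qed
      then show "I t \<omega> = path_integral \<sigma> D (\<lambda>s. B s \<omega>) t" by simp
    qed
  qed
qed

end

context drift
begin

text \<open>The iterated logarithm costs at most a square root: \<open>ln (ln (1 / \<tau>)) \<le> ln (1 / \<tau>) \<le> 2 / sqrt \<tau>\<close>. Hence the numerator is at
most \<open>4 * sqrt \<tau> \<le> 4 * (\<rho> t) ^ 3\<close>.\<close>
lemma energy_ratio_tendsto_0:
  assumes \<tau>: "\<And>t. t \<ge> 0 \<Longrightarrow> 0 \<le> \<tau> t" "\<And>t. t \<ge> 0 \<Longrightarrow> \<tau> t \<le> tolerance t"
  shows "((\<lambda>t. 2 * \<tau> t * ln (ln (1 / \<tau> t)) / (\<rho> t)\<^sup>2) \<longlongrightarrow> 0) at_top"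
proof (rule Lim_null_comparison)
  have "((\<lambda>t. 4 * \<rho> t) \<longlongrightarrow> 4 * 0) at_top" by (intro tendsto_mult tendsto_const \<rho>_tendsto_0)
  then show "((\<lambda>t. 4 * \<rho> t) \<longlongrightarrow> 0) at_top" by simp
  have "eventually (\<lambda>t. \<rho> t < exp (- 1)) at_top"
    using \<rho>_tendsto_0 by (rule order_tendstoD) simp
  then show "eventually (\<lambda>t. norm (2 * \<tau> t * ln (ln (1 / \<tau> t)) / (\<rho> t)\<^sup>2) \<le> 4 * \<rho> t) at_top"
    using eventually_ge_at_top[of "0::real"]
  proof eventually_elim
    case (elim t)
    have r: "0 < \<rho> t" "\<rho> t \<le> 1" using \<rho>_bounds[of t] elim by auto
    show ?case
    proof (cases "\<tau> t = 0")
      case True then show ?thesis using r by simp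
    next
      case False
      define x where "x = \<tau> t"
      have x: "x > 0" using \<tau>(1)[of t] False elim by (simp add: x_def)
      have "\<rho> t ^ 6 / (t + 1) \<le> \<rho> t ^ 6 / 1" using r elim by (intro divide_left_mono) auto
      then have x6: "x \<le> \<rho> t ^ 6" using \<tau>(2)[of t] tolerance_le_\<rho>6[of t] elim by (simp add: x_def)
      have "\<rho> t ^ 6 \<le> \<rho> t ^ 1" using r by (intro power_decreasing) auto
      then have "x \<le> exp (- 1)" using x6 elim by simp
      then have "ln x \<le> - 1" using ln_le_cancel_iff[of x "exp (- 1)"] x by simp
      define u where "u = - ln x"
      have u: "u \<ge> 1" "ln (1 / x) = u" using \<open>ln x \<le> - 1\<close> x by (auto simp: u_def ln_div)
      have "ln u \<ge> 0" using u by simp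
      have "ln u \<le> u - 1" using u by (intro ln_le_minus_one) simp
      moreover have "ln (1 / sqrt x) \<le> 1 / sqrt x - 1" using x by (intro ln_le_minus_one) simp
      then have "u \<le> 2 * (1 / sqrt x)" using x by (simp add: u_def ln_div ln_sqrt)
      ultimately have "ln u \<le> 2 * (1 / sqrt x)" by linarith
      then have "x * ln u \<le> x * (2 * (1 / sqrt x))" using x by (intro mult_left_mono) auto
      also have "\<dots> = 2 * (x / sqrt x)" by simp
      also have "x / sqrt x = sqrt x" using x by (simp add: real_div_sqrt)
      finally have main: "x * ln u \<le> 2 * sqrt x" .
      have "sqrt x \<le> sqrt ((\<rho> t ^ 3)\<^sup>2)" using x6 by (intro real_sqrt_le_mono) (simp flip: power_mult)
      also have "\<dots> = \<rho> t ^ 3" using r by (simp only: real_sqrt_abs abs_of_nonneg[of "\<rho> t ^ 3"] zero_le_power less_imp_le)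
      finally have "2 * (x * ln u) \<le> 4 * \<rho> t ^ 3" using main by linarith
      also have "\<dots> = 4 * \<rho> t * (\<rho> t)\<^sup>2" by (simp add: power2_eq_square power3_eq_cube)
      finally have "2 * (x * ln u) / (\<rho> t)\<^sup>2 \<le> 4 * \<rho> t" using r by (subst pos_divide_le_eq) auto
      moreover have "0 \<le> 2 * (x * ln u) / (\<rho> t)\<^sup>2" using x \<open>ln u \<ge> 0\<close> r by simp
      ultimately show ?thesis unfolding x_def[symmetric] u(2) by (simp add: mult.assoc)
    qed
  qed
qed

end

text \<open>The two one-sided limits of \<open>f / \<phi>\<close> agree; dividing one by the other eliminates \<open>\<phi>\<close>.\<close>
lemma odd_ratio:
  fixes f \<phi> :: "real \<Rightarrow> real"
  assumes pos: "\<And>x. x > 0 \<Longrightarrow> f x > 0" and \<phi>: "\<And>x. \<phi> (- x) = - \<phi> x"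
    and lim: "((\<lambda>x. f x / \<phi> x) \<longlongrightarrow> 1) (at 0)"
  shows "((\<lambda>x. f (- x) / f x) \<longlongrightarrow> - 1) (at_right 0)"
proof -
  have r: "((\<lambda>x. f x / \<phi> x) \<longlongrightarrow> 1) (at_right 0)" and l: "((\<lambda>x. f x / \<phi> x) \<longlongrightarrow> 1) (at_left 0)"
    using lim by (auto simp: filterlim_at_split)
  have "((\<lambda>x. f (- x) / \<phi> (- x)) \<longlongrightarrow> 1) (at_right 0)"
    using l by (simp add: filterlim_at_left_to_right)
  then have "((\<lambda>x. f (- x) / \<phi> (- x) / (f x / \<phi> x)) \<longlongrightarrow> 1 / 1) (at_right 0)"
    by (rule tendsto_divide[OF _ r]) simp
  then have "((\<lambda>x. - (f (- x) / \<phi> (- x) / (f x / \<phi> x))) \<longlongrightarrow> - 1) (at_right 0)"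
    using tendsto_minus by fastforce
  then show ?thesis
  proof (rule Lim_transform_eventually)
    have "eventually (\<lambda>x. f x / \<phi> x > 0) (at_right 0)"
      using r by (rule order_tendstoD) simp
    then show "eventually (\<lambda>x. - (f (- x) / \<phi> (- x) / (f x / \<phi> x)) = f (- x) / f x) (at_right 0)"
      by eventually_elim (auto simp: \<phi> divide_simps)
  qed
qed

theorem theorem18:
  fixes M :: "'a measure" and B :: "real \<Rightarrow> 'a \<Rightarrow> real"
    and f \<phi> \<Gamma> :: "real \<Rightarrow> real" and \<beta> :: real
  assumes "complete_measure M"
    and "brownian_motion M B"
    and "locally_lipschitz f"
    and "f 0 = 0"
    and "\<And>x. x \<noteq> 0 \<Longrightarrow> x * f x > 0"
    and "\<And>x. \<phi> (- x) = - \<phi> x"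
    and "((\<lambda>x. f x / \<phi> x) \<longlongrightarrow> 1) (at 0)"
    and "\<beta> > 1"
    and "regularly_varying_at_0 \<beta> f"
    and "((\<lambda>x. f x / x) \<longlongrightarrow> 0) (at_right 0)"
    and "C1_on {0..} \<Gamma>"
    and "\<And>t. t \<ge> 0 \<Longrightarrow> \<Gamma> t > 0"
    and "filterlim \<Gamma> at_top at_top"
  shows "\<exists>\<sigma> :: real \<Rightarrow> real.
    continuous_on {0..} \<sigma> \<and>
    set_integrable lborel {0..} (\<lambda>t. (\<sigma> t)\<^sup>2) \<and>
    C1_on {0<..} (\<lambda>t. (\<sigma> t)\<^sup>2) \<and> (\<forall>t>0. (\<sigma> t)\<^sup>2 > 0) \<and>
    ((\<lambda>t. 2 * tail_energy \<sigma> t * ln (ln (1 / tail_energy \<sigma> t)) / (F_inv f t)\<^sup>2) \<longlongrightarrow> 0) at_top \<and>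
    Limsup at_top (\<lambda>t. ereal ((\<sigma> t)\<^sup>2 / \<Gamma> t)) = 1 \<and>
    (\<forall>\<xi> :: real.
      (\<exists>X. sde_solution M B f \<sigma> \<xi> X) \<and>
      (\<forall>X. sde_solution M B f \<sigma> \<xi> X \<longrightarrow>
        (\<exists>\<Lambda>. \<Lambda> \<in> borel_measurable (terminal_sigma M B) \<and>
          (AE \<omega> in M. \<Lambda> \<omega> \<in> {-1, 0, 1}) \<and>
          (AE \<omega> in M. ((\<lambda>t. X t \<omega> / F_inv f t) \<longlongrightarrow> \<Lambda> \<omega>) at_top))))"
proof -
  interpret brownian_motion M B by fact
  interpret drift f \<beta> by unfold_locales (fact assms)+
  have odd: "((\<lambda>x. f (- x) / f x) \<longlongrightarrow> - 1) (at_right 0)"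
    using pos assms(6,7) by (rule odd_ratio)
  have \<Gamma>: "continuous_on {0..} \<Gamma>"
    using assms(11) DERIV_continuous_on unfolding C1_on_def by blast
  obtain \<sigma> D where \<sigma>: "\<And>t. (\<sigma> has_real_derivative D t) (at t)" and D: "continuous_on UNIV D"
    and \<sigma>_pos: "\<And>t. t > 0 \<Longrightarrow> \<sigma> t > 0"
    and energy: "\<And>t. t \<ge> 0 \<Longrightarrow> set_integrable lborel {t..} (\<lambda>s. (\<sigma> s)\<^sup>2)" "\<And>t. t \<ge> 0 \<Longrightarrow> tail_energy \<sigma> t \<le> tolerance t"
    and limsup: "Limsup at_top (\<lambda>t. ereal ((\<sigma> t)\<^sup>2 / \<Gamma> t)) = 1"
    and tail: "AE \<omega> in M. \<exists>J T. \<forall>t\<ge>T. \<bar>J - path_integral \<sigma> D (\<lambda>s. B s \<omega>) t\<bar> \<le> tolerance t"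
  proof (rule noise_exists[where \<epsilon> = tolerance, OF \<Gamma> _ assms(13)])
    show "\<Gamma> t > 0" if "t \<ge> 0" for t using that by (rule assms(12))
    show "tolerance t > 0" if "t \<ge> 0" for t using that by (rule tolerance_pos)
    show "tolerance t \<le> tolerance s" if "0 \<le> s" "s \<le> t" for s t using that by (rule tolerance_antimono)
  qed (rule that, simp_all)
  have \<sigma>c: "continuous_on S \<sigma>" for S
    by (intro continuous_at_imp_continuous_on ballI DERIV_isCont[OF \<sigma>])
  have "C1_on {0<..} (\<lambda>t. (\<sigma> t)\<^sup>2)"
    unfolding C1_on_def
  proof (intro exI conjI ballI)
    show "((\<lambda>t. (\<sigma> t)\<^sup>2) has_real_derivative 2 * \<sigma> t * D t) (at t within {0<..})" for t
      by (rule has_field_derivative_at_within) (auto intro!: derivative_eq_intros \<sigma>)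
    show "continuous_on {0<..} (\<lambda>t. 2 * \<sigma> t * D t)"
      by (intro continuous_on_mult continuous_on_const \<sigma>c continuous_on_subset[OF D]) simp
  qed
  moreover have "((\<lambda>t. 2 * tail_energy \<sigma> t * ln (ln (1 / tail_energy \<sigma> t)) / (F_inv f t)\<^sup>2) \<longlongrightarrow> 0) at_top"
    unfolding \<rho>_def[symmetric]
  proof (rule energy_ratio_tendsto_0)
    show "tail_energy \<sigma> t \<le> tolerance t" if "t \<ge> 0" for t using energy that by simp
    show "0 \<le> tail_energy \<sigma> t" for t
      unfolding tail_energy_def set_lebesgue_integral_def by (rule integral_nonneg_AE) simp
  qed
  moreover have "\<exists>X. sde_solution M B f \<sigma> \<xi> X" for \<xi>
    by (rule sde_solution_exists[OF lipschitz _ _ D \<sigma>]) (use pos neg in \<open>auto intro: less_imp_le\<close>)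
  moreover have "\<exists>\<Lambda>. \<Lambda> \<in> borel_measurable (terminal_sigma M B) \<and>
          (AE \<omega> in M. \<Lambda> \<omega> \<in> {-1, 0, 1}) \<and>
          (AE \<omega> in M. ((\<lambda>t. X t \<omega> / F_inv f t) \<longlongrightarrow> \<Lambda> \<omega>) at_top)"
    if sol: "sde_solution M B f \<sigma> \<xi> X" for \<xi> X
  proof -
    \<comment> \<open>A limit along the integers is measurable for the raw terminal \<open>\<sigma>\<close>-algebra, without completion.\<close>
    define \<Lambda> where "\<Lambda> \<omega> = lim (\<lambda>n. X (real n) \<omega> / \<rho> (real n))" for \<omega>
    obtain I where X: "AE \<omega> in M. continuous_on {0..} (\<lambda>t. X t \<omega>)" "adapted \<F> X"
      and I: "\<And>t. t \<ge> 0 \<Longrightarrow> has_ito_integral M \<F> B (\<lambda>s _. \<sigma> s) t (I t)"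
      and eq: "AE \<omega> in M. \<forall>t\<ge>0. X t \<omega> = \<xi> - (LBINT s=0..t. f (X s \<omega>)) + I t \<omega>"
      using sol unfolding sde_solution_def continuous_process_def by blast
    have \<Lambda>_meas: "\<Lambda> \<in> borel_measurable (terminal_sigma M B)"
      unfolding \<Lambda>_def[abs_def]
    proof (intro borel_measurable_lim_metric borel_measurable_divide borel_measurable_const)
      show "X (real n) \<in> borel_measurable (terminal_sigma M B)" for n
        by (rule terminal_sigma_measurable[of _ _ _ "real n"]) (use X(2) in \<open>simp add: adapted_def\<close>)
    qed
    have fX: "continuous_on {0..} (\<lambda>s. f (X s \<omega>))" if "continuous_on {0..} (\<lambda>t. X t \<omega>)" for \<omega>
      by (rule continuous_on_compose2[OF continuous_f[of UNIV] that]) auto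
    have eq': "AE \<omega> in M. \<forall>t\<ge>0. X t \<omega> = \<xi> - integral {0..t} (\<lambda>s. f (X s \<omega>)) + I t \<omega>"
      using eq X(1)
    proof eventually_elim
      case (elim \<omega>)
      have "(LBINT s=0..t. f (X s \<omega>)) = integral {0..t} (\<lambda>s. f (X s \<omega>))" if "t \<ge> 0" for t
        by (rule interval_integral_eq_HK[OF that continuous_on_subset[OF fX[OF elim(2)]]]) auto
      with elim(1) show ?case by simp
    qed
    have "AE \<omega> in M. continuous_on {0..} (\<lambda>t. I t \<omega>)"
      using eq' X(1)
    proof eventually_elim
      case (elim \<omega>)
      have "continuous_on {0..} (\<lambda>t. X t \<omega> - \<xi> + integral {0..t} (\<lambda>s. f (X s \<omega>)))"
        by (intro continuous_on_add continuous_on_diff elim(2) continuous_on_const continuous_on_nonneg_reals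
            indefinite_integral_continuous_1 integrable_continuous_interval continuous_on_subset[OF fX[OF elim(2)]]) auto
      then show ?case by (rule continuous_on_eq) (use elim(1) in simp)
    qed
    from ito_integral_path_AE[OF D \<sigma> I this]
    have path: "AE \<omega> in M. \<forall>t\<ge>0. I t \<omega> = path_integral \<sigma> D (\<lambda>s. B s \<omega>) t" .
    have "AE \<omega> in M. \<exists>l\<in>{-1, 0, 1}. ((\<lambda>t. X t \<omega> / \<rho> t) \<longlongrightarrow> l) at_top"
      using X(1) eq' path tail
    proof eventually_elim
      case (elim \<omega>)
      then obtain J T where J: "\<And>t. t \<ge> T \<Longrightarrow> \<bar>J - path_integral \<sigma> D (\<lambda>s. B s \<omega>) t\<bar> \<le> tolerance t" by blast
      define \<eta> where "\<eta> t = J - path_integral \<sigma> D (\<lambda>s. B s \<omega>) t" for t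
      \<comment> \<open>Adding the remaining noise \<open>\<eta>\<close> to \<open>X\<close> removes the stochastic integral and leaves a differentiable path.\<close>
      define y where "y t = \<xi> + J - integral {0..t} (\<lambda>s. f (X s \<omega>))" for t
      have Xy: "X t \<omega> = y t - \<eta> t" if "t \<ge> 0" for t
        using elim(2,3) that by (simp add: y_def \<eta>_def)
      have "\<exists>l\<in>{-1, 0, 1}. ((\<lambda>t. (y t - \<eta> t) / \<rho> t) \<longlongrightarrow> l) at_top"
      proof (rule path_limit[OF odd, of "max 0 T"])
        fix t assume t: "max 0 T < t"
        then show "\<bar>\<eta> t\<bar> \<le> tolerance t" using J[of t] by (simp add: \<eta>_def)
        have "((\<lambda>t. integral {0..t} (\<lambda>s. f (X s \<omega>))) has_real_derivative f (X t \<omega>)) (at t within {0..t + 1})"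
          using t by (intro integral_has_real_derivative continuous_on_subset[OF fX[OF elim(1)]]) auto
        then have "((\<lambda>t. integral {0..t} (\<lambda>s. f (X s \<omega>))) has_real_derivative f (X t \<omega>)) (at t)"
          using t at_within_Icc_at[of 0 t "t + 1"] by simp
        then have "(y has_real_derivative 0 - f (X t \<omega>)) (at t)"
          unfolding y_def by (intro DERIV_diff DERIV_const)
        then show "(y has_real_derivative - f (y t - \<eta> t)) (at t)"
          using Xy[of t] t by simp
      qed
      then obtain l where l: "l \<in> {-1, 0, 1}" "((\<lambda>t. (y t - \<eta> t) / \<rho> t) \<longlongrightarrow> l) at_top" by blast
      have "((\<lambda>t. X t \<omega> / \<rho> t) \<longlongrightarrow> l) at_top"
        using l(2)
      proof (rule Lim_transform_eventually)
        show "eventually (\<lambda>t. (y t - \<eta> t) / \<rho> t = X t \<omega> / \<rho> t) at_top"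
          using eventually_ge_at_top[of "0::real"] by eventually_elim (simp add: Xy)
      qed
      with l(1) show ?case by blast
    qed
    then have "AE \<omega> in M. \<Lambda> \<omega> \<in> {-1, 0, 1} \<and> ((\<lambda>t. X t \<omega> / \<rho> t) \<longlongrightarrow> \<Lambda> \<omega>) at_top"
    proof eventually_elim
      case (elim \<omega>)
      then obtain l where l: "l \<in> {-1, 0, 1}" "((\<lambda>t. X t \<omega> / \<rho> t) \<longlongrightarrow> l) at_top" by blast
      have "(\<lambda>n. X (real n) \<omega> / \<rho> (real n)) \<longlonglongrightarrow> l"
        by (rule filterlim_compose[OF l(2) filterlim_real_sequentially])
      then have "\<Lambda> \<omega> = l" unfolding \<Lambda>_def by (rule limI)
      with l show ?case by simp
    qed
    then have "AE \<omega> in M. \<Lambda> \<omega> \<in> {-1, 0, 1}" "AE \<omega> in M. ((\<lambda>t. X t \<omega> / \<rho> t) \<longlongrightarrow> \<Lambda> \<omega>) at_top"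
      unfolding AE_conj_iff by blast+
    with \<Lambda>_meas show ?thesis unfolding \<rho>_def by blast
  qed
  moreover have "(\<sigma> t)\<^sup>2 > 0" if "t > 0" for t
    using \<sigma>_pos[OF that] by (rule zero_less_power)
  ultimately show ?thesis
    using \<sigma>c[of "{0..}"] energy(1)[of 0] limsup by (intro exI[of _ \<sigma>]) blast
qed

end
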